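(* Assume (A.1), (A.2) and (A.3) (stated in the context). Then there exist $\kappa_0>0$ and $h_0>0$ such that, for all $h\le h_0$, the map $T_h=\Pi^{(h)}_{\mathcal B_h}\circ R_h$ is a contraction on $$\mathcal U^h_{\kappa_0}(\widehat{\mathbf P}_h):=\{\mathbf Q_h\in Z_h(\mathbb S^2):\ \|\mathbf Q_h-\widehat{\mathbf P}_h\|_h\le\kappa_0h\}$$ and has a locally unique fixed point $\mathbf P_h^\star\in\mathcal U^h_{\kappa_0}(\widehat{\mathbf P}_h)$. In particular, there exists $q\in(0,1)$, independent of $h$, such that for every initial datum $\mathbf P_h^0\in\mathcal U^h_{\kappa_0}(\widehat{\mathbf P}_h)$ the iteration $\mathbf P_h^{n+1}=T_h(\mathbf P_h^n)$ satisfies $$\|\mathbf P_h^n-\mathbf P_h^\star\|_h\le q^n\|\mathbf P_h^0-\mathbf P_h^\star\|_h,\qquad n\ge0,$$ and hence converges to $\mathbf P_h^\star$. Moreover, there exists $C>0$, independent of $h$, such that $$\|\mathbf P_h^\star-\widehat{\mathbf P}_h\|_h\le C h^{1+\alpha}.$$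
   Context: Mesh and discrete spaces. $\Omega\subset\mathbb R^2$ is a convex polygonal domain and $\{\mathcal T_h\}$ is a shape-regular, quasi-uniform family of triangulations of $\Omega$, with $h_K=\operatorname{diam}(K)$, $h=\max_{K\in\mathcal T_h}h_K$. "Independent of $h$" means uniform over the family. $\mathbb S^2$ is the space of symmetric $2\times2$ real matrices, $\mathbb S^2_{++}$ the positive definite ones, $A:B=\operatorname{tr}(A^\top B)$, $|A|=\sqrt{A:A}$. Fix an integer $m\ge0$. $Z_h$ is the space of $v_h\in L^2(\Omega)$ with $v_h|_K\in\mathbb P_m(K)$ for all $K\in\mathcal T_h$ (no continuity across elements); $Z_h(\mathbb S^2)$ is its $\mathbb S^2$-valued analogue. For each $K$, $\{x_{K,j}\}_{j=1}^{N_m}$, $N_m=\dim\mathbb P_m(K)$, are local nodes obtained from a fixed unisolvent nodal configuration for $\mathbb P_m$ on the reference triangle by the affine map; nodes of different elements are treated as distinct and $v_h(x_{K,j}):=(v_h|_K)(x_{K,j})$. Positive weights $w_{K,j}$ satisfy $w_{K,j}\simeq h_K^2$ uniformly in $K,j,h$. Set $(v_h,z_h)_h=\sum_K\sum_j w_{K,j}v_h(x_{K,j})z_h(x_{K,j})$ (with $:$ in place of the product for matrix fields) and $\|v_h\|_h^2=(v_h,v_h)_h$. $\|\cdot\|_{L^2(\mathcal T_h)}$ is the broken $L^2$ norm, $\|v\|_{L^2(\mathcal T_h)}^2=\sum_K\|v\|_{L^2(K)}^2$. $I_h^Z:C^0(\overline\Omega)\to Z_h$ is the nodal interpolation operator,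 $(I_h^Zv)(x_{K,j})=v(x_{K,j})$, extended componentwise to matrix fields. (A.1) Exact solution. $f\in C^0(\overline\Omega)$ with $0<c_0\le f\le c_1<\infty$, and $u\in W^{3,\infty}(\Omega)\cap H^{m+3}(\Omega)$ is a convex solution of $\det D^2u=f$ in $\Omega$, $u=g$ on $\partial\Omega$ (with $g\in H^{3/2}(\partial\Omega)$), and there are $\nu_1\ge\nu_2>0$ with $\nu_2|\xi|^2\le\xi^TD^2u(x)\xi\le\nu_1|\xi|^2$ for all $\xi\in\mathbb R^2$, $x\in\Omega$; in particular $D^2u\in W^{1,\infty}(\Omega,\mathbb S^2)\cap H^{m+1}(\Omega,\mathbb S^2)$. Set $\widehat{\mathbf P}_h:=I_h^Z(D^2u)$. Constraint set and projection. $\mathcal B_h:=\{\mathbf Q_h\in Z_h(\mathbb S^2):\ \mathbf Q_h(x_{K,j})\in\mathbb S^2_{++},\ \det\mathbf Q_h(x_{K,j})=f(x_{K,j})\ \forall K\in\mathcal T_h,\ j=1,\dots,N_m\}$, and $\Pi^{(h)}_{\mathcal B_h}$ is the metric (nearest point) projection onto $\mathcal B_h$ with respect to $\|\cdot\|_h$. It is a priori set-valued; the assertion that $T_h$ is a contraction includes that it is single-valued where used. Linear reconstruction. $X_h$ is a (finite-dimensional) scalar finite element space, $H_h:X_h\to Z_h(\mathbb S^2)$ a linear operator (discrete Hessian), $J_h:X_h\times X_h\to\mathbb R$ a symmetric positive semidefinite bilinear form, and $\sigma>0$ a fixed constant. Set $a_h(w_h,v_h):=(H_hw_h,H_hv_h)_h+\sigma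 J_h(w_h,v_h)$. Given $\mathbf P_h\in Z_h(\mathbb S^2)$, let $u_h=u_h(\mathbf P_h)\in X_h$ satisfy $a_h(u_h,v_h)=(\mathbf P_h,H_hv_h)_h$ for all $v_h\in X_h$, and set $R_h\mathbf P_h:=H_hu_h(\mathbf P_h)$; this is a well-defined linear map $R_h:Z_h(\mathbb S^2)\to Z_h(\mathbb S^2)$ (even if $u_h$ is not unique, $H_hu_h$ is). (A.2) There is $C>0$, independent of $h$, such that $\|H_hv_h\|_{L^2(\mathcal T_h)}\le\|\operatorname{tr}(H_hv_h)\|_{L^2(\mathcal T_h)}+C\,J_h(v_h,v_h)^{1/2}$ for all $v_h\in X_h$. (A.3) There are $C_R>0$ and $\alpha>0$, independent of $h$, such that $\rho_h:=\|R_h(\widehat{\mathbf P}_h)-\widehat{\mathbf P}_h\|_h\le C_Rh^{1+\alpha}$. *)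

theory Defs
  imports "HOL-Analysis.Analysis"
begin

type_synonym plane = "real^2"
type_synonym mat2 = "real^2^2"

definition Sym2 :: "mat2 set" where
  "Sym2 = {A. transpose A = A}"

definition SPD2 :: "mat2 set" where
  "SPD2 = {A \<in> Sym2. \<forall>\<xi>. \<xi> \<noteq> 0 \<longrightarrow> 0 < \<xi> \<bullet> (A *v \<xi>)}"

text \<open>
  The library inner product and norm on \<^typ>\<open>real^2^2\<close> are the Frobenius ones, so
  \<open>A \<bullet> B\<close> and \<open>norm A\<close> are used for $A:B$ and $|A|$.
\<close>

lemma inner_mat2_eq_trace: "(A::mat2) \<bullet> B = trace (transpose A ** B)"
  by (simp add: trace_def transpose_def matrix_matrix_mult_def inner_vec_def sum_2)


section \<open>Weak derivatives and Sobolev regularity\<close>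

definition partial :: "2 \<Rightarrow> (plane \<Rightarrow> real) \<Rightarrow> plane \<Rightarrow> real" where
  "partial a \<phi> = (\<lambda>x. frechet_derivative \<phi> (at x) (axis a 1))"

text \<open>Multi-indices are lists of coordinate directions; the order is the length of the list.\<close>

definition partials :: "2 list \<Rightarrow> (plane \<Rightarrow> real) \<Rightarrow> plane \<Rightarrow> real" where
  "partials as \<phi> = foldr partial as \<phi>"

definition test_function :: "plane set \<Rightarrow> (plane \<Rightarrow> real) \<Rightarrow> bool" where
  "test_function \<Omega> \<phi> \<longleftrightarrow>
     (\<forall>as x. partials as \<phi> differentiable (at x)) \<and>
     (\<exists>S. compact S \<and> S \<subseteq> \<Omega> \<and> (\<forall>x. x \<notin> S \<longrightarrow> \<phi> x = 0))"

definition loc_integrable :: "plane set \<Rightarrow> (plane \<Rightarrow> real) \<Rightarrow> bool" where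
  "loc_integrable \<Omega> v \<longleftrightarrow> (\<forall>S. compact S \<and> S \<subseteq> \<Omega> \<longrightarrow> integrable (lebesgue_on S) v)"

definition weak_deriv :: "plane set \<Rightarrow> 2 list \<Rightarrow> (plane \<Rightarrow> real) \<Rightarrow> (plane \<Rightarrow> real) \<Rightarrow> bool" where
  "weak_deriv \<Omega> as u v \<longleftrightarrow>
     loc_integrable \<Omega> u \<and> loc_integrable \<Omega> v \<and>
     (\<forall>\<phi>. test_function \<Omega> \<phi> \<longrightarrow>
        (LINT x|lebesgue_on \<Omega>. u x * partials as \<phi> x) =
        (-1) ^ length as * (LINT x|lebesgue_on \<Omega>. v x * \<phi> x))"

definition in_L2 :: "plane set \<Rightarrow> (plane \<Rightarrow> real) \<Rightarrow> bool" where
  "in_L2 \<Omega> v \<longleftrightarrow>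
     v \<in> borel_measurable (lebesgue_on \<Omega>) \<and> integrable (lebesgue_on \<Omega>) (\<lambda>x. (v x)\<^sup>2)"

definition in_Linf :: "plane set \<Rightarrow> (plane \<Rightarrow> real) \<Rightarrow> bool" where
  "in_Linf \<Omega> v \<longleftrightarrow>
     v \<in> borel_measurable (lebesgue_on \<Omega>) \<and> (\<exists>M. AE x in lebesgue_on \<Omega>. \<bar>v x\<bar> \<le> M)"

definition sobolev_H :: "plane set \<Rightarrow> nat \<Rightarrow> (plane \<Rightarrow> real) \<Rightarrow> bool" where
  "sobolev_H \<Omega> k u \<longleftrightarrow>
     (\<forall>as. length as \<le> k \<longrightarrow> (\<exists>v. weak_deriv \<Omega> as u v \<and> in_L2 \<Omega> v))"

definition sobolev_Winf :: "plane set \<Rightarrow> nat \<Rightarrow> (plane \<Rightarrow> real) \<Rightarrow> bool" where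
  "sobolev_Winf \<Omega> k u \<longleftrightarrow>
     (\<forall>as. length as \<le> k \<longrightarrow> (\<exists>v. weak_deriv \<Omega> as u v \<and> in_Linf \<Omega> v))"

text \<open>
  $H^{3/2}(\partial\Omega)$ is the trace space of $H^2(\Omega)$.  In two dimensions $H^2$ functions
  on a convex domain have a representative that is continuous up to the boundary, and the
  trace is its restriction.
\<close>

definition H32_boundary :: "plane set \<Rightarrow> (plane \<Rightarrow> real) \<Rightarrow> bool" where
  "H32_boundary \<Omega> g \<longleftrightarrow>
     (\<exists>G. sobolev_H \<Omega> 2 G \<and> continuous_on (closure \<Omega>) G \<and> (\<forall>x\<in>frontier \<Omega>. G x = g x))"


section \<open>Domain and exact solution\<close>

definition convex_polygonal_domain :: "plane set \<Rightarrow> bool" where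
  "convex_polygonal_domain \<Omega> \<longleftrightarrow>
     open \<Omega> \<and> convex \<Omega> \<and> \<Omega> \<noteq> {} \<and> polytope (closure \<Omega>)"

text \<open>
  \<open>u\<close> and \<open>D2u\<close> stand for the representatives, continuous on the closed domain, of the solution
  and of its weak Hessian; they exist and are unique since $u \<in> W^{3,\infty}(\Omega)$ and
  $\Omega$ is convex.  The values of \<open>D2u\<close> on the closure, including boundary nodes, are the ones
  that nodal interpolation uses.
\<close>

definition exact_solution ::
  "plane set \<Rightarrow> nat \<Rightarrow> (plane \<Rightarrow> real) \<Rightarrow> (plane \<Rightarrow> real) \<Rightarrow> (plane \<Rightarrow> real) \<Rightarrow> (plane \<Rightarrow> mat2) \<Rightarrow> bool"
where
  "exact_solution \<Omega> m f g u D2u \<longleftrightarrow>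
     continuous_on (closure \<Omega>) f \<and>
     (\<exists>c0 c1. 0 < c0 \<and> (\<forall>x\<in>closure \<Omega>. c0 \<le> f x \<and> f x \<le> c1)) \<and>
     H32_boundary \<Omega> g \<and>
     sobolev_Winf \<Omega> 3 u \<and> sobolev_H \<Omega> (m + 3) u \<and>
     continuous_on (closure \<Omega>) u \<and> convex_on \<Omega> u \<and>
     continuous_on (closure \<Omega>) D2u \<and> D2u ` closure \<Omega> \<subseteq> Sym2 \<and>
     (\<forall>a b. weak_deriv \<Omega> [a, b] u (\<lambda>x. D2u x $ a $ b)) \<and>
     (\<forall>x\<in>\<Omega>. det (D2u x) = f x) \<and>
     (\<forall>x\<in>frontier \<Omega>. u x = g x) \<and>
     (\<exists>\<nu>1 \<nu>2. \<nu>1 \<ge> \<nu>2 \<and> \<nu>2 > 0 \<and>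
        (\<forall>x\<in>\<Omega>. \<forall>\<xi>. \<nu>2 * (norm \<xi>)\<^sup>2 \<le> \<xi> \<bullet> (D2u x *v \<xi>) \<and>
                      \<xi> \<bullet> (D2u x *v \<xi>) \<le> \<nu>1 * (norm \<xi>)\<^sup>2))"


section \<open>Discretizations\<close>

text \<open>
  An elementwise (broken) function is given by its restrictions \<open>v K\<close> to the elements \<open>K\<close>, so it
  may have several values at a point shared by elements, and \<open>v K (pts d K j)\<close> is
  $v_h(x_{K,j})$.  For each mesh of the family a discretization collects $\mathcal T_h$, the nodes
  $x_{K,j}$, the weights $w_{K,j}$, the space $X_h$ and the operators $H_h$ and $J_h$.
\<close>

type_synonym 'v broken = "plane set \<Rightarrow> plane \<Rightarrow> 'v"

record discretization =
  cells :: "plane set set"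
  pts :: "plane set \<Rightarrow> nat \<Rightarrow> plane"
  weight :: "plane set \<Rightarrow> nat \<Rightarrow> real"
  Xspace :: "real broken set"
  Hess :: "real broken \<Rightarrow> mat2 broken"
  Jform :: "real broken \<Rightarrow> real broken \<Rightarrow> real"

definition mesh_of :: "plane set \<Rightarrow> plane set set \<Rightarrow> bool" where
  "mesh_of \<Omega> T \<longleftrightarrow> triangulation T \<and> (\<forall>K\<in>T. 2 simplex K) \<and> \<Union>T = closure \<Omega>"

definition meshsize :: "discretization \<Rightarrow> real" where
  "meshsize d = Max (diameter ` cells d)"

definition shape_regular :: "('i \<Rightarrow> discretization) \<Rightarrow> bool" where
  "shape_regular D \<longleftrightarrow>
     (\<exists>\<gamma>>0. \<forall>i. \<forall>K\<in>cells (D i). \<exists>x. cball x (\<gamma> * diameter K) \<subseteq> K)"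

definition quasi_uniform :: "('i \<Rightarrow> discretization) \<Rightarrow> bool" where
  "quasi_uniform D \<longleftrightarrow>
     (\<exists>\<gamma>>0. \<forall>i. \<forall>K\<in>cells (D i). \<gamma> * meshsize (D i) \<le> diameter K)"

text \<open>Polynomials of total degree at most \<open>m\<close> with coefficients in \<open>V\<close>.\<close>

definition polys :: "nat \<Rightarrow> 'v::real_vector set \<Rightarrow> (plane \<Rightarrow> 'v) set" where
  "polys m V = {p. \<exists>c. (\<forall>a b. c a b \<in> V) \<and>
     p = (\<lambda>x. \<Sum>a\<le>m. \<Sum>b\<le>m - a. ((x$1) ^ a * (x$2) ^ b) *\<^sub>R c a b)}"

definition Npoly :: "nat \<Rightarrow> nat" where
  "Npoly m = (m + 2) choose 2"

definition ref_triangle :: "plane set" where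
  "ref_triangle = convex hull {0, axis 1 1, axis 2 1}"

definition unisolvent :: "nat \<Rightarrow> (nat \<Rightarrow> plane) \<Rightarrow> bool" where
  "unisolvent m xhat \<longleftrightarrow>
     (\<forall>j<Npoly m. xhat j \<in> ref_triangle) \<and>
     (\<forall>b :: nat \<Rightarrow> real. \<exists>!p. p \<in> polys m UNIV \<and> (\<forall>j<Npoly m. p (xhat j) = b j))"

definition affine_nodes :: "nat \<Rightarrow> (nat \<Rightarrow> plane) \<Rightarrow> discretization \<Rightarrow> bool" where
  "affine_nodes m xhat d \<longleftrightarrow>
     (\<forall>K\<in>cells d. \<exists>(A::mat2) b.
        (\<lambda>x. A *v x + b) ` ref_triangle = K \<and> (\<forall>j<Npoly m. pts d K j = A *v xhat j + b))"

definition weights_ok :: "nat \<Rightarrow> ('i \<Rightarrow> discretization) \<Rightarrow> bool" where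
  "weights_ok m D \<longleftrightarrow>
     (\<exists>c>0. \<exists>C>0. \<forall>i. \<forall>K\<in>cells (D i). \<forall>j<Npoly m.
        0 < weight (D i) K j \<and>
        c * (diameter K)\<^sup>2 \<le> weight (D i) K j \<and> weight (D i) K j \<le> C * (diameter K)\<^sup>2)"

text \<open>
  $Z_h$ for \<open>V = UNIV :: real set\<close> and $Z_h(\mathbb S^2)$ for \<open>V = Sym2\<close>.  The polynomial \<open>v K\<close> is
  taken on the whole plane (it is determined by its values on \<open>K\<close>) and \<open>v\<close> is zero outside the
  mesh, so equality in \<open>Zspace\<close> is equality in $L^2(\Omega)$.
\<close>

definition Zspace :: "nat \<Rightarrow> discretization \<Rightarrow> 'v::real_vector set \<Rightarrow> 'v broken set" where
  "Zspace m d V =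
     {v. (\<forall>K\<in>cells d. v K \<in> polys m V) \<and> (\<forall>K. K \<notin> cells d \<longrightarrow> v K = (\<lambda>_. 0))}"

definition hinner :: "nat \<Rightarrow> discretization \<Rightarrow> 'v::real_inner broken \<Rightarrow> 'v broken \<Rightarrow> real" where
  "hinner m d v z =
     (\<Sum>K\<in>cells d. \<Sum>j<Npoly m. weight d K j * (v K (pts d K j) \<bullet> z K (pts d K j)))"

definition hnorm :: "nat \<Rightarrow> discretization \<Rightarrow> 'v::real_inner broken \<Rightarrow> real" where
  "hnorm m d v = sqrt (hinner m d v v)"

definition broken_L2 :: "discretization \<Rightarrow> 'v::real_normed_vector broken \<Rightarrow> real" where
  "broken_L2 d v = sqrt (\<Sum>K\<in>cells d. LINT x|lebesgue_on K. (norm (v K x))\<^sup>2)"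

definition interp :: "nat \<Rightarrow> discretization \<Rightarrow> (plane \<Rightarrow> real) \<Rightarrow> real broken" where
  "interp m d w = (THE v. v \<in> Zspace m d UNIV \<and>
     (\<forall>K\<in>cells d. \<forall>j<Npoly m. v K (pts d K j) = w (pts d K j)))"

definition interp_mat :: "nat \<Rightarrow> discretization \<Rightarrow> (plane \<Rightarrow> mat2) \<Rightarrow> mat2 broken" where
  "interp_mat m d W = (\<lambda>K x. \<chi> a b. interp m d (\<lambda>y. W y $ a $ b) K x)"


section \<open>Linear reconstruction\<close>

definition lincomb ::
  "real \<Rightarrow> 'v::real_vector broken \<Rightarrow> real \<Rightarrow> 'v broken \<Rightarrow> 'v broken" where
  "lincomb r v s w = (\<lambda>K x. r *\<^sub>R v K x + s *\<^sub>R w K x)"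

text \<open>Finite-dimensional linear space: the span of a finite set of elementwise functions.\<close>

definition fin_dim_space :: "real broken set \<Rightarrow> bool" where
  "fin_dim_space X \<longleftrightarrow>
     (\<exists>B. finite B \<and> X = {v. \<exists>c. v = (\<lambda>K x. \<Sum>b\<in>B. c b * b K x)})"

definition reconstruction_ok :: "nat \<Rightarrow> discretization \<Rightarrow> bool" where
  "reconstruction_ok m d \<longleftrightarrow>
     fin_dim_space (Xspace d) \<and>
     (\<forall>v\<in>Xspace d. Hess d v \<in> Zspace m d Sym2) \<and>
     (\<forall>v\<in>Xspace d. \<forall>w\<in>Xspace d. \<forall>r s.
        Hess d (lincomb r v s w) = lincomb r (Hess d v) s (Hess d w)) \<and>
     (\<forall>v\<in>Xspace d. \<forall>w\<in>Xspace d. \<forall>z\<in>Xspace d. \<forall>r s.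
        Jform d (lincomb r v s w) z = r * Jform d v z + s * Jform d w z) \<and>
     (\<forall>v\<in>Xspace d. \<forall>w\<in>Xspace d. Jform d v w = Jform d w v) \<and>
     (\<forall>v\<in>Xspace d. 0 \<le> Jform d v v)"

definition aform :: "nat \<Rightarrow> real \<Rightarrow> discretization \<Rightarrow> real broken \<Rightarrow> real broken \<Rightarrow> real" where
  "aform m \<sigma> d w v = hinner m d (Hess d w) (Hess d v) + \<sigma> * Jform d w v"

text \<open>The solution chosen by \<open>SOME\<close> need not be unique, but its discrete Hessian is.\<close>

definition Rmap :: "nat \<Rightarrow> real \<Rightarrow> discretization \<Rightarrow> mat2 broken \<Rightarrow> mat2 broken" where
  "Rmap m \<sigma> d P = Hess d (SOME u. u \<in> Xspace d \<and>
     (\<forall>v\<in>Xspace d. aform m \<sigma> d u v = hinner m d P (Hess d v)))"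


section \<open>Constraint set, projection and fixed-point map\<close>

definition Bset :: "nat \<Rightarrow> discretization \<Rightarrow> (plane \<Rightarrow> real) \<Rightarrow> mat2 broken set" where
  "Bset m d f = {Q \<in> Zspace m d Sym2. \<forall>K\<in>cells d. \<forall>j<Npoly m.
     Q K (pts d K j) \<in> SPD2 \<and> det (Q K (pts d K j)) = f (pts d K j)}"

definition nearest :: "nat \<Rightarrow> discretization \<Rightarrow> mat2 broken set \<Rightarrow> mat2 broken \<Rightarrow> mat2 broken set" where
  "nearest m d B Q = {P \<in> B. \<forall>S\<in>B. hnorm m d (Q - P) \<le> hnorm m d (Q - S)}"

text \<open>Meaningful only where the set of nearest points is a singleton.\<close>

definition Tmap ::
  "nat \<Rightarrow> real \<Rightarrow> discretization \<Rightarrow> (plane \<Rightarrow> real) \<Rightarrow> mat2 broken \<Rightarrow> mat2 broken" where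
  "Tmap m \<sigma> d f Q = (THE P. P \<in> nearest m d (Bset m d f) (Rmap m \<sigma> d Q))"

definition nbhd :: "nat \<Rightarrow> discretization \<Rightarrow> mat2 broken \<Rightarrow> real \<Rightarrow> mat2 broken set" where
  "nbhd m d P r = {Q \<in> Zspace m d Sym2. hnorm m d (Q - P) \<le> r}"

end

theory Submission
  imports Defs
begin

text \<open>
  The projection onto the constraint set acts node by node, because a broken polynomial is determined
  by arbitrary nodal values.  At a node the constraint is a sheet of the hyperboloid
  $\det P = f$, and in dimension two $\det$ is a quadratic form whose polar form is
  $(P,Q) \mapsto \mathrm{cof}\, P : Q$.  A closest point $P$ to $X$ satisfies
  $X - P = r\, \mathrm{cof}\, P$, and for two such pairs one gets the exact identity
  $(X - Y):(P - Q) = |P - Q|^2 + (r + s) \det (P - Q)$.  Near the surface the multipliers are small, so the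
  projection is single-valued there and almost firmly nonexpansive, and differences of projections are
  almost tangent to the surface (\<open>closest_local\<close>).

  Let $E$ be the difference of two elements of the neighbourhood, $W = H_h w$ the difference of their
  reconstructions and $D$ the difference of the projections.  The variational equation gives
  $\|W\|_h^2 + 2 \sigma J_h(w,w) \le \|E\|_h^2$ (\<open>Rmap_energy\<close>), and the monotonicity of the
  projection gives $\|W - D\|_h^2 + (1 - 2\beta) \|D\|_h^2 \le \|W\|_h^2$ with a small $\beta$.  Without further
  information this is only nonexpansiveness up to $\beta$.  The gain comes from the hypothesis that
  compares discrete Hessians with their traces: if the penalty $J_h(w,w)$ and the normal component of $W$
  were both small, then $W$ would be almost tangent, that is $A : W \approx 0$ with $A$ the cofactor matrix of
  the exact Hessian; by the Cordes inequality (\<open>cordes\<close>) the trace of such a $W$ has a norm strictly smaller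
  than that of $W$, which contradicts the hypothesis unless $W$ is small.  Quantitatively,
  $\|W\|_h^2 \le K_0 (J_h(w,w) + \|A : W\|_h^2)$ for small $h$ (\<open>broken_stability\<close>,
  \<open>uniform_stability\<close>).  As the normal component of $W$ is bounded by $W - D$ and $\beta D$, the two losses
  above together dominate a fixed fraction of $\|D\|_h^2$, and the map is a contraction with a factor independent
  of $h$ (\<open>projected_step\<close>).

  The stability estimate must pass between nodal and $L^2$ norms.  On polynomials of fixed degree they are
  equivalent after scaling to the reference triangle (\<open>cell_norm_equivalence\<close>), and replacing $A$ by a constant on
  each cell makes the normal component a polynomial, with an error governed by the modulus of continuity of
  the exact Hessian.

  The interpolated Hessian lies in the constraint set, so the map moves it by at most twice the
  consistency error, of order $h^{1+\alpha}$, which is small against the radius $\kappa_0 h$.  Hence the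
  neighbourhood is mapped to itself, and the fixed point obeys the same error bound (\<open>local_convergence\<close>).
\<close>

section \<open>Polynomials of bounded total degree\<close>

lemma sum_triangle_delta:
  fixes c :: "nat \<Rightarrow> nat \<Rightarrow> 'a::real_vector"
  assumes "a + b \<le> m"
  shows "(\<Sum>a'\<le>m. \<Sum>b'\<le>m - a'. if a' = a \<and> b' = b then c a' b' else 0) = c a b"
proof -
  have "(\<Sum>a'\<le>m. \<Sum>b'\<le>m - a'. if a' = a \<and> b' = b then c a' b' else 0)
      = (\<Sum>a'\<le>m. if a' = a then (\<Sum>b'\<le>m - a'. if b' = b then c a' b' else 0) else 0)"
    by (rule sum.cong) auto
  also have "\<dots> = (\<Sum>b'\<le>m - a. if b' = b then c a b' else 0)"
    using assms by (simp add: sum.delta)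
  also have "\<dots> = c a b" using assms by (simp add: sum.delta le_diff_conv2)
  finally show ?thesis .
qed

lemma polys_monomial:
  assumes "a + b \<le> m" and "k \<in> V" and "0 \<in> V"
  shows "(\<lambda>x. ((x$1) ^ a * (x$2) ^ b) *\<^sub>R k) \<in> polys m V"
  unfolding polys_def
proof (intro CollectI exI conjI ext)
  let ?c = "\<lambda>a' b'. if a' = a \<and> b' = b then k else 0"
  show "\<forall>a b. ?c a b \<in> V" using assms by auto
  fix x :: plane
  have "(\<Sum>a'\<le>m. \<Sum>b'\<le>m - a'. (x $ 1 ^ a' * x $ 2 ^ b') *\<^sub>R ?c a' b')
     = (\<Sum>a'\<le>m. \<Sum>b'\<le>m - a'. if a' = a \<and> b' = b then (x $ 1 ^ a' * x $ 2 ^ b') *\<^sub>R k else 0)"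
    by (intro sum.cong) auto
  then show "((x$1) ^ a * (x$2) ^ b) *\<^sub>R k = (\<Sum>a'\<le>m. \<Sum>b'\<le>m - a'. (x $ 1 ^ a' * x $ 2 ^ b') *\<^sub>R ?c a' b')"
    using sum_triangle_delta[OF assms(1), of "\<lambda>a' b'. (x $ 1 ^ a' * x $ 2 ^ b') *\<^sub>R k"] by simp
qed

lemma polys_add:
  assumes "p \<in> polys m UNIV" "q \<in> polys m UNIV"
  shows "(\<lambda>x. p x + q x) \<in> polys m UNIV"
proof -
  obtain c d where "p = (\<lambda>x. \<Sum>a\<le>m. \<Sum>b\<le>m - a. ((x$1) ^ a * (x$2) ^ b) *\<^sub>R c a b)"
    and "q = (\<lambda>x. \<Sum>a\<le>m. \<Sum>b\<le>m - a. ((x$1) ^ a * (x$2) ^ b) *\<^sub>R d a b)"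
    using assms by (auto simp: polys_def)
  then show ?thesis
    unfolding polys_def
    by (auto intro!: exI[of _ "\<lambda>a b. c a b + d a b"] simp: sum.distrib scaleR_add_right)
qed

lemma polys_scale:
  assumes "p \<in> polys m UNIV"
  shows "(\<lambda>x. r *\<^sub>R p x) \<in> polys m UNIV"
proof -
  obtain c where "p = (\<lambda>x. \<Sum>a\<le>m. \<Sum>b\<le>m - a. ((x$1) ^ a * (x$2) ^ b) *\<^sub>R c a b)"
    using assms by (auto simp: polys_def)
  then show ?thesis
    unfolding polys_def
    by (auto intro!: exI[of _ "\<lambda>a b. r *\<^sub>R c a b"] simp: scaleR_sum_right mult.commute)
qed

lemma polys_0: "(\<lambda>x. 0) \<in> polys m UNIV"
  unfolding polys_def by (auto intro!: exI[of _ "\<lambda>a b. 0"])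

lemma polys_sum:
  assumes "\<And>i. i \<in> I \<Longrightarrow> p i \<in> polys m UNIV"
  shows "(\<lambda>x. \<Sum>i\<in>I. p i x) \<in> polys m UNIV"
  using assms
proof (induction I rule: infinite_finite_induct)
  case (insert i I)
  then show ?case using polys_add[of "p i" m "\<lambda>x. \<Sum>i\<in>I. p i x"] by auto
qed (auto simp: polys_0)

lemma polys_cmult: 
  fixes p :: "plane \<Rightarrow> real"
  shows "p \<in> polys m UNIV \<Longrightarrow> (\<lambda>x. r * p x) \<in> polys m UNIV"
  using polys_scale[of p m r] by simp

lemma polys_real_expand:
  fixes p :: "plane \<Rightarrow> real"
  assumes "p \<in> polys m UNIV"
  obtains c where "p = (\<lambda>x. \<Sum>a\<le>m. \<Sum>b\<le>m - a. c a b * ((x$1) ^ a * (x$2) ^ b))"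
  using assms by (auto simp: polys_def mult.commute)

lemma polys_real_monomial:
  "a + b \<le> m \<Longrightarrow> (\<lambda>x. (x$1) ^ a * (x$2) ^ b) \<in> polys m (UNIV :: real set)"
  using polys_monomial[of a b m "1::real" UNIV] by simp

lemma polys_mono:
  assumes "p \<in> polys n (UNIV :: real set)" "n \<le> m"
  shows "p \<in> polys m UNIV"
proof -
  obtain c where p: "p = (\<lambda>x. \<Sum>a\<le>n. \<Sum>b\<le>n - a. c a b * ((x$1) ^ a * (x$2) ^ b))"
    using assms(1) by (rule polys_real_expand)
  show ?thesis
    unfolding p using assms(2)
    by (intro polys_sum polys_cmult polys_real_monomial) auto
qed

lemma polys_times_affine:
  assumes "p \<in> polys n (UNIV :: real set)"
  shows "(\<lambda>x. (\<alpha> * x$1 + \<beta> * x$2 + \<gamma>) * p x) \<in> polys (Suc n) UNIV"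
proof -
  obtain c where p: "p = (\<lambda>x. \<Sum>a\<le>n. \<Sum>b\<le>n - a. c a b * ((x$1) ^ a * (x$2) ^ b))"
    using assms by (rule polys_real_expand)
  have eq: "(\<lambda>x. (\<alpha> * x$1 + \<beta> * x$2 + \<gamma>) * p x) = (\<lambda>x. \<Sum>a\<le>n. \<Sum>b\<le>n - a.
      (\<alpha> * c a b) * ((x$1) ^ Suc a * (x$2) ^ b) + (\<beta> * c a b) * ((x$1) ^ a * (x$2) ^ Suc b)
        + (\<gamma> * c a b) * ((x$1) ^ a * (x$2) ^ b))"
    unfolding p by (auto simp: sum_distrib_left algebra_simps sum.distrib)
  show ?thesis
    unfolding eq
    by (intro polys_sum polys_add polys_cmult polys_real_monomial) auto
qed

text \<open>Total degree is invariant under affine substitutions, because multiplying by an affine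
  function raises it by at most one.\<close>

lemma polys_affine_comp:
  assumes "p \<in> polys m (UNIV :: real set)"
  shows "(\<lambda>x. p ((A :: mat2) *v x + b)) \<in> polys m UNIV"
proof -
  obtain c where p: "p = (\<lambda>x. \<Sum>a\<le>m. \<Sum>b\<le>m - a. c a b * ((x$1) ^ a * (x$2) ^ b))"
    using assms by (rule polys_real_expand)
  define l where "l k x = A$k$1 * x$1 + A$k$2 * x$2 + b$k" for k and x :: plane
  have comp: "(A *v x + b)$k = l k x" for k x
    by (simp add: l_def matrix_vector_mult_def sum_2)
  have times: "(\<lambda>x. l k x * q x) \<in> polys (Suc n) UNIV" if "q \<in> polys n UNIV" for k q n
    unfolding l_def by (rule polys_times_affine[OF that])
  have one: "(\<lambda>x. 1) \<in> polys 0 (UNIV :: real set)"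
    using polys_real_monomial[of 0 0 0] by simp
  have pow2: "(\<lambda>x. l 2 x ^ b) \<in> polys b UNIV" for b
    by (induction b) (auto simp: one times)
  have prods: "(\<lambda>x. l 1 x ^ a * l 2 x ^ b) \<in> polys (a + b) UNIV" for a b
    by (induction a) (auto simp: pow2 times mult.assoc)
  show ?thesis
    unfolding p comp
    by (intro polys_sum polys_cmult polys_mono[OF prods]) auto
qed

lemma polys_continuous:
  assumes "p \<in> polys m (UNIV :: real set)"
  shows "continuous_on S p"
  using assms by (rule polys_real_expand) (auto intro!: continuous_intros)

lemma polys_component:
  fixes p :: "plane \<Rightarrow> mat2"
  assumes "p \<in> polys m V"
  shows "(\<lambda>x. p x $ k $ l) \<in> polys m UNIV"
proof -
  obtain c where p: "p = (\<lambda>x. \<Sum>a\<le>m. \<Sum>b\<le>m - a. ((x$1) ^ a * (x$2) ^ b) *\<^sub>R c a b)"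
    using assms by (auto simp: polys_def)
  have eq: "(\<lambda>x. p x $ k $ l) = (\<lambda>x. \<Sum>a\<le>m. \<Sum>b\<le>m - a. ((x$1) ^ a * (x$2) ^ b) *\<^sub>R c a b $ k $ l)"
    unfolding p by simp
  show ?thesis unfolding eq polys_def by auto
qed

lemma Sym2_iff: "A \<in> Sym2 \<longleftrightarrow> A$1$2 = A$2$1"
  by (auto simp: Sym2_def transpose_def vec_eq_iff forall_2)

lemma polys_Sym2_value:
  assumes "p \<in> polys m Sym2"
  shows "p x \<in> Sym2"
proof -
  obtain c where p: "p = (\<lambda>x. \<Sum>a\<le>m. \<Sum>b\<le>m - a. ((x$1) ^ a * (x$2) ^ b) *\<^sub>R c a b)"
    and "\<And>a b. c a b \<in> Sym2"
    using assms by (auto simp: polys_def)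
  then show ?thesis
    by (simp add: Sym2_iff)
qed

lemma polys_Sym2I:
  fixes p :: "plane \<Rightarrow> mat2"
  assumes comp: "\<And>k l. (\<lambda>x. p x $ k $ l) \<in> polys m UNIV"
    and sym: "\<And>x. p x \<in> Sym2"
  shows "p \<in> polys m Sym2"
proof -
  \<comment> \<open>The coefficients are a function of the component function, so symmetric components get
     symmetric coefficients.\<close>
  define rep where "rep c = (\<lambda>x::plane. \<Sum>a\<le>m. \<Sum>b\<le>m - a. ((x$1) ^ a * (x$2) ^ b) *\<^sub>R (c a b :: real))"
    for c
  define coef where "coef q = (SOME c. q = rep c)" for q
  have coef: "q = rep (coef q)" if "q \<in> polys m UNIV" for q
  proof -
    have "\<exists>c. q = rep c" using that by (auto simp: polys_def rep_def)
    then show ?thesis unfolding coef_def by (rule someI_ex)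
  qed
  define c where "c a b = (\<chi> k l. coef (\<lambda>x. p x $ k $ l) a b)" for a b
  have "(\<lambda>x. p x $ 1 $ 2) = (\<lambda>x. p x $ 2 $ 1)"
    using sym by (simp add: Sym2_iff)
  then have "c a b \<in> Sym2" for a b
    by (simp add: Sym2_iff c_def)
  moreover have "p = (\<lambda>x. \<Sum>a\<le>m. \<Sum>b\<le>m - a. ((x$1) ^ a * (x$2) ^ b) *\<^sub>R c a b)"
  proof
    fix x
    have "p x $ k $ l = (\<Sum>a\<le>m. \<Sum>b\<le>m - a. ((x$1) ^ a * (x$2) ^ b) *\<^sub>R c a b) $ k $ l" for k l
      using fun_cong[OF coef[OF comp[of k l]], of x] by (simp add: c_def rep_def)
    then show "p x = (\<Sum>a\<le>m. \<Sum>b\<le>m - a. ((x$1) ^ a * (x$2) ^ b) *\<^sub>R c a b)"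
      by (simp add: vec_eq_iff)
  qed
  ultimately show ?thesis by (auto simp: polys_def)
qed

section \<open>Closest points on the determinant surface\<close>

text \<open>In dimension two the cofactor matrix is a linear function of the matrix (Cayley--Hamilton), which
  makes the determinant a quadratic form.\<close>

definition cof :: "mat2 \<Rightarrow> mat2" where
  "cof A = trace A *\<^sub>R mat 1 - transpose A"

text \<open>For positive \<open>t\<close>, one sheet of a two-sheeted hyperboloid in the three-dimensional space of symmetric matrices: the
  admissible values of the constraint at one node.\<close>

definition det_surface :: "real \<Rightarrow> mat2 set" where
  "det_surface t = {A \<in> SPD2. det A = t}"

definition closest :: "mat2 set \<Rightarrow> mat2 \<Rightarrow> mat2 \<Rightarrow> bool" where
  "closest S X P \<longleftrightarrow> P \<in> S \<and> (\<forall>A\<in>S. norm (X - P) \<le> norm (X - A))"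

lemma trace_mat2: "trace (A::mat2) = A$1$1 + A$2$2"
  by (simp add: trace_def sum_2)

lemma cof_component:
  "cof A $1$1 = A$2$2" "cof A $1$2 = - A$2$1" "cof A $2$1 = - A$1$2" "cof A $2$2 = A$1$1"
  by (simp_all add: cof_def trace_mat2 mat_def transpose_def)

lemma inner_mat2: "(A::mat2) \<bullet> B = A$1$1 * B$1$1 + A$1$2 * B$1$2 + A$2$1 * B$2$1 + A$2$2 * B$2$2"
  by (simp add: inner_vec_def sum_2)

lemma norm_mat2: "(norm (A::mat2))\<^sup>2 = (A$1$1)\<^sup>2 + (A$1$2)\<^sup>2 + (A$2$1)\<^sup>2 + (A$2$2)\<^sup>2"
  unfolding power2_norm_eq_inner inner_mat2 by (simp add: power2_eq_square)

lemma mat2_eq_iff: "(A::mat2) = B \<longleftrightarrow> A$1$1 = B$1$1 \<and> A$1$2 = B$1$2 \<and> A$2$1 = B$2$1 \<and> A$2$2 = B$2$2"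
  by (auto simp: vec_eq_iff forall_2)

lemma norm_cof: "norm (cof A) = norm A"
proof -
  have "(norm (cof A))\<^sup>2 = (norm A)\<^sup>2"
    by (simp add: norm_mat2 cof_component)
  then show ?thesis by simp
qed

lemma cof_diff: "cof (A - B) = cof A - cof B"
  by (simp add: mat2_eq_iff cof_component)

lemma cof_add: "cof (A + B) = cof A + cof B"
  by (simp add: mat2_eq_iff cof_component)

lemma det_le_norm: "\<bar>2 * det (A::mat2)\<bar> \<le> (norm A)\<^sup>2"
proof -
  have "(norm A)\<^sup>2 - 2 * det A = (A$1$1 - A$2$2)\<^sup>2 + (A$1$2 + A$2$1)\<^sup>2"
    "(norm A)\<^sup>2 + 2 * det A = (A$1$1 + A$2$2)\<^sup>2 + (A$1$2 - A$2$1)\<^sup>2"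
    unfolding norm_mat2 det_2 by (simp_all add: power2_eq_square algebra_simps)
  then have "0 \<le> (norm A)\<^sup>2 - 2 * det A" "0 \<le> (norm A)\<^sup>2 + 2 * det A"
    by (metis add_nonneg_nonneg zero_le_power2)+
  then show ?thesis by (simp add: abs_le_iff)
qed

text \<open>The determinant is a quadratic form on the matrices, with polar form \<open>cof P \<bullet> Q\<close>, so
  the difference of two matrices of equal determinant is exactly orthogonal to the cofactor matrix
  of their mean.\<close>

lemma det_polar:
  assumes "det (P::mat2) = det Q"
  shows "cof P \<bullet> (P - Q) = det (P - Q)" "cof Q \<bullet> (P - Q) = - det (P - Q)"
    "cof (P + Q) \<bullet> (P - Q) = 0"
  using assms by (simp_all add: inner_mat2 cof_component det_2 algebra_simps)

lemma det_surface_pos: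
  assumes "A \<in> det_surface t"
  shows "0 < A$1$1" "0 < A$2$2" "A$1$2 = A$2$1" "A$1$1 * A$2$2 - A$1$2 * A$1$2 = t" "0 < t"
proof -
  have "A \<in> Sym2" and pos: "\<And>\<xi>. \<xi> \<noteq> 0 \<Longrightarrow> 0 < \<xi> \<bullet> (A *v \<xi>)" and det: "det A = t"
    using assms by (auto simp: det_surface_def SPD2_def)
  then show sym: "A$1$2 = A$2$1" by (simp add: Sym2_iff)
  have ax: "axis 1 1 \<noteq> (0::plane)" "axis 2 1 \<noteq> (0::plane)" by auto
  show p1: "0 < A$1$1"
    using pos[OF ax(1)] by (simp add: inner_vec_def sum_2 matrix_vector_mult_def axis_def)
  show "0 < A$2$2"
    using pos[OF ax(2)] by (simp add: inner_vec_def sum_2 matrix_vector_mult_def axis_def)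
  show eq: "A$1$1 * A$2$2 - A$1$2 * A$1$2 = t"
    using det sym by (simp add: det_2)
  define v :: plane where "v = (\<chi> k. if k = 1 then - A$1$2 else A$1$1)"
  have "v $ 2 \<noteq> 0" using p1 by (simp add: v_def)
  then have "v \<noteq> 0" by auto
  moreover have "v \<bullet> (A *v v) = A$1$1 * (A$1$1 * A$2$2 - A$1$2 * A$1$2)"
    by (simp add: inner_vec_def sum_2 matrix_vector_mult_def v_def sym algebra_simps)
  ultimately have "0 < A$1$1 * t" using pos[of v] eq by simp
  then show "0 < t" using p1 by (simp add: zero_less_mult_iff)
qed

text \<open>Weak inequalities for the diagonal suffice, since their product is positive; this is what makes the
  surface closed.\<close>

lemma det_surface_iff:
  assumes "0 < t"
  shows "A \<in> det_surface t \<longleftrightarrow> 0 \<le> A$1$1 \<and> 0 \<le> A$2$2 \<and> A$1$2 = A$2$1 \<and> A$1$1 * A$2$2 - A$1$2 * A$1$2 = t"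
    (is "?L \<longleftrightarrow> ?R")
proof
  assume ?L then show ?R using det_surface_pos[of A t] by simp
next
  assume R: ?R
  then have "0 < A$1$1 * A$2$2" using assms by (smt (verit) zero_le_square)
  with R have a: "0 < A$1$1" by (simp add: zero_less_mult_iff)
  have "0 < \<xi> \<bullet> (A *v \<xi>)" if "\<xi> \<noteq> 0" for \<xi>
  proof -
    let ?x = "\<xi>$1" and ?y = "\<xi>$2"
    have "A$1$1 * (\<xi> \<bullet> (A *v \<xi>)) = (A$1$1 * ?x + A$1$2 * ?y)\<^sup>2 + t * ?y\<^sup>2"
    proof -
      have t: "t = A$1$1 * A$2$2 - A$1$2 * A$1$2" and s: "A$2$1 = A$1$2" using R by auto
      show ?thesis
        unfolding t inner_vec_def sum_2 matrix_vector_mult_def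
        by (simp add: s power2_eq_square algebra_simps)
    qed
    moreover have "0 < (A$1$1 * ?x + A$1$2 * ?y)\<^sup>2 + t * ?y\<^sup>2"
    proof (cases "?y = 0")
      case True
      then have "?x \<noteq> 0" using that by (auto simp: vec_eq_iff forall_2)
      then show ?thesis using True a by simp
    next
      case False
      then show ?thesis using assms by (simp add: add_nonneg_pos)
    qed
    ultimately have "0 < A$1$1 * (\<xi> \<bullet> (A *v \<xi>))" by simp
    then show ?thesis using a by (simp add: zero_less_mult_iff)
  qed
  then show ?L using R by (auto simp: det_surface_def SPD2_def Sym2_iff det_2)
qed

lemma closed_det_surface: "0 < t \<Longrightarrow> closed (det_surface t)"
proof -
  assume "0 < t"
  then have eq: "det_surface t = {A. 0 \<le> A$1$1} \<inter> {A. 0 \<le> A$2$2} \<inter> {A. A$1$2 = A$2$1}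
     \<inter> {A. A$1$1 * A$2$2 - A$1$2 * A$1$2 = t}"
    using det_surface_iff by auto
  show ?thesis
    unfolding eq
    by (intro closed_Int closed_Collect_le closed_Collect_eq continuous_intros)
qed

lemma closest_exists:
  assumes "0 < t"
  obtains P where "closest (det_surface t) X P"
proof -
  have "(\<chi> k l. if k = l then sqrt t else 0) \<in> det_surface t"
    using assms by (simp add: det_surface_iff)
  then have "det_surface t \<noteq> {}" by auto
  then obtain P where "P \<in> det_surface t" "\<And>A. A \<in> det_surface t \<Longrightarrow> dist X P \<le> dist X A"
    using distance_attains_inf[OF closed_det_surface[OF assms]] by metis
  then show ?thesis using that by (auto simp: closest_def dist_norm)
qed

text \<open>The squared distance along the curves used below is a polynomial of degree four in the curve
  parameter, minimal at the origin.\<close>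

lemma quartic_linear_coeff_zero:
  assumes "\<And>s::real. 0 \<le> b * s + c * s\<^sup>2 + d * s ^ 3 + e * s ^ 4"
  shows "b = 0"
proof -
  define g where "g s = b * s + c * s\<^sup>2 + d * s ^ 3 + e * s ^ 4" for s :: real
  have "(g has_real_derivative b) (at 0)"
    unfolding g_def by (auto intro!: derivative_eq_intros)
  then show ?thesis
    by (rule DERIV_local_min[where d=1]) (use assms in \<open>auto simp: g_def\<close>)
qed

text \<open>First order optimality.  The one-parameter groups $P \mapsto (I+sN) P (I+sN)^\top$ with
  nilpotent $N$ preserve symmetry and determinant; testing with three of them shows that the
  residual is orthogonal to the tangent plane, hence a multiple of the normal \<open>cof P\<close>.\<close>

lemma closest_normal:
  assumes cl: "closest (det_surface t) X P" and X: "X \<in> Sym2"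
  obtains r where "X - P = r *\<^sub>R cof P"
proof -
  have P: "P \<in> det_surface t" using cl by (simp add: closest_def)
  note p = det_surface_pos[OF P]
  define a b c where abc: "a = P$1$1" "b = P$1$2" "c = P$2$2"
  define x y z where xyz: "x = X$1$1 - a" "y = X$1$2 - b" "z = X$2$2 - c"
  have pos: "0 < a" "0 < c" "a * c - b * b = t" using p abc by auto
  have ineq: "x\<^sup>2 + 2 * y\<^sup>2 + z\<^sup>2 \<le> (x - u)\<^sup>2 + 2 * (y - v)\<^sup>2 + (z - w)\<^sup>2"
    if uvw: "0 \<le> a + u" "0 \<le> c + w" "(a + u) * (c + w) - (b + v) * (b + v) = t" for u v w
  proof -
    define A :: mat2 where
      "A = (\<chi> k l. if k = 1 \<and> l = 1 then a + u else if k = 2 \<and> l = 2 then c + w else b + v)"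
    have "A \<in> det_surface t" using uvw p(5) by (simp add: det_surface_iff A_def)
    then have "(norm (X - P))\<^sup>2 \<le> (norm (X - A))\<^sup>2"
      using cl by (simp add: closest_def)
    then show ?thesis
      using X p(3) by (simp add: norm_mat2 A_def xyz abc Sym2_iff algebra_simps)
  qed
  have lin: "x * u + 2 * y * v + z * w = 0"
    if "\<And>s. 0 \<le> a + (u * s + u' * s\<^sup>2)" "\<And>s. 0 \<le> c + (w * s + w' * s\<^sup>2)"
      "\<And>s. (a + (u * s + u' * s\<^sup>2)) * (c + (w * s + w' * s\<^sup>2)) - (b + (v * s + v' * s\<^sup>2)) * (b + (v * s + v' * s\<^sup>2)) = t"
    for u u' v v' w w' :: real
  proof -
    have "0 \<le> (- 2 * (x * u + 2 * y * v + z * w)) * s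
        + (u\<^sup>2 + 2 * v\<^sup>2 + w\<^sup>2 - 2 * (x * u' + 2 * y * v' + z * w')) * s\<^sup>2
        + (2 * (u * u' + 2 * v * v' + w * w')) * s ^ 3 + (u'\<^sup>2 + 2 * v'\<^sup>2 + w'\<^sup>2) * s ^ 4" for s
      using ineq[OF that(1)[of s] that(2)[of s] that(3)[of s]]
      by (simp add: power2_eq_square power3_eq_cube power4_eq_xxxx algebra_simps)
    then have "- 2 * (x * u + 2 * y * v + z * w) = 0" by (rule quartic_linear_coeff_zero)
    then show ?thesis by simp
  qed
  have nonneg: "0 \<le> r" if "0 < k" "k * r = l\<^sup>2 + t * n\<^sup>2" for k l n r :: real
  proof -
    have "0 \<le> k * r" using that(2) p(5) by simp
    then show ?thesis using that(1) by (simp add: zero_le_mult_iff)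
  qed
  \<comment> \<open>The nilpotent matrices with rows $(0,1),(0,0)$, $(0,0),(1,0)$ and
    $(1,-1),(1,-1)$.\<close>
  have 1: "x * (2 * b) + 2 * y * c + z * 0 = 0"
  proof (rule lin[where u' = c and v' = 0 and w' = 0])
    show "0 \<le> a + (2 * b * s + c * s\<^sup>2)" for s
      by (rule nonneg[of c _ "b + c * s" 1])
         (use pos in \<open>auto simp: power2_eq_square algebra_simps\<close>)
    show "(a + (2 * b * s + c * s\<^sup>2)) * (c + (0 * s + 0 * s\<^sup>2))
        - (b + (c * s + 0 * s\<^sup>2)) * (b + (c * s + 0 * s\<^sup>2)) = t" for s
      using pos by (simp add: power2_eq_square algebra_simps)
  qed (use pos in auto)
  have 3: "x * 0 + 2 * y * a + z * (2 * b) = 0"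
  proof (rule lin[where u' = 0 and v' = 0 and w' = a])
    show "0 \<le> c + (2 * b * s + a * s\<^sup>2)" for s
      by (rule nonneg[of a _ "b + a * s" 1])
         (use pos in \<open>auto simp: power2_eq_square algebra_simps\<close>)
    show "(a + (0 * s + 0 * s\<^sup>2)) * (c + (2 * b * s + a * s\<^sup>2))
        - (b + (a * s + 0 * s\<^sup>2)) * (b + (a * s + 0 * s\<^sup>2)) = t" for s
      using pos by (simp add: power2_eq_square algebra_simps)
  qed (use pos in auto)
  let ?e = "a - 2 * b + c"
  have 2: "x * (2 * (a - b)) + 2 * y * (a - c) + z * (2 * (b - c)) = 0"
  proof (rule lin[where u' = ?e and v' = ?e and w' = ?e])
    show "0 \<le> a + (2 * (a - b) * s + ?e * s\<^sup>2)" for s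
      by (rule nonneg[of a _ "(1 + s) * a - s * b" s])
         (use pos in \<open>auto simp: pos(3)[symmetric] power2_eq_square algebra_simps\<close>)
    show "0 \<le> c + (2 * (b - c) * s + ?e * s\<^sup>2)" for s
      by (rule nonneg[of c _ "(1 - s) * c + s * b" s])
         (use pos in \<open>auto simp: pos(3)[symmetric] power2_eq_square algebra_simps\<close>)
    show "(a + (2 * (a - b) * s + ?e * s\<^sup>2)) * (c + (2 * (b - c) * s + ?e * s\<^sup>2))
        - (b + ((a - c) * s + ?e * s\<^sup>2)) * (b + ((a - c) * s + ?e * s\<^sup>2)) = t" for s
      by (simp add: pos(3)[symmetric] power2_eq_square algebra_simps)
  qed
  define r where "r = x / c"
  have x: "x = r * c" using pos by (simp add: r_def)
  have "c * (y + b * r) = 0" using 1 by (simp add: x algebra_simps)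
  then have y: "y = - (b * r)" using pos by simp
  have "2 * (c * (z - a * r)) = (x * 0 + 2 * y * a + z * (2 * b))
      - (x * (2 * (a - b)) + 2 * y * (a - c) + z * (2 * (b - c)))"
    by (simp add: x y algebra_simps)
  then have "c * (z - a * r) = 0" using 2 3 by simp
  then have z: "z = a * r" using pos by simp
  have "X - P = r *\<^sub>R cof P"
    using x y z X p(3) by (simp add: mat2_eq_iff cof_component xyz abc Sym2_iff)
  then show ?thesis by (rule that)
qed

text \<open>The residuals are \<open>r *\<^sub>R cof P\<close> and \<open>s *\<^sub>R cof Q\<close>, and by the polar identity they
  contribute exactly \<open>(r + s) * det (P - Q)\<close> to the inner product below; the multipliers are small
  because the normals have norm at least \<open>sqrt t\<close>.\<close>

lemma closest_monotone:
  assumes P: "closest (det_surface t) X P" and Q: "closest (det_surface t) Y Q"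
    and sym: "X \<in> Sym2" "Y \<in> Sym2"
    and near: "norm (X - P) \<le> \<beta> * sqrt t" "norm (Y - Q) \<le> \<beta> * sqrt t"
  shows "(1 - \<beta>) * (norm (P - Q))\<^sup>2 \<le> (X - Y) \<bullet> (P - Q)"
proof -
  have mem: "P \<in> det_surface t" "Q \<in> det_surface t" using P Q by (auto simp: closest_def)
  then have dets: "det P = t" "det Q = t" by (auto simp: det_surface_def)
  have t: "0 < t" using det_surface_pos(5)[OF mem(1)] .
  obtain r where r: "X - P = r *\<^sub>R cof P" by (rule closest_normal[OF P sym(1)])
  obtain s where s: "Y - Q = s *\<^sub>R cof Q" by (rule closest_normal[OF Q sym(2)])
  have small: "\<bar>r\<bar> \<le> \<beta>" if "A \<in> det_surface t" "norm (r *\<^sub>R cof A) \<le> \<beta> * sqrt t" for A and r :: real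
  proof -
    have "t \<le> (norm A)\<^sup>2"
      using det_le_norm[of A] that(1) t by (auto simp: det_surface_def)
    then have "sqrt t \<le> norm A" by (rule real_le_lsqrt[rotated]) auto
    then have "\<bar>r\<bar> * sqrt t \<le> \<bar>r\<bar> * norm A" by (simp add: mult_left_mono)
    also have "\<dots> \<le> \<beta> * sqrt t" using that(2) by (simp add: norm_cof)
    finally show ?thesis using t by simp
  qed
  have "\<bar>r\<bar> \<le> \<beta>" "\<bar>s\<bar> \<le> \<beta>" using small mem near by (auto simp: r s)
  then have rs: "\<bar>r + s\<bar> \<le> 2 * \<beta>" by linarith
  have "\<bar>(r + s) * det (P - Q)\<bar> \<le> (2 * \<beta>) * ((norm (P - Q))\<^sup>2 / 2)"
    unfolding abs_mult using rs det_le_norm[of "P - Q"] by (intro mult_mono) auto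
  moreover have "(X - Y) \<bullet> (P - Q) = (norm (P - Q))\<^sup>2 + (r + s) * det (P - Q)"
  proof -
    have "X - Y = (P - Q) + (r *\<^sub>R cof P - s *\<^sub>R cof Q)" using r s by (simp add: algebra_simps)
    then have "(X - Y) \<bullet> (P - Q) = (P - Q) \<bullet> (P - Q) + (r * (cof P \<bullet> (P - Q)) - s * (cof Q \<bullet> (P - Q)))"
      by (simp add: inner_add_left inner_diff_left)
    then show ?thesis
      using det_polar(1,2)[of P Q] dets by (simp only: power2_norm_eq_inner) (simp only: algebra_simps)
  qed
  ultimately show ?thesis by (simp add: algebra_simps abs_le_iff)
qed

text \<open>For a base point on the surface, closest points are at most twice as far from it as the
  points that are projected, so \<open>closest_monotone\<close> applies near the surface and their differences
  are almost tangent there.\<close>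

lemma closest_local:
  assumes \<beta>: "0 < \<beta>" and A: "A \<in> det_surface t"
    and P: "closest (det_surface t) X P" and Q: "closest (det_surface t) Y Q"
    and sym: "X \<in> Sym2" "Y \<in> Sym2"
    and near: "norm (X - A) \<le> \<epsilon>" "norm (Y - A) \<le> \<epsilon>"
    and \<epsilon>: "\<epsilon> \<le> \<beta> * sqrt t" "2 * \<epsilon> \<le> \<beta>"
  shows "(1 - \<beta>) * (norm (P - Q))\<^sup>2 \<le> (X - Y) \<bullet> (P - Q)"
    and "\<bar>cof A \<bullet> (P - Q)\<bar> \<le> \<beta> * norm (P - Q)"
proof -
  have PX: "norm (X - P) \<le> \<epsilon>" and QY: "norm (Y - Q) \<le> \<epsilon>"
    using P Q A near by (force simp: closest_def)+
  show "(1 - \<beta>) * (norm (P - Q))\<^sup>2 \<le> (X - Y) \<bullet> (P - Q)"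
    using closest_monotone[OF P Q sym] PX QY \<epsilon> by force
  have "det P = det Q" using P Q by (auto simp: closest_def det_surface_def)
  then have "cof (P + Q) \<bullet> (P - Q) = 0" by (rule det_polar)
  then have "2 * (cof A \<bullet> (P - Q)) = cof ((A - P) + (A - Q)) \<bullet> (P - Q)"
    by (simp only: cof_add cof_diff inner_add_left inner_diff_left)
  then have "2 * \<bar>cof A \<bullet> (P - Q)\<bar> \<le> norm ((A - P) + (A - Q)) * norm (P - Q)"
    using Cauchy_Schwarz_ineq2[of "cof ((A - P) + (A - Q))" "P - Q"] by (simp add: norm_cof)
  also have "norm ((A - P) + (A - Q)) \<le> 4 * \<epsilon>"
  proof -
    have "norm (A - P) \<le> 2 * \<epsilon>"
      using norm_triangle_ineq[of "X - P" "A - X"] PX near(1) by (simp add: norm_minus_commute)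
    moreover have "norm (A - Q) \<le> 2 * \<epsilon>"
      using norm_triangle_ineq[of "Y - Q" "A - Y"] QY near(2) by (simp add: norm_minus_commute)
    ultimately show ?thesis using norm_triangle_ineq[of "A - P" "A - Q"] by linarith
  qed
  then have "norm ((A - P) + (A - Q)) * norm (P - Q) \<le> (2 * \<beta>) * norm (P - Q)"
    using \<epsilon>(2) by (intro mult_right_mono) auto
  finally show "\<bar>cof A \<bullet> (P - Q)\<bar> \<le> \<beta> * norm (P - Q)" by simp
qed

section \<open>The Cordes inequality\<close>

text \<open>The Cordes condition in two dimensions: for symmetric \<open>B\<close> of positive determinant, with \<open>\<theta> = (norm B)\<^sup>2 / trace B\<close> one has
  \<open>(norm (mat 1 - B /\<^sub>R \<theta>))\<^sup>2 = 1 - 2 * det B / (norm B)\<^sup>2\<close>, so the trace of a matrix almost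
  orthogonal to \<open>B\<close> is strictly smaller than its norm.\<close>

lemma cordes:
  fixes B M :: mat2
  assumes c: "0 < c" "c \<le> det B" and b: "norm B \<le> b" and \<delta>: "\<delta> = 2 * c / b\<^sup>2"
    and sym: "B \<in> Sym2"
  shows "(trace M)\<^sup>2 \<le> (1 - \<delta>\<^sup>2) * (norm M)\<^sup>2 + (1 + 1 / \<delta>) / c * (B \<bullet> M)\<^sup>2"
proof -
  define n \<tau> where "n = (norm B)\<^sup>2" and "\<tau> = trace B"
  have n2: "2 * det B \<le> n" using det_le_norm[of B] unfolding n_def by linarith
  then have n: "0 < n" using c by linarith
  have nb: "n \<le> b\<^sup>2" using b by (simp add: n_def power_mono)
  then have b2: "0 < b\<^sup>2" using n by linarith
  have \<delta>0: "0 < \<delta>" using \<delta> c b2 by simp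
  have \<tau>: "\<tau>\<^sup>2 = n + 2 * det B"
    using sym unfolding n_def \<tau>_def norm_mat2 trace_mat2 det_2
    by (simp add: Sym2_iff power2_eq_square algebra_simps)
  define G where "G = mat 1 - (\<tau> / n) *\<^sub>R B"
  have "G \<bullet> G = 1 - 2 * det B / n"
  proof -
    have "G \<bullet> G = (mat 1 \<bullet> (mat 1 :: mat2)) - 2 * (\<tau> / n) * (mat 1 \<bullet> B) + (\<tau> / n)\<^sup>2 * (B \<bullet> B)"
      unfolding G_def
      by (simp add: inner_diff_left inner_diff_right inner_commute power2_eq_square algebra_simps)
    also have "\<dots> = 2 - 2 * (\<tau> / n) * \<tau> + (\<tau> / n)\<^sup>2 * n"
    proof -
      have "mat 1 \<bullet> (mat 1 :: mat2) = 2" "mat 1 \<bullet> B = \<tau>"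
        by (simp_all add: inner_mat2 mat_def trace_mat2 \<tau>_def)
      then show ?thesis by (simp add: n_def power2_norm_eq_inner)
    qed
    also have "\<dots> = 2 - \<tau>\<^sup>2 / n" using n by (simp add: power2_eq_square)
    also have "\<dots> = 1 - 2 * det B / n" using n unfolding \<tau> by (simp add: field_simps)
    finally show ?thesis .
  qed
  also have "\<dots> \<le> 1 - \<delta>"
  proof -
    have "\<delta> \<le> 2 * c / n" unfolding \<delta> using nb n c b2 by (intro divide_left_mono mult_pos_pos) auto
    also have "\<dots> \<le> 2 * det B / n" using c n by (intro divide_right_mono) auto
    finally show ?thesis by simp
  qed
  finally have G: "(norm G)\<^sup>2 \<le> 1 - \<delta>" by (simp add: power2_norm_eq_inner)
  have coef: "(\<tau> / n)\<^sup>2 \<le> 1 / c"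
  proof -
    have "c * (n + 2 * det B) \<le> (n / 2) * (2 * n)"
      using n2 c n by (intro mult_mono) auto
    then have "(n + 2 * det B) / n\<^sup>2 \<le> 1 / c" using n c by (simp add: field_simps power2_eq_square)
    then show ?thesis by (simp only: power_divide \<tau>)
  qed
  have "trace M = G \<bullet> M + (\<tau> / n) * (B \<bullet> M)"
  proof -
    have "mat 1 \<bullet> M = trace M" by (simp add: inner_mat2 mat_def trace_mat2)
    then show ?thesis by (simp add: G_def inner_diff_left)
  qed
  moreover have "(p + q)\<^sup>2 \<le> (1 + \<delta>) * p\<^sup>2 + (1 + 1 / \<delta>) * q\<^sup>2" for p q :: real
  proof -
    have "(1 + \<delta>) * p\<^sup>2 + (1 + 1 / \<delta>) * q\<^sup>2 - (p + q)\<^sup>2 = (\<delta> * p - q)\<^sup>2 / \<delta>"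
      using \<delta>0 by (simp add: field_simps power2_eq_square)
    moreover have "0 \<le> (\<delta> * p - q)\<^sup>2 / \<delta>" using \<delta>0 by simp
    ultimately show ?thesis by linarith
  qed
  ultimately have "(trace M)\<^sup>2 \<le> (1 + \<delta>) * (G \<bullet> M)\<^sup>2 + (1 + 1 / \<delta>) * ((\<tau> / n)\<^sup>2 * (B \<bullet> M)\<^sup>2)"
    by (simp only: power_mult_distrib[symmetric])
  also have "\<dots> \<le> (1 + \<delta>) * ((1 - \<delta>) * (norm M)\<^sup>2) + (1 + 1 / \<delta>) * (1 / c * (B \<bullet> M)\<^sup>2)"
  proof (intro add_mono mult_left_mono mult_right_mono coef)
    have "(G \<bullet> M)\<^sup>2 \<le> (norm G)\<^sup>2 * (norm M)\<^sup>2"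
      using Cauchy_Schwarz_ineq[of G M] by (simp add: power2_norm_eq_inner)
    also have "\<dots> \<le> (1 - \<delta>) * (norm M)\<^sup>2" using G by (intro mult_right_mono) auto
    finally show "(G \<bullet> M)\<^sup>2 \<le> (1 - \<delta>) * (norm M)\<^sup>2" .
  qed (use \<delta>0 in auto)
  also have "\<dots> = (1 - \<delta>\<^sup>2) * (norm M)\<^sup>2 + (1 + 1 / \<delta>) / c * (B \<bullet> M)\<^sup>2"
    by (simp add: power2_eq_square algebra_simps)
  finally show ?thesis .
qed

section \<open>Semidefinite bilinear forms\<close>

text \<open>The carrier \<open>X\<close> comes with its own operation \<open>L r v s w\<close>, to be read as $r v + s w$: the spaces of
  broken functions and of polynomials are sets of functions whose type carries no vector space
  structure.\<close>

definition linear_functional_on :: "'a set \<Rightarrow> (real \<Rightarrow> 'a \<Rightarrow> real \<Rightarrow> 'a \<Rightarrow> 'a) \<Rightarrow> ('a \<Rightarrow> real) \<Rightarrow> bool" where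
  "linear_functional_on X L \<phi> \<longleftrightarrow> (\<forall>v\<in>X. \<forall>w\<in>X. \<forall>r s. \<phi> (L r v s w) = r * \<phi> v + s * \<phi> w)"

locale semi_inner_space =
  fixes X :: "'a set" and L :: "real \<Rightarrow> 'a \<Rightarrow> real \<Rightarrow> 'a \<Rightarrow> 'a" and a :: "'a \<Rightarrow> 'a \<Rightarrow> real"
  assumes closed: "v \<in> X \<Longrightarrow> w \<in> X \<Longrightarrow> L r v s w \<in> X"
    and nonempty: "X \<noteq> {}"
    and sym: "v \<in> X \<Longrightarrow> w \<in> X \<Longrightarrow> a v w = a w v"
    and lin: "w \<in> X \<Longrightarrow> linear_functional_on X L (\<lambda>v. a v w)"
    and nonneg: "v \<in> X \<Longrightarrow> 0 \<le> a v v"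
begin

lemma add_left: "v \<in> X \<Longrightarrow> v' \<in> X \<Longrightarrow> w \<in> X \<Longrightarrow> a (L r v s v') w = r * a v w + s * a v' w"
  using lin by (auto simp: linear_functional_on_def)

lemma add_right: "v \<in> X \<Longrightarrow> v' \<in> X \<Longrightarrow> w \<in> X \<Longrightarrow> a w (L r v s v') = r * a w v + s * a w v'"
  using add_left[of v v' w r s] sym closed by metis

lemma cauchy_schwarz:
  assumes v: "v \<in> X" and w: "w \<in> X"
  shows "(a v w)\<^sup>2 \<le> a v v * a w w"
proof -
  have q: "0 \<le> r\<^sup>2 * a v v + 2 * (r * s) * a v w + s\<^sup>2 * a w w" for r s
  proof -
    have "0 \<le> a (L r v s w) (L r v s w)" using v w by (simp add: nonneg closed)
    also have "\<dots> = r\<^sup>2 * a v v + 2 * (r * s) * a v w + s\<^sup>2 * a w w"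
      using v w sym[of w v] by (simp add: add_left add_right closed power2_eq_square algebra_simps)
    finally show ?thesis .
  qed
  show ?thesis
  proof (cases "a w w = 0")
    case True
    have "a v w = 0"
    proof (rule ccontr)
      assume nz: "a v w \<noteq> 0"
      then show False
        using q[of 1 "- (a v v + 1) / (2 * a v w)"] True by (simp add: field_simps)
    qed
    then show ?thesis by (simp add: True)
  next
    case False
    then have pos: "0 < a w w" using nonneg[OF w] by simp
    have "0 \<le> a w w * (a v v * a w w - (a v w)\<^sup>2)"
      using q[of "a w w" "- a v w"] by (simp add: power2_eq_square algebra_simps)
    then show ?thesis using pos by (simp add: zero_le_mult_iff)
  qed
qed

text \<open>Solvability of \<open>a u v = \<phi> v\<close> for a form that may be degenerate, as long as \<open>\<phi>\<close> vanishes on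
  its kernel.  The induction over a spanning set is the Gram--Schmidt process: a new vector is made
  orthogonal to the earlier ones and corrects the solution unless it has fallen into the kernel.
  That a vector lies in the span of \<open>F\<close> is expressed by duality: every linear functional that
  vanishes on \<open>F\<close> vanishes on it.\<close>

lemma solvable_on_finite:
  assumes "finite F" "F \<subseteq> X" and \<phi>: "linear_functional_on X L \<phi>"
    and ker: "\<And>e. e \<in> X \<Longrightarrow> a e e = 0 \<Longrightarrow> \<phi> e = 0"
  shows "\<exists>u\<in>X. (\<forall>v\<in>F. a u v = \<phi> v) \<and>
     (\<forall>\<psi>. linear_functional_on X L \<psi> \<and> (\<forall>v\<in>F. \<psi> v = 0) \<longrightarrow> \<psi> u = 0)"
  using assms
proof (induction F arbitrary: \<phi> rule: finite_induct)
  case empty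
  obtain x where x: "x \<in> X" using nonempty by blast
  have "\<psi> (L 0 x 0 x) = 0" if "linear_functional_on X L \<psi>" for \<psi> using that x by (simp add: linear_functional_on_def)
  then show ?case using closed[OF x x] by blast
next
  case (insert b F)
  then have b: "b \<in> X" and F: "F \<subseteq> X" by auto
  have "\<And>e. e \<in> X \<Longrightarrow> a e e = 0 \<Longrightarrow> a e b = 0"
    using cauchy_schwarz[OF _ b] by fastforce
  then obtain p where p: "p \<in> X" "\<And>v. v \<in> F \<Longrightarrow> a p v = a v b"
    and pspan: "\<And>\<psi>. linear_functional_on X L \<psi> \<Longrightarrow> (\<forall>v\<in>F. \<psi> v = 0) \<Longrightarrow> \<psi> p = 0"
    using insert.IH[OF F lin[OF b]] by blast
  obtain u0 where u0: "u0 \<in> X" "\<And>v. v \<in> F \<Longrightarrow> a u0 v = \<phi> v"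
    and u0span: "\<And>\<psi>. linear_functional_on X L \<psi> \<Longrightarrow> (\<forall>v\<in>F. \<psi> v = 0) \<Longrightarrow> \<psi> u0 = 0"
    using insert.IH[OF F insert.prems(2,3)] by blast
  define e where "e = L 1 b (-1) p"
  have e: "e \<in> X" using b p(1) by (simp add: e_def closed)
  have lin_e: "\<psi> e = \<psi> b - \<psi> p" if "linear_functional_on X L \<psi>" for \<psi>
    using that b p(1) by (simp add: e_def linear_functional_on_def)
  have eF: "a v e = 0" if "v \<in> F" for v
    using that F b p sym[of v b] sym[of v p] by (auto simp: e_def add_right)
  have ep: "a p e = 0" using pspan[OF lin[OF e]] eF by blast
  have eu0: "a u0 e = 0" using u0span[OF lin[OF e]] eF by blast
  have ab: "a w b = a w e + a w p" if "w \<in> X" for w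
    using that b p(1) by (simp add: e_def add_right)
  have u0p: "a u0 p = \<phi> p"
  proof -
    have "linear_functional_on X L (\<lambda>v. a v u0 - \<phi> v)"
      using lin[OF u0(1)] insert.prems(2) by (simp add: linear_functional_on_def algebra_simps)
    moreover have "a v u0 - \<phi> v = 0" if "v \<in> F" for v
      using that u0 F sym[of v u0] by auto
    ultimately have "a p u0 - \<phi> p = 0" using pspan by blast
    then show ?thesis using sym p u0 by auto
  qed
  define k where "k = (if a e e = 0 then 0 else \<phi> e / a e e)"
  have k: "k * a e e = \<phi> e" using insert.prems(3)[OF e] by (simp add: k_def)
  define u where "u = L 1 u0 k e"
  have u: "u \<in> X" using u0(1) e by (simp add: u_def closed)
  have au: "a u w = a u0 w + k * a e w" if "w \<in> X" for w
    using that u0(1) e by (simp add: u_def add_left)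
  have "a u v = \<phi> v" if "v \<in> F" for v
    using that F u0 eF e sym[of v e] au[of v] by auto
  moreover have "a u b = \<phi> b"
  proof -
    have "a e p = 0" using ep sym e p by metis
    then have "a u b = \<phi> p + \<phi> e"
      using au[OF b] ab[OF u0(1)] ab[OF e] eu0 u0p k by (simp add: algebra_simps)
    then show ?thesis using lin_e[OF insert.prems(2)] by simp
  qed
  moreover have "\<psi> u = 0" if \<psi>: "linear_functional_on X L \<psi>" "\<forall>v\<in>insert b F. \<psi> v = 0" for \<psi>
  proof -
    have "\<psi> u = \<psi> u0 + k * \<psi> e" using \<psi>(1) u0(1) e by (simp add: u_def linear_functional_on_def)
    then show ?thesis using lin_e[OF \<psi>(1)] pspan[OF \<psi>(1)] u0span[OF \<psi>(1)] \<psi>(2) by simp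
  qed
  ultimately show ?case using u by blast
qed

lemma solvable:
  assumes "finite F" "F \<subseteq> X" and \<phi>: "linear_functional_on X L \<phi>"
    and ker: "\<forall>e\<in>X. a e e = 0 \<longrightarrow> \<phi> e = 0"
    and span: "\<forall>\<psi>. linear_functional_on X L \<psi> \<longrightarrow> (\<forall>w\<in>F. \<psi> w = 0) \<longrightarrow> (\<forall>v\<in>X. \<psi> v = 0)"
  shows "\<exists>u\<in>X. \<forall>v\<in>X. a u v = \<phi> v"
proof -
  obtain u where u: "u \<in> X" "\<forall>v\<in>F. a u v = \<phi> v"
    using solvable_on_finite[OF assms(1-3)] ker by blast
  have "linear_functional_on X L (\<lambda>v. a v u - \<phi> v)"
    using lin[OF u(1)] \<phi> by (simp add: linear_functional_on_def algebra_simps)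
  moreover have "\<forall>w\<in>F. a w u - \<phi> w = 0"
    using u assms(2) sym[OF _ u(1)] by (simp add: subset_iff)
  ultimately have "\<forall>v\<in>X. a v u - \<phi> v = 0"
    using span by blast
  then show ?thesis using u(1) sym[OF _ u(1)] by auto
qed

end

section \<open>Nodal and integral norms of polynomials on a triangle\<close>

lemma integrable_lebesgue_on_compact:
  fixes f :: "'a::euclidean_space \<Rightarrow> real"
  assumes "compact S" "continuous_on S f"
  shows "integrable (lebesgue_on S) f"
proof -
  have i: "integrable lborel (\<lambda>x. indicator S x *\<^sub>R f x)"
    by (rule borel_integrable_compact[OF assms])
  then have "integrable lebesgue (\<lambda>x. indicator S x *\<^sub>R f x)"
    using integrable_completion[of _ lborel] borel_measurable_integrable[OF i] by blast
  moreover have "S \<in> sets lebesgue" using assms(1) by (simp add: compact_imp_closed)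
  ultimately show ?thesis by (subst integrable_restrict_space) auto
qed

text \<open>The scalar integrand is viewed as a vector with one component, the form in which
  \<open>integral_change_of_variables\<close> applies.\<close>

lemma lebesgue_integral_affine_image:
  fixes A :: mat2 and f :: "plane \<Rightarrow> real"
  assumes S: "compact S" and f: "continuous_on ((\<lambda>x. A *v x + b) ` S) f" and A: "det A \<noteq> 0"
  shows "(LINT x|lebesgue_on ((\<lambda>x. A *v x + b) ` S). f x)
     = \<bar>det A\<bar> * (LINT x|lebesgue_on S. f (A *v x + b))"
proof -
  let ?F = "\<lambda>x. A *v x + b"
  have contF: "continuous_on S ?F" by (intro continuous_intros linear_continuous_on_compose matrix_vector_mul_linear)
  have cK: "compact (?F ` S)" using S contF by (rule compact_continuous_image[rotated])
  have sets: "S \<in> sets lebesgue" "?F ` S \<in> sets lebesgue"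
    using S cK by (simp_all add: compact_imp_closed)
  have intK: "integrable (lebesgue_on (?F ` S)) f" by (rule integrable_lebesgue_on_compact[OF cK f])
  have intS: "integrable (lebesgue_on S) (\<lambda>x. f (?F x))"
    by (intro integrable_lebesgue_on_compact[OF S] continuous_on_compose2[OF f contF]) auto
  define g where "g = (\<lambda>x. vec (f x) :: real^1)"
  have "integral (?F ` S) g = integral S (\<lambda>x. \<bar>det (matrix ((*v) A))\<bar> *\<^sub>R g (?F x))"
  proof (rule integral_change_of_variables[OF sets(1)])
    show "(?F has_derivative (*v) A) (at x within S)" for x
      by (auto intro!: derivative_eq_intros bounded_linear_imp_has_derivative
          linear_conv_bounded_linear[THEN iffD1] matrix_vector_mul_linear)
    have "inj ((*v) A)" using A by (simp add: inj_matrix_vector_mult invertible_det_nz)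
    then show "inj_on ?F S" by (auto simp: inj_on_def)
    have "f absolutely_integrable_on (?F ` S)"
      using intK sets(2) by (simp add: set_integrable_def integrable_restrict_space)
    then show "g absolutely_integrable_on ?F ` S \<or> (\<lambda>x. \<bar>det (matrix ((*v) A))\<bar> *\<^sub>R g (?F x)) absolutely_integrable_on S"
      by (simp add: absolutely_integrable_on_1_iff g_def)
  qed
  then have "integral (?F ` S) f = integral S (\<lambda>x. \<bar>det A\<bar> * f (?F x))"
    by (simp add: integral_on_1_eq g_def vec_eq_iff)
  then show ?thesis
    using lebesgue_integral_eq_integral[OF intK sets(2)] lebesgue_integral_eq_integral[OF intS sets(1)]
    by simp
qed

lemma ref_triangle_std: "ref_triangle = convex hull (insert 0 Basis)"
proof -
  have "(Basis :: plane set) = {axis 1 1, axis 2 1}"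
    by (auto simp: Basis_vec_def UNIV_2)
  then show ?thesis by (simp add: ref_triangle_def)
qed

lemma ref_triangle_compact: "compact ref_triangle"
  unfolding ref_triangle_def by (intro compact_convex_hull finite_imp_compact) auto

lemma ref_triangle_closure_interior: "closure (interior ref_triangle) = ref_triangle"
proof -
  have "interior ref_triangle \<noteq> {}"
    unfolding ref_triangle_std using interior_std_simplex_nonempty[where 'a=plane] by auto
  then have "closure (interior ref_triangle) = closure ref_triangle"
    by (intro convex_closure_interior) (simp_all add: ref_triangle_def convex_convex_hull)
  then show ?thesis using ref_triangle_compact by (simp add: compact_imp_closed)
qed

text \<open>A continuous square with vanishing integral vanishes almost everywhere, hence on the interior, and
  the triangle is the closure of its interior; nodes may lie on its boundary.\<close>

lemma zero_integral_ref_triangle: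
  fixes p :: "plane \<Rightarrow> real"
  assumes p: "continuous_on UNIV p" and zero: "(LINT x|lebesgue_on ref_triangle. (p x)\<^sup>2) = 0"
    and x: "x \<in> ref_triangle"
  shows "p x = 0"
proof -
  let ?T = ref_triangle
  have sets: "?T \<in> sets lebesgue" using ref_triangle_compact by (simp add: compact_imp_closed)
  have "integrable (lebesgue_on ?T) (\<lambda>x. (p x)\<^sup>2)"
    using p by (intro integrable_lebesgue_on_compact ref_triangle_compact continuous_intros)
      (auto intro: continuous_on_subset)
  then have "AE x in lebesgue_on ?T. (p x)\<^sup>2 = 0"
    using zero by (subst (asm) integral_nonneg_eq_0_iff_AE) auto
  then have "AE x in lebesgue. x \<in> ?T \<longrightarrow> p x = 0"
    using sets by (subst (asm) AE_restrict_space_iff) auto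
  then have ae: "AE x\<in>interior ?T in lebesgue. x \<in> {x. p x = 0}"
    by (rule AE_mp) (use interior_subset in auto)
  have closed: "closed {x. p x = 0}"
    using p by (intro closed_Collect_eq) (auto intro: continuous_intros)
  have "interior ?T \<subseteq> {x. p x = 0}"
    using mem_closed_if_AE_lebesgue_open[OF open_interior closed ae] by auto
  then have "closure (interior ?T) \<subseteq> {x. p x = 0}"
    using closed by (rule closure_minimal)
  then show ?thesis using x by (auto simp: ref_triangle_closure_interior)
qed

lemma linear_functional_on_polys_sum:
  assumes \<psi>: "linear_functional_on (polys m UNIV) (\<lambda>r p s q. (\<lambda>x. r * p x + s * q x)) \<psi>"
    and p: "\<And>i. i \<in> I \<Longrightarrow> p i \<in> polys m (UNIV :: real set)"
    and zero: "\<And>i. i \<in> I \<Longrightarrow> \<psi> (p i) = 0"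
  shows "\<psi> (\<lambda>x. \<Sum>i\<in>I. c i * p i x) = 0"
proof -
  have lin: "\<psi> (\<lambda>x. r * p x + s * q x) = r * \<psi> p + s * \<psi> q"
    if "p \<in> polys m UNIV" "q \<in> polys m UNIV" for p q r s
    using \<psi> that by (simp add: linear_functional_on_def)
  have "\<psi> (\<lambda>x. 0 * 0 + 0 * 0) = 0 * \<psi> (\<lambda>x. 0) + 0 * \<psi> (\<lambda>x. 0)"
    by (intro lin polys_0)
  then have zero': "\<psi> (\<lambda>x. 0) = 0" by simp
  show ?thesis
    using p zero
proof (induction I rule: infinite_finite_induct)
  case (insert i I)
  have "(\<lambda>x. \<Sum>i\<in>I. c i * p i x) \<in> polys m UNIV"
    using insert.prems by (intro polys_sum polys_cmult) auto
  then have "\<psi> (\<lambda>x. c i * p i x + 1 * (\<Sum>i\<in>I. c i * p i x))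
      = c i * \<psi> (p i) + 1 * \<psi> (\<lambda>x. \<Sum>i\<in>I. c i * p i x)"
    by (intro lin insert.prems insertI1)
  then show ?case using insert by simp
qed (simp_all add: zero')
qed

text \<open>Point evaluation on polynomials is represented in $L^2$ of the reference triangle by a
  polynomial, so that it is bounded by the $L^2$ norm.\<close>

lemma polys_point_value_bound:
  assumes xh: "xh \<in> ref_triangle"
  shows "\<exists>C\<ge>0. \<forall>p\<in>polys m (UNIV :: real set). (p xh)\<^sup>2 \<le> C * (LINT x|lebesgue_on ref_triangle. (p x)\<^sup>2)"
proof -
  let ?X = "polys m (UNIV :: real set)" and ?L = "\<lambda>r p s q. (\<lambda>x::plane. r * p x + s * q x :: real)"
  define a where "a p q = (LINT x|lebesgue_on ref_triangle. p x * q x)" for p q :: "plane \<Rightarrow> real"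
  have int: "integrable (lebesgue_on ref_triangle) (\<lambda>x. p x * q x)" if "p \<in> ?X" "q \<in> ?X" for p q
    using that by (intro integrable_lebesgue_on_compact ref_triangle_compact continuous_intros polys_continuous)
  interpret semi_inner_space ?X ?L a
  proof
    show "?L r v s w \<in> ?X" if "v \<in> ?X" "w \<in> ?X" for v w r s
      using that by (intro polys_add polys_cmult)
    show "?X \<noteq> {}" using polys_0 by blast
    show "a v w = a w v" for v w by (simp add: a_def mult.commute)
    show "0 \<le> a v v" for v by (simp add: a_def)
    show "linear_functional_on ?X ?L (\<lambda>v. a v w)" if w: "w \<in> ?X" for w
      unfolding linear_functional_on_def
    proof (intro ballI allI)
      fix p q r s assume "p \<in> ?X" "q \<in> ?X"
      then have "a (?L r p s q) w = (LINT x|lebesgue_on ref_triangle. r * (p x * w x) + s * (q x * w x))"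
        by (simp add: a_def algebra_simps)
      also have "\<dots> = r * a p w + s * a q w"
        using int[OF \<open>p \<in> ?X\<close> w] int[OF \<open>q \<in> ?X\<close> w] by (simp add: a_def)
      finally show "a (?L r p s q) w = r * a p w + s * a q w" .
    qed
  qed
  define F where "F = (\<lambda>(a, b). \<lambda>x::plane. (x$1) ^ a * (x$2) ^ b) ` {(a, b). a \<le> m \<and> b \<le> m - a}"
  have I: "{(a, b). a \<le> m \<and> b \<le> m - a} = Sigma {..m} (\<lambda>a. {..m - a})" by auto
  have 1: "finite F" unfolding F_def I by simp
  have 2: "F \<subseteq> ?X" by (auto simp: F_def intro!: polys_real_monomial)
  have 3: "linear_functional_on ?X ?L (\<lambda>p. p xh)" by (simp add: linear_functional_on_def)
  have 4: "\<forall>e\<in>?X. a e e = 0 \<longrightarrow> e xh = 0"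
    using zero_integral_ref_triangle[OF polys_continuous _ xh]
    by (auto simp: a_def power2_eq_square)
  have 5: "\<forall>\<psi>. linear_functional_on ?X ?L \<psi> \<longrightarrow> (\<forall>w\<in>F. \<psi> w = 0) \<longrightarrow> (\<forall>v\<in>?X. \<psi> v = 0)"
  proof (intro allI impI ballI)
    fix \<psi> v assume \<psi>: "linear_functional_on ?X ?L \<psi>" "\<forall>w\<in>F. \<psi> w = 0" and v: "v \<in> ?X"
    obtain c where c: "v = (\<lambda>x. \<Sum>a\<le>m. \<Sum>b\<le>m - a. c a b * ((x$1) ^ a * (x$2) ^ b))"
      using v by (rule polys_real_expand)
    have eq: "v = (\<lambda>x. \<Sum>i\<in>Sigma {..m} (\<lambda>a. {..m - a}).
        (case i of (a, b) \<Rightarrow> c a b) * (case i of (a, b) \<Rightarrow> (\<lambda>x. (x$1) ^ a * (x$2) ^ b)) x)"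
      unfolding c by (simp add: sum.Sigma case_prod_unfold)
    show "\<psi> v = 0"
      unfolding eq
    proof (rule linear_functional_on_polys_sum[OF \<psi>(1)])
      fix i assume i: "i \<in> Sigma {..m} (\<lambda>a. {..m - a})"
      then show "(case i of (a, b) \<Rightarrow> (\<lambda>x. (x$1) ^ a * (x$2) ^ b)) \<in> ?X"
        by (auto intro!: polys_real_monomial)
      show "\<psi> (case i of (a, b) \<Rightarrow> (\<lambda>x. (x$1) ^ a * (x$2) ^ b)) = 0"
        using \<psi>(2) i unfolding F_def I by (auto simp: image_def)
    qed
  qed
  obtain u where u: "u \<in> ?X" "\<And>v. v \<in> ?X \<Longrightarrow> a u v = v xh"
    using solvable[OF 1 2 3 4 5] by blast
  show ?thesis
  proof (intro exI[of _ "a u u"] conjI ballI)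
    show "0 \<le> a u u" using u(1) by (rule nonneg)
    show "(p xh)\<^sup>2 \<le> a u u * (LINT x|lebesgue_on ref_triangle. (p x)\<^sup>2)" if "p \<in> ?X" for p
      using cauchy_schwarz[OF u(1) that] u(2)[OF that] by (simp add: a_def power2_eq_square)
  qed
qed

lemma ex1_unique: "\<exists>!x. P x \<Longrightarrow> P a \<Longrightarrow> P b \<Longrightarrow> a = b"
  by blast

lemma unisolvent_lagrange:
  assumes "unisolvent m xhat"
  shows "\<exists>\<Lambda>. (\<forall>j. \<Lambda> j \<in> polys m (UNIV :: real set)) \<and>
    (\<forall>p\<in>polys m (UNIV :: real set). \<forall>x. p x = (\<Sum>j<Npoly m. p (xhat j) * \<Lambda> j x))"
proof -
  let ?N = "Npoly m"
  have ex1: "\<exists>!p. p \<in> polys m UNIV \<and> (\<forall>j<?N. p (xhat j) = b j)" for b :: "nat \<Rightarrow> real"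
    using assms by (simp add: unisolvent_def)
  have "\<exists>p. p \<in> polys m UNIV \<and> (\<forall>j<?N. p (xhat j) = (if j = i then 1 else 0 :: real))" for i
    using ex1[of "\<lambda>j. if j = i then 1 else 0"] by (rule ex1_implies_ex)
  then have "\<forall>i. \<exists>p. p \<in> polys m UNIV \<and> (\<forall>j<?N. p (xhat j) = (if j = i then 1 else 0 :: real))"
    by (rule allI)
  from choice[OF this] obtain \<Lambda> where \<Lambda>: "\<And>i. \<Lambda> i \<in> polys m UNIV"
      "\<And>i j. j < ?N \<Longrightarrow> \<Lambda> i (xhat j) = (if j = i then 1 else 0 :: real)"
    by blast
  have "p x = (\<Sum>j<?N. p (xhat j) * \<Lambda> j x)" if p: "p \<in> polys m UNIV" for p x
  proof -
    have "(\<lambda>x. \<Sum>j<?N. p (xhat j) * \<Lambda> j x) \<in> polys m UNIV"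
      by (intro polys_sum polys_cmult \<Lambda>)
    moreover have "(\<Sum>j<?N. p (xhat j) * \<Lambda> j (xhat i)) = p (xhat i)" if "i < ?N" for i
      using that by (simp add: \<Lambda>(2) if_distrib[where f="(*) _"] sum.delta cong: if_cong)
    ultimately have "p = (\<lambda>x. \<Sum>j<?N. p (xhat j) * \<Lambda> j x)"
      using p by (intro ex1_unique[OF ex1[of "\<lambda>j. p (xhat j)"]]) auto
    then show ?thesis by (rule fun_cong)
  qed
  then show ?thesis using \<Lambda>(1) by blast
qed

text \<open>One direction expands in the Lagrange basis, the other bounds every nodal value by the $L^2$ norm.\<close>

lemma ref_norm_equivalence:
  assumes uni: "unisolvent m xhat"
  shows "\<exists>M>0. \<forall>p\<in>polys m (UNIV :: real set).
    (LINT x|lebesgue_on ref_triangle. (p x)\<^sup>2) \<le> M * (\<Sum>j<Npoly m. (p (xhat j))\<^sup>2) \<and>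
    (\<Sum>j<Npoly m. (p (xhat j))\<^sup>2) \<le> M * (LINT x|lebesgue_on ref_triangle. (p x)\<^sup>2)"
proof -
  let ?N = "Npoly m" and ?I = "\<lambda>f. LINT x|lebesgue_on ref_triangle. (f x :: real)"
  obtain \<Lambda> where L: "\<forall>j. \<Lambda> j \<in> polys m (UNIV :: real set)"
    "\<forall>p\<in>polys m (UNIV :: real set). \<forall>x. p x = (\<Sum>j<?N. p (xhat j) * \<Lambda> j x)"
    using unisolvent_lagrange[OF uni] by blast
  note \<Lambda> = L(1)[rule_format] L(2)[rule_format]
  have int: "integrable (lebesgue_on ref_triangle) f" if "continuous_on UNIV f" for f :: "plane \<Rightarrow> real"
    using that by (intro integrable_lebesgue_on_compact ref_triangle_compact) (auto intro: continuous_on_subset)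
  define M1 where "M1 = ?I (\<lambda>x. \<Sum>j<?N. (\<Lambda> j x)\<^sup>2)"
  have M1: "?I (\<lambda>x. (p x)\<^sup>2) \<le> M1 * (\<Sum>j<?N. (p (xhat j))\<^sup>2)" if p: "p \<in> polys m UNIV" for p
  proof -
    have "?I (\<lambda>x. (p x)\<^sup>2) \<le> ?I (\<lambda>x. (\<Sum>j<?N. (p (xhat j))\<^sup>2) * (\<Sum>j<?N. (\<Lambda> j x)\<^sup>2))"
    proof (intro integral_mono int continuous_intros polys_continuous[OF p] polys_continuous[OF \<Lambda>(1)])
      show "(p x)\<^sup>2 \<le> (\<Sum>j<?N. (p (xhat j))\<^sup>2) * (\<Sum>j<?N. (\<Lambda> j x)\<^sup>2)" for x
        unfolding \<Lambda>(2)[OF p, of x] by (rule Cauchy_Schwarz_ineq_sum)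
    qed
    then show ?thesis by (simp add: M1_def mult.commute)
  qed
  have "\<exists>C. j < ?N \<longrightarrow> 0 \<le> C \<and> (\<forall>p\<in>polys m (UNIV :: real set). (p (xhat j))\<^sup>2 \<le> C * ?I (\<lambda>x. (p x)\<^sup>2))" for j
  proof (cases "j < ?N")
    case True
    then have "xhat j \<in> ref_triangle" using uni by (simp add: unisolvent_def)
    from polys_point_value_bound[OF this, of m] show ?thesis by (elim exE) (intro exI impI)
  qed simp
  then have "\<forall>j. \<exists>C. j < ?N \<longrightarrow> 0 \<le> C \<and> (\<forall>p\<in>polys m (UNIV :: real set). (p (xhat j))\<^sup>2 \<le> C * ?I (\<lambda>x. (p x)\<^sup>2))"
    by (rule allI)
  from choice[OF this] obtain C where
    C0: "\<forall>j. j < ?N \<longrightarrow> 0 \<le> C j \<and> (\<forall>p\<in>polys m (UNIV :: real set). (p (xhat j))\<^sup>2 \<le> C j * ?I (\<lambda>x. (p x)\<^sup>2))"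
    by (rule exE)
  have C: "\<And>j. j < ?N \<Longrightarrow> 0 \<le> C j"
    "\<And>j p. j < ?N \<Longrightarrow> p \<in> polys m (UNIV :: real set) \<Longrightarrow> (p (xhat j))\<^sup>2 \<le> C j * ?I (\<lambda>x. (p x)\<^sup>2)"
    using C0 by simp_all
  have C': "(\<Sum>j<?N. (p (xhat j))\<^sup>2) \<le> sum C {..<?N} * ?I (\<lambda>x. (p x)\<^sup>2)" if "p \<in> polys m UNIV" for p
    unfolding sum_distrib_right by (intro sum_mono) (use C(2) that in auto)
  have I0: "0 \<le> ?I (\<lambda>x. (p x)\<^sup>2)" for p :: "plane \<Rightarrow> real" by (intro Bochner_Integration.integral_nonneg) simp
  define M where "M = 1 + \<bar>M1\<bar> + sum C {..<?N}"
  have Mge: "M1 \<le> M" "sum C {..<?N} \<le> M" "0 < M"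
    using C(1) sum_nonneg[of "{..<?N}" C] by (auto simp: M_def)
  show ?thesis
  proof (intro exI[of _ M] conjI ballI)
    show "0 < M" by (rule Mge)
    show "?I (\<lambda>x. (p x)\<^sup>2) \<le> M * (\<Sum>j<?N. (p (xhat j))\<^sup>2)" if "p \<in> polys m UNIV" for p
      using M1[OF that] mult_right_mono[OF Mge(1) sum_nonneg[of "{..<?N}" "\<lambda>j. (p (xhat j))\<^sup>2"]] by force
    show "(\<Sum>j<?N. (p (xhat j))\<^sup>2) \<le> M * ?I (\<lambda>x. (p x)\<^sup>2)" if "p \<in> polys m UNIV" for p
      using C'[OF that] mult_right_mono[OF Mge(2) I0[of p]] by linarith
  qed
qed

lemma nodal_unisolvence_affine:
  fixes A :: mat2 and c :: "nat \<Rightarrow> real"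
  assumes uni: "unisolvent m xhat" and A: "det A \<noteq> 0"
  shows "\<exists>!p. p \<in> polys m UNIV \<and> (\<forall>j<Npoly m. p (A *v xhat j + b) = c j)"
proof -
  obtain B where AB: "A ** B = mat 1" and BA: "B ** A = mat 1"
    using A by (auto simp: invertible_det_nz[symmetric] invertible_def)
  have inv: "B *v (A *v x + b) + - (B *v b) = x" "A *v (B *v x + - (B *v b)) + b = x" for x
    by (simp_all add: matrix_vector_right_distrib matrix_vector_mult_diff_distrib
        matrix_vector_mul_assoc AB BA)
  have ex1: "\<exists>!p. p \<in> polys m UNIV \<and> (\<forall>j<Npoly m. p (xhat j) = c j)"
    using uni by (simp add: unisolvent_def)
  then obtain p where p: "p \<in> polys m UNIV" "\<forall>j<Npoly m. p (xhat j) = c j" by blast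
  show ?thesis
  proof (rule ex1I)
    show "(\<lambda>x. p (B *v x + - (B *v b))) \<in> polys m UNIV \<and>
        (\<forall>j<Npoly m. p (B *v (A *v xhat j + b) + - (B *v b)) = c j)"
      unfolding inv using p polys_affine_comp[OF p(1)] by blast
    fix q assume q: "q \<in> polys m UNIV \<and> (\<forall>j<Npoly m. q (A *v xhat j + b) = c j)"
    then have "(\<lambda>x. q (A *v x + b)) = p"
      by (intro ex1_unique[OF ex1]) (auto simp: p polys_affine_comp)
    then have "p (B *v x + - (B *v b)) = q x" for x
      using inv(2)[of x] by metis
    then show "q = (\<lambda>x. p (B *v x + - (B *v b)))" by auto
  qed
qed

text \<open>A singular affine map has a negligible image, which cannot contain a ball.\<close>

lemma affine_cell_det_nonzero:
  assumes "cball x r \<subseteq> (\<lambda>x. (A :: mat2) *v x + b) ` S" "0 < r"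
  shows "det A \<noteq> 0"
proof
  assume "det A = 0"
  then have "\<not> inj ((*v) A)" using det_nz_iff_inj[of "(*v) A"] by simp
  then have "negligible ((*v) A ` S)"
    by (intro negligible_linear_singular_image matrix_vector_mul_linear)
  then have "negligible ((+) b ` ((*v) A ` S))" by (rule negligible_translation)
  then have "negligible ((\<lambda>x. A *v x + b) ` S)" by (simp add: image_image add.commute)
  then have "negligible (ball x r)"
    using assms(1) ball_subset_cball by (meson negligible_subset order_trans)
  then show False using assms(2) by (simp add: open_not_negligible)
qed

text \<open>Scaling to the reference triangle multiplies integrals by the Jacobian, and the measure of the cell
  lies between those of an inscribed disc of radius \<open>\<gamma> * diameter K\<close> and a circumscribed one of radius
  \<open>diameter K\<close>.  The constant depends on the cell only through \<open>\<gamma>\<close>.\<close>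

lemma cell_norm_equivalence:
  assumes uni: "unisolvent m xhat" and \<gamma>: "0 < \<gamma>"
  shows "\<exists>M>0. \<forall>(A::mat2) b x. let F = (\<lambda>x. A *v x + b); K = F ` ref_triangle in
     0 < diameter K \<longrightarrow> cball x (\<gamma> * diameter K) \<subseteq> K \<longrightarrow>
     (\<forall>p\<in>polys m (UNIV :: real set).
        (LINT x|lebesgue_on K. (p x)\<^sup>2) \<le> M * ((diameter K)\<^sup>2 * (\<Sum>j<Npoly m. (p (F (xhat j)))\<^sup>2)) \<and>
        (diameter K)\<^sup>2 * (\<Sum>j<Npoly m. (p (F (xhat j)))\<^sup>2) \<le> M * (LINT x|lebesgue_on K. (p x)\<^sup>2))"
proof -
  obtain M where M0: "0 < M" "\<forall>p\<in>polys m (UNIV :: real set).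
    (LINT x|lebesgue_on ref_triangle. (p x)\<^sup>2) \<le> M * (\<Sum>j<Npoly m. (p (xhat j))\<^sup>2) \<and>
    (\<Sum>j<Npoly m. (p (xhat j))\<^sup>2) \<le> M * (LINT x|lebesgue_on ref_triangle. (p x)\<^sup>2)"
    using ref_norm_equivalence[OF uni] by blast
  then have M: "0 < M"
    "\<And>p. p \<in> polys m (UNIV :: real set) \<Longrightarrow>
       (LINT x|lebesgue_on ref_triangle. (p x)\<^sup>2) \<le> M * (\<Sum>j<Npoly m. (p (xhat j))\<^sup>2)"
    "\<And>p. p \<in> polys m (UNIV :: real set) \<Longrightarrow>
       (\<Sum>j<Npoly m. (p (xhat j))\<^sup>2) \<le> M * (LINT x|lebesgue_on ref_triangle. (p x)\<^sup>2)"
    by auto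
  define \<tau> where "\<tau> = measure lebesgue ref_triangle"
  have \<tau>0: "0 \<le> \<tau>" by (simp add: \<tau>_def)
  let ?M = "M * (pi / \<tau> + \<tau> / (pi * \<gamma>\<^sup>2) + 1)"
  show ?thesis
  proof (rule exI[of _ ?M], unfold Let_def, intro conjI allI impI ballI)
    show "0 < ?M" using M(1) \<tau>0 \<gamma> by (intro mult_pos_pos add_nonneg_pos add_nonneg_nonneg) auto
    fix A :: mat2 and b x :: plane and p :: "plane \<Rightarrow> real"
    let ?F = "\<lambda>x. A *v x + b"
    define K where "K = ?F ` ref_triangle"
    define d where "d = diameter K"
    assume "0 < diameter (?F ` ref_triangle)" "cball x (\<gamma> * diameter (?F ` ref_triangle)) \<subseteq> ?F ` ref_triangle"
    then have d: "0 < d" and ball: "cball x (\<gamma> * d) \<subseteq> K" by (auto simp: d_def K_def)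
    assume p: "p \<in> polys m UNIV"
    have det: "det A \<noteq> 0"
      using affine_cell_det_nonzero[OF ball[unfolded K_def]] d \<gamma> by simp
    have "compact K" unfolding K_def
      by (intro compact_continuous_image ref_triangle_compact continuous_intros
          linear_continuous_on_compose matrix_vector_mul_linear)
    then have Kmeas: "K \<in> lmeasurable" and Kb: "bounded K"
      by (auto simp: lmeasurable_compact compact_imp_bounded)
    have Tmeas: "ref_triangle \<in> lmeasurable" by (simp add: lmeasurable_compact ref_triangle_compact)
    have restr: "measure (lebesgue_on S) S = measure lebesgue S" if "S \<in> lmeasurable" for S :: "plane set"
      using that by (subst measure_restrict_space) (auto dest: fmeasurableD)
    have vol: "measure lebesgue K = \<bar>det A\<bar> * \<tau>"
      using lebesgue_integral_affine_image[OF ref_triangle_compact, of A b "\<lambda>_. 1"] det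
      using restr[OF Kmeas] restr[OF Tmeas] by (simp add: K_def \<tau>_def)
    have "x \<in> cball x (\<gamma> * d)" using d \<gamma> by simp
    then have x: "x \<in> K" using ball by blast
    have disc: "measure lebesgue (cball y r) = pi * r\<^sup>2" if "0 \<le> r" for y :: plane and r
      using content_ball[OF that, of y] by (simp add: content_cball_conv_ball unit_ball_vol_2)
    have "K \<subseteq> cball x d"
      using diameter_bounded_bound[OF Kb x] by (auto simp: d_def)
    then have up: "\<bar>det A\<bar> * \<tau> \<le> pi * d\<^sup>2"
      using measure_mono_fmeasurable[OF _ fmeasurableD[OF Kmeas] lmeasurable_cball, of x d] disc[of d x] d
      unfolding vol[symmetric] by simp
    have lo: "pi * (\<gamma> * d)\<^sup>2 \<le> \<bar>det A\<bar> * \<tau>"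
      using measure_mono_fmeasurable[OF ball fmeasurableD[OF lmeasurable_cball] Kmeas] disc[of "\<gamma> * d" x] d \<gamma>
      unfolding vol[symmetric] by simp
    have "0 < pi * (\<gamma> * d)\<^sup>2" using d \<gamma> by simp
    then have \<tau>: "0 < \<tau>" using lo det \<tau>0 by (cases "\<tau> = 0") auto
    define J where "J = (LINT x|lebesgue_on ref_triangle. (p (?F x))\<^sup>2)"
    define s where "s = (\<Sum>j<Npoly m. (p (?F (xhat j)))\<^sup>2)"
    have J: "J \<le> M * s" "s \<le> M * J"
      unfolding J_def s_def using M(2,3)[OF polys_affine_comp[OF p]] by auto
    have s0: "0 \<le> s" unfolding s_def by (intro sum_nonneg) auto
    have J0: "0 \<le> J" unfolding J_def by (intro Bochner_Integration.integral_nonneg) simp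
    have LK: "(LINT x|lebesgue_on K. (p x)\<^sup>2) = \<bar>det A\<bar> * J"
      unfolding K_def J_def
      by (rule lebesgue_integral_affine_image[OF ref_triangle_compact _ det])
         (intro continuous_intros polys_continuous[OF p])
    have "\<bar>det A\<bar> * J \<le> (pi / \<tau> * d\<^sup>2) * (M * s)"
      using up \<tau> J M(1) s0 J0 by (intro mult_mono) (auto simp: field_simps)
    also have "\<dots> \<le> ?M * (d\<^sup>2 * s)"
    proof -
      have "0 \<le> (M * (\<tau> / (pi * \<gamma>\<^sup>2) + 1)) * (d\<^sup>2 * s)"
        using M(1) \<tau>0 s0 by (intro mult_nonneg_nonneg add_nonneg_nonneg) auto
      then show ?thesis by (simp add: algebra_simps)
    qed
    finally show "(LINT x|lebesgue_on (?F ` ref_triangle). (p x)\<^sup>2)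
        \<le> ?M * ((diameter (?F ` ref_triangle))\<^sup>2 * (\<Sum>j<Npoly m. (p (?F (xhat j)))\<^sup>2))"
      unfolding K_def[symmetric] d_def[symmetric] s_def[symmetric] LK .
    have "d\<^sup>2 * s \<le> (\<tau> / (pi * \<gamma>\<^sup>2) * \<bar>det A\<bar>) * (M * J)"
      using lo \<tau>0 \<gamma> J M(1) s0 J0 by (intro mult_mono) (auto simp: field_simps power_mult_distrib)
    also have "\<dots> \<le> ?M * (\<bar>det A\<bar> * J)"
    proof -
      have "0 \<le> (M * (pi / \<tau> + 1)) * (\<bar>det A\<bar> * J)"
        using M(1) \<tau> J0 by (intro mult_nonneg_nonneg add_nonneg_nonneg) auto
      then show ?thesis by (simp add: algebra_simps)
    qed
    finally show "(diameter (?F ` ref_triangle))\<^sup>2 * (\<Sum>j<Npoly m. (p (?F (xhat j)))\<^sup>2)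
        \<le> ?M * (LINT x|lebesgue_on (?F ` ref_triangle). (p x)\<^sup>2)"
      unfolding K_def[symmetric] d_def[symmetric] s_def[symmetric] LK .
  qed
qed

section \<open>Nodal values of broken functions\<close>

text \<open>What is needed of one mesh to compute with nodal values alone: the discrete inner product is then a
  weighted sum over a finite set of nodes on which elements of the broken space are uniquely
  prescribed.\<close>

locale nodal_discretization =
  fixes m :: nat and d :: discretization
  assumes finite_cells: "finite (cells d)"
    and weight_pos: "K \<in> cells d \<Longrightarrow> j < Npoly m \<Longrightarrow> 0 < weight d K j"
    and nodal_unisolvence: "K \<in> cells d \<Longrightarrow>
      \<exists>!p. p \<in> polys m UNIV \<and> (\<forall>j<Npoly m. p (pts d K j) = (b j :: real))"
begin

definition nodes :: "(plane set \<times> nat) set" where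
  "nodes = cells d \<times> {..<Npoly m}"

definition nval :: "'v broken \<Rightarrow> plane set \<times> nat \<Rightarrow> 'v" where
  "nval v i = v (fst i) (pts d (fst i) (snd i))"

definition wt :: "plane set \<times> nat \<Rightarrow> real" where
  "wt i = weight d (fst i) (snd i)"

lemma finite_nodes: "finite nodes"
  by (simp add: nodes_def finite_cells)

lemma wt_pos: "i \<in> nodes \<Longrightarrow> 0 < wt i"
  by (auto simp: nodes_def wt_def weight_pos)

lemma nval_simps [simp]:
  "nval (v - w) i = nval v i - nval w i"
  "nval (lincomb r a s b) i = r *\<^sub>R nval a i + s *\<^sub>R nval b i"
  by (simp_all add: nval_def lincomb_def)

lemma hinner_nodes: "hinner m d v z = (\<Sum>i\<in>nodes. wt i * (nval v i \<bullet> nval z i))"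
  by (simp add: hinner_def nodes_def sum.Sigma wt_def nval_def case_prod_unfold finite_cells)

lemma hnorm_sq_nodes: "(hnorm m d v)\<^sup>2 = (\<Sum>i\<in>nodes. wt i * (norm (nval v i))\<^sup>2)"
proof -
  have "0 \<le> hinner m d v v"
    unfolding hinner_nodes by (intro sum_nonneg mult_nonneg_nonneg) (auto dest: wt_pos)
  then have "(hnorm m d v)\<^sup>2 = hinner m d v v" by (simp add: hnorm_def)
  then show ?thesis by (simp add: hinner_nodes power2_norm_eq_inner)
qed

lemma hnorm_nonneg: "0 \<le> hnorm m d v"
  unfolding hnorm_def hinner_nodes
  by (intro real_sqrt_ge_zero sum_nonneg mult_nonneg_nonneg) (auto dest: wt_pos)

lemma hnorm_L2_set: "hnorm m d v = L2_set (\<lambda>i. sqrt (wt i) * norm (nval v i)) nodes"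
proof -
  have "(\<Sum>i\<in>nodes. (sqrt (wt i) * norm (nval v i))\<^sup>2) = (\<Sum>i\<in>nodes. wt i * (norm (nval v i))\<^sup>2)"
    by (intro sum.cong refl) (auto simp: power_mult_distrib dest: wt_pos)
  then have "L2_set (\<lambda>i. sqrt (wt i) * norm (nval v i)) nodes = sqrt ((hnorm m d v)\<^sup>2)"
    by (simp add: L2_set_def hnorm_sq_nodes)
  then show ?thesis by (simp add: hnorm_nonneg)
qed

lemma hnorm_triangle: "hnorm m d (u - w) \<le> hnorm m d (u - v) + hnorm m d (v - w)"
proof -
  have "L2_set (\<lambda>i. sqrt (wt i) * norm (nval (u - w) i)) nodes
      \<le> L2_set (\<lambda>i. sqrt (wt i) * norm (nval (u - v) i) + sqrt (wt i) * norm (nval (v - w) i)) nodes"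
  proof (intro L2_set_mono)
    fix i assume "i \<in> nodes"
    then have "0 \<le> sqrt (wt i)" using wt_pos[of i] by simp
    moreover have "norm (nval (u - w) i) \<le> norm (nval (u - v) i) + norm (nval (v - w) i)"
      using norm_triangle_ineq[of "nval (u - v) i" "nval (v - w) i"] by simp
    ultimately show "sqrt (wt i) * norm (nval (u - w) i)
        \<le> sqrt (wt i) * norm (nval (u - v) i) + sqrt (wt i) * norm (nval (v - w) i)"
      by (metis distrib_left mult_left_mono)
    show "0 \<le> sqrt (wt i) * norm (nval (u - w) i)" using \<open>0 \<le> sqrt (wt i)\<close> by simp
  qed
  also have "\<dots> \<le> hnorm m d (u - v) + hnorm m d (v - w)"
    unfolding hnorm_L2_set by (rule L2_set_triangle_ineq)
  finally show ?thesis by (simp only: hnorm_L2_set)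
qed

lemma hnorm_commute: "hnorm m d (u - w) = hnorm m d (w - u)"
  by (simp add: hnorm_L2_set norm_minus_commute)

text \<open>With weights of order $h^2$ this is an inverse inequality: a bound of order $h$ for the discrete norm
  bounds the nodal values uniformly in $h$.\<close>

lemma node_le_hnorm: "i \<in> nodes \<Longrightarrow> wt i * (norm (nval v i))\<^sup>2 \<le> (hnorm m d v)\<^sup>2"
  unfolding hnorm_sq_nodes
  by (rule member_le_sum) (auto simp: finite_nodes dest: wt_pos)

lemma nval_Sym2: "v \<in> Zspace m d Sym2 \<Longrightarrow> i \<in> nodes \<Longrightarrow> nval v i \<in> Sym2"
  by (auto simp: Zspace_def nodes_def nval_def polys_Sym2_value)

lemma Zspace_ext:
  assumes v: "v \<in> Zspace m d Sym2" and w: "w \<in> Zspace m d Sym2"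
    and eq: "\<And>i. i \<in> nodes \<Longrightarrow> nval v i = nval w i"
  shows "v = w"
proof (intro ext)
  fix K x
  show "v K x = w K x"
  proof (cases "K \<in> cells d")
    case True
    have "v K x $ k $ l = w K x $ k $ l" for k l
    proof -
      have "(\<lambda>x. v K x $ k $ l) = (\<lambda>x. w K x $ k $ l)"
      proof (rule ex1_unique[OF nodal_unisolvence[OF True, of "\<lambda>j. w K (pts d K j) $ k $ l"]])
        show "(\<lambda>x. v K x $ k $ l) \<in> polys m UNIV \<and>
            (\<forall>j<Npoly m. v K (pts d K j) $ k $ l = w K (pts d K j) $ k $ l)"
          using v True eq by (auto simp: Zspace_def nodes_def nval_def polys_component)
        show "(\<lambda>x. w K x $ k $ l) \<in> polys m UNIV \<and>
            (\<forall>j<Npoly m. w K (pts d K j) $ k $ l = w K (pts d K j) $ k $ l)"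
          using w True by (auto simp: Zspace_def polys_component)
      qed
      then show ?thesis by (rule fun_cong)
    qed
    then show ?thesis by (simp add: vec_eq_iff)
  next
    case False
    then show ?thesis using v w by (simp add: Zspace_def)
  qed
qed

lemma Zspace_interpolant:
  assumes sym: "\<And>i. i \<in> nodes \<Longrightarrow> B i \<in> Sym2"
  shows "\<exists>v\<in>Zspace m d Sym2. \<forall>i\<in>nodes. nval v i = B i"
proof -
  define p where "p K k l = (SOME p. p \<in> polys m UNIV \<and> (\<forall>j<Npoly m. p (pts d K j) = B (K, j) $ k $ l))"
    for K k l
  have p: "p K k l \<in> polys m UNIV" "\<And>j. j < Npoly m \<Longrightarrow> p K k l (pts d K j) = B (K, j) $ k $ l"
    if "K \<in> cells d" for K k l
    using someI_ex[OF ex1_implies_ex[OF nodal_unisolvence[OF that, of "\<lambda>j. B (K, j) $ k $ l"]]]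
    unfolding p_def by auto
  define v where "v K x = (if K \<in> cells d then \<chi> k l. p K k l x else 0)" for K x
  have "p K 1 2 = p K 2 1" if "K \<in> cells d" for K
    using sym that
    by (intro ex1_unique[OF nodal_unisolvence[OF that, of "\<lambda>j. B (K, j) $ 1 $ 2"]])
       (auto simp: p Sym2_iff nodes_def)
  then have "v K x \<in> Sym2" for K x by (simp add: v_def Sym2_iff)
  then have "v \<in> Zspace m d Sym2"
    unfolding Zspace_def by (auto intro!: polys_Sym2I simp: p(1)) (auto simp: v_def p(1))
  moreover have "\<forall>i\<in>nodes. nval v i = B i"
    by (auto simp: nodes_def nval_def v_def p vec_eq_iff)
  ultimately show ?thesis by blast
qed

lemma interp_nodal:
  shows "interp m d w \<in> Zspace m d UNIV"
    and "K \<in> cells d \<Longrightarrow> j < Npoly m \<Longrightarrow> interp m d w K (pts d K j) = w (pts d K j)"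
proof -
  define P where "P v \<longleftrightarrow> v \<in> Zspace m d UNIV \<and>
     (\<forall>K\<in>cells d. \<forall>j<Npoly m. v K (pts d K j) = w (pts d K j))" for v :: "real broken"
  define p where "p K = (THE p. p \<in> polys m UNIV \<and> (\<forall>j<Npoly m. p (pts d K j) = w (pts d K j)))" for K
  have p: "p K \<in> polys m UNIV \<and> (\<forall>j<Npoly m. p K (pts d K j) = w (pts d K j))" if "K \<in> cells d" for K
    unfolding p_def by (rule theI'[OF nodal_unisolvence[OF that]])
  have "\<exists>!v. P v"
  proof (rule ex1I)
    show "P (\<lambda>K. if K \<in> cells d then p K else (\<lambda>_. 0))"
      using p by (simp add: P_def Zspace_def)
    fix v assume v: "P v"
    show "v = (\<lambda>K. if K \<in> cells d then p K else (\<lambda>_. 0))"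
    proof
      fix K
      show "v K = (if K \<in> cells d then p K else (\<lambda>_. 0))"
      proof (cases "K \<in> cells d")
        case True
        then have "v K = p K"
          using v p[OF True] by (intro ex1_unique[OF nodal_unisolvence[OF True]]) (auto simp: P_def Zspace_def)
        then show ?thesis using True by simp
      qed (use v in \<open>simp add: P_def Zspace_def\<close>)
    qed
  qed
  then have "P (THE v. P v)" by (rule theI')
  then have "P (interp m d w)" unfolding interp_def P_def .
  then show "interp m d w \<in> Zspace m d UNIV"
    and "K \<in> cells d \<Longrightarrow> j < Npoly m \<Longrightarrow> interp m d w K (pts d K j) = w (pts d K j)"
    by (auto simp: P_def)
qed

lemma interp_cong:
  assumes "\<And>K j. K \<in> cells d \<Longrightarrow> j < Npoly m \<Longrightarrow> w (pts d K j) = w' (pts d K j)"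
  shows "interp m d w = interp m d w'"
proof -
  have "(\<lambda>v. v \<in> Zspace m d UNIV \<and> (\<forall>K\<in>cells d. \<forall>j<Npoly m. v K (pts d K j) = w (pts d K j)))
    = (\<lambda>v. v \<in> Zspace m d UNIV \<and> (\<forall>K\<in>cells d. \<forall>j<Npoly m. v K (pts d K j) = w' (pts d K j)))"
    using assms by auto
  then show ?thesis by (simp only: interp_def)
qed

lemma interp_mat_nodal:
  assumes sym: "\<And>K j. K \<in> cells d \<Longrightarrow> j < Npoly m \<Longrightarrow> W (pts d K j) \<in> Sym2"
  shows "interp_mat m d W \<in> Zspace m d Sym2"
    and "i \<in> nodes \<Longrightarrow> nval (interp_mat m d W) i = W (pts d (fst i) (snd i))"
proof -
  have "interp m d (\<lambda>y. W y $ 1 $ 2) = interp m d (\<lambda>y. W y $ 2 $ 1)"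
    using sym by (intro interp_cong) (auto simp: Sym2_iff)
  then have "interp_mat m d W K x \<in> Sym2" for K x by (simp add: interp_mat_def Sym2_iff)
  moreover have "(\<lambda>x. interp_mat m d W K x $ k $ l) \<in> polys m UNIV" if "K \<in> cells d" for K k l
    using interp_nodal(1) that by (simp add: interp_mat_def Zspace_def)
  moreover have "interp_mat m d W K = (\<lambda>_. 0)" if "K \<notin> cells d" for K
  proof -
    have "interp m d w K = (\<lambda>_. 0)" for w using interp_nodal(1)[of w] that by (simp add: Zspace_def)
    then show ?thesis by (simp add: interp_mat_def vec_eq_iff fun_eq_iff)
  qed
  ultimately show "interp_mat m d W \<in> Zspace m d Sym2"
    by (auto simp: Zspace_def intro!: polys_Sym2I)
  show "nval (interp_mat m d W) i = W (pts d (fst i) (snd i))" if "i \<in> nodes"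
    using that interp_nodal(2) by (auto simp: nodes_def nval_def interp_mat_def vec_eq_iff)
qed

section \<open>Nodewise metric projection\<close>

text \<open>Since elements of the broken space are in bijection with their nodal values, the metric
  projection acts separately at every node.\<close>

lemma nearest_exists:
  assumes f: "\<And>i. i \<in> nodes \<Longrightarrow> 0 < f (pts d (fst i) (snd i))"
  shows "\<exists>P\<in>nearest m d (Bset m d f) X. \<forall>i\<in>nodes. closest (det_surface (f (pts d (fst i) (snd i)))) (nval X i) (nval P i)"
proof -
  let ?S = "\<lambda>i. det_surface (f (pts d (fst i) (snd i)))"
  define B where "B i = (SOME P. closest (?S i) (nval X i) P)" for i
  have B: "closest (?S i) (nval X i) (B i)" if "i \<in> nodes" for i
    unfolding B_def by (rule closest_exists[OF f[OF that], of "nval X i"]) (rule someI)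
  have "B i \<in> Sym2" if "i \<in> nodes" for i
    using B[OF that] by (auto simp: closest_def det_surface_def SPD2_def)
  then obtain P where P: "P \<in> Zspace m d Sym2" "\<forall>i\<in>nodes. nval P i = B i"
    using Zspace_interpolant by meson
  then have cl: "\<forall>i\<in>nodes. closest (?S i) (nval X i) (nval P i)" using B by simp
  then have "P \<in> Bset m d f"
    using P(1) by (auto simp: Bset_def closest_def det_surface_def nodes_def nval_def)
  moreover have "hnorm m d (X - P) \<le> hnorm m d (X - S)" if "S \<in> Bset m d f" for S
    unfolding hnorm_L2_set
  proof (intro L2_set_mono mult_left_mono)
    fix i assume i: "i \<in> nodes"
    then have "nval S i \<in> ?S i" using that by (auto simp: Bset_def det_surface_def nodes_def nval_def)
    then show "norm (nval (X - P) i) \<le> norm (nval (X - S) i)" using cl i by (simp add: closest_def)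
  qed (auto dest: wt_pos)
  ultimately have "P \<in> nearest m d (Bset m d f) X" by (simp add: nearest_def)
  then show ?thesis using cl by blast
qed

text \<open>Replacing the values of a nearest point by nodewise closest ones cannot decrease the distance, so
  no summand of the distance can exceed its nodal minimum.\<close>

lemma nearest_nodewise:
  assumes f: "\<And>i. i \<in> nodes \<Longrightarrow> 0 < f (pts d (fst i) (snd i))"
    and Q: "Q \<in> nearest m d (Bset m d f) X" and i: "i \<in> nodes"
  shows "closest (det_surface (f (pts d (fst i) (snd i)))) (nval X i) (nval Q i)"
proof -
  let ?S = "\<lambda>i. det_surface (f (pts d (fst i) (snd i)))"
  obtain P where P: "P \<in> nearest m d (Bset m d f) X"
    and cl: "\<And>i. i \<in> nodes \<Longrightarrow> closest (?S i) (nval X i) (nval P i)"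
    using nearest_exists[of f X] f by blast
  have Qs: "nval Q i \<in> ?S i" if "i \<in> nodes" for i
    using Q that by (auto simp: nearest_def Bset_def det_surface_def nodes_def nval_def)
  have le: "wt i * (norm (nval (X - P) i))\<^sup>2 \<le> wt i * (norm (nval (X - Q) i))\<^sup>2" if "i \<in> nodes" for i
    using cl[OF that] Qs[OF that] wt_pos[OF that] by (intro mult_left_mono power_mono) (auto simp: closest_def)
  have "hnorm m d (X - Q) \<le> hnorm m d (X - P)" using P Q by (auto simp: nearest_def)
  then have "(hnorm m d (X - Q))\<^sup>2 \<le> (hnorm m d (X - P))\<^sup>2" by (intro power_mono hnorm_nonneg)
  then have "wt i * (norm (nval (X - Q) i))\<^sup>2 \<le> wt i * (norm (nval (X - P) i))\<^sup>2"
    using sum_mono_inv[of "\<lambda>i. wt i * (norm (nval (X - P) i))\<^sup>2" nodes "\<lambda>i. wt i * (norm (nval (X - Q) i))\<^sup>2" i]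
      le i finite_nodes sum_mono[of nodes "\<lambda>i. wt i * (norm (nval (X - P) i))\<^sup>2" "\<lambda>i. wt i * (norm (nval (X - Q) i))\<^sup>2"]
    unfolding hnorm_sq_nodes by force
  then have "norm (nval X i - nval Q i) \<le> norm (nval X i - nval P i)"
    using wt_pos[OF i] by simp
  then show ?thesis using cl[OF i] Qs[OF i] by (force simp: closest_def)
qed

end

context nodal_discretization
begin

lemma hnorm_eq_0_iff:
  assumes "v \<in> Zspace m d Sym2" "w \<in> Zspace m d Sym2"
  shows "hnorm m d (v - w) = 0 \<longleftrightarrow> v = w"
proof
  assume "hnorm m d (v - w) = 0"
  then have z: "wt i * (norm (nval (v - w) i))\<^sup>2 \<le> 0" if "i \<in> nodes" for i
    using node_le_hnorm[OF that, of "v - w"] by simp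
  have "nval v i = nval w i" if "i \<in> nodes" for i
    using z[OF that] wt_pos[OF that] by (simp add: mult_le_0_iff)
  then show "v = w" using assms by (intro Zspace_ext)
qed (simp add: hnorm_L2_set L2_set_def)

lemma hinner_le: "2 * hinner m d v z \<le> (hnorm m d v)\<^sup>2 + (hnorm m d z)\<^sup>2"
proof -
  have "2 * (wt i * (nval v i \<bullet> nval z i)) \<le> wt i * (norm (nval v i))\<^sup>2 + wt i * (norm (nval z i))\<^sup>2"
    if "i \<in> nodes" for i
  proof -
    have "0 \<le> wt i * (norm (nval v i - nval z i))\<^sup>2" using wt_pos[OF that] by simp
    also have "\<dots> = wt i * (norm (nval v i))\<^sup>2 + wt i * (norm (nval z i))\<^sup>2 - 2 * (wt i * (nval v i \<bullet> nval z i))"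
      by (simp only: power2_norm_eq_inner) (simp add: inner_diff_left inner_diff_right inner_commute algebra_simps)
    finally show ?thesis by simp
  qed
  then show ?thesis
    unfolding hnorm_sq_nodes hinner_nodes sum_distrib_left sum.distrib[symmetric]
    by (intro sum_mono)
qed

section \<open>Contractions of the broken space\<close>

text \<open>Banach's theorem for the discrete norm.  The broken functions are not a metric space as a type, so
  the limit of the iterates is built from the limits of their nodal values.\<close>

lemma contraction_fixed_point:
  fixes T :: "mat2 broken \<Rightarrow> mat2 broken" and Phat :: "mat2 broken" and r :: real
  defines "U \<equiv> nbhd m d Phat r"
  assumes Phat: "Phat \<in> Zspace m d Sym2" and r: "0 \<le> r"
    and self: "\<And>Q. Q \<in> U \<Longrightarrow> T Q \<in> U"
    and q: "0 \<le> q" "q < 1"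
    and contr: "\<And>Q Q'. Q \<in> U \<Longrightarrow> Q' \<in> U \<Longrightarrow> hnorm m d (T Q - T Q') \<le> q * hnorm m d (Q - Q')"
  shows "\<exists>Pstar\<in>U. T Pstar = Pstar \<and> (\<forall>Q\<in>U. T Q = Q \<longrightarrow> Q = Pstar) \<and>
      (\<forall>P0\<in>U. (\<forall>n. hnorm m d ((T ^^ n) P0 - Pstar) \<le> q ^ n * hnorm m d (P0 - Pstar)) \<and>
         (\<lambda>n. hnorm m d ((T ^^ n) P0 - Pstar)) \<longlonglongrightarrow> 0)"
proof -
  have UZ: "Q \<in> Zspace m d Sym2" if "Q \<in> U" for Q using that by (simp add: U_def nbhd_def)
  have iter: "(T ^^ n) P \<in> U" if "P \<in> U" for n P using that by (induction n) (auto simp: self)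
  have geo: "hnorm m d ((T ^^ n) P - (T ^^ n) Q) \<le> q ^ n * hnorm m d (P - Q)" if "P \<in> U" "Q \<in> U" for n P Q
  proof (induction n)
    case (Suc n)
    have "hnorm m d ((T ^^ Suc n) P - (T ^^ Suc n) Q) \<le> q * hnorm m d ((T ^^ n) P - (T ^^ n) Q)"
      using contr iter that by simp
    also have "\<dots> \<le> q * (q ^ n * hnorm m d (P - Q))" using Suc q by (intro mult_left_mono)
    finally show ?case by (simp only: power_Suc mult.assoc)
  qed simp
  have Pin: "Phat \<in> U" using Phat r by (simp add: U_def nbhd_def hnorm_L2_set L2_set_def)
  define x where "x n = (T ^^ n) Phat" for n
  have xU: "x n \<in> U" for n using iter[OF Pin] by (simp add: x_def)
  define a where "a = hnorm m d (T Phat - Phat)"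
  have step: "hnorm m d (x (Suc n) - x n) \<le> q ^ n * a" for n
  proof -
    have "x (Suc n) = (T ^^ n) (T Phat)" by (simp only: x_def funpow_Suc_right o_def)
    then show ?thesis using geo[OF self[OF Pin] Pin] by (simp add: x_def a_def)
  qed
  have conv: "convergent (\<lambda>n. nval (x n) i)" if i: "i \<in> nodes" for i
  proof -
    have w: "0 < sqrt (wt i)" using wt_pos[OF i] by simp
    have bound: "norm (nval (x (Suc n)) i - nval (x n) i) \<le> (a / sqrt (wt i)) * q ^ n" for n
    proof -
      have "(sqrt (wt i) * norm (nval (x (Suc n) - x n) i))\<^sup>2 \<le> (hnorm m d (x (Suc n) - x n))\<^sup>2"
        using node_le_hnorm[OF i, of "x (Suc n) - x n"] wt_pos[OF i] by (simp add: power_mult_distrib)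
      then have "sqrt (wt i) * norm (nval (x (Suc n) - x n) i) \<le> q ^ n * a"
        using hnorm_nonneg step[of n] by (meson order_trans power2_le_imp_le)
      then show ?thesis using w by (simp add: field_simps)
    qed
    have "summable (\<lambda>n. nval (x (Suc n)) i - nval (x n) i)"
    proof (rule summable_comparison_test')
      show "summable (\<lambda>n. (a / sqrt (wt i)) * q ^ n)"
        using q by (intro summable_mult summable_geometric) simp
      show "norm (nval (x (Suc n)) i - nval (x n) i) \<le> (a / sqrt (wt i)) * q ^ n" if "0 \<le> n" for n
        by (rule bound)
    qed
    then have "convergent (\<lambda>n. (\<Sum>k<n. nval (x (Suc k)) i - nval (x k) i))"
      by (simp add: summable_iff_convergent)
    then have "convergent (\<lambda>n. nval (x n) i - nval (x 0) i)"
      using sum_lessThan_telescope[of "\<lambda>n. nval (x n) i"] by simp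
    then have "convergent (\<lambda>n. (nval (x n) i - nval (x 0) i) + nval (x 0) i)"
      by (intro convergent_add convergent_const)
    then show ?thesis by simp
  qed
  define B where "B i = lim (\<lambda>n. nval (x n) i)" for i
  have lim: "(\<lambda>n. nval (x n) i) \<longlonglongrightarrow> B i" if "i \<in> nodes" for i
    using conv[OF that] by (simp add: B_def convergent_LIMSEQ_iff)
  have Bsym: "B i \<in> Sym2" if i: "i \<in> nodes" for i
  proof -
    have "(\<lambda>n. nval (x n) i $ 1 $ 2) \<longlonglongrightarrow> B i $ 1 $ 2" "(\<lambda>n. nval (x n) i $ 2 $ 1) \<longlonglongrightarrow> B i $ 2 $ 1"
      by (intro tendsto_vec_nth lim i)+
    moreover have "(\<lambda>n. nval (x n) i $ 1 $ 2) = (\<lambda>n. nval (x n) i $ 2 $ 1)"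
      using nval_Sym2[OF UZ[OF xU] i] by (simp add: Sym2_iff)
    ultimately show ?thesis using LIMSEQ_unique by (auto simp: Sym2_iff)
  qed
  have "\<exists>v\<in>Zspace m d Sym2. \<forall>i\<in>nodes. nval v i = B i"
    by (rule Zspace_interpolant) (rule Bsym)
  then obtain v where v: "v \<in> Zspace m d Sym2" "\<forall>i\<in>nodes. nval v i = B i"
    by blast
  have lim0: "(\<lambda>n. hnorm m d (x n - v)) \<longlonglongrightarrow> 0"
  proof -
    have "(\<lambda>n. wt i * (norm (nval (x n) i - nval v i))\<^sup>2) \<longlonglongrightarrow> wt i * (norm (B i - B i))\<^sup>2" if "i \<in> nodes" for i
    proof -
      have vi: "nval v i = B i" using v(2) that by simp
      show ?thesis unfolding vi
        by (rule tendsto_mult[OF tendsto_const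
              tendsto_power[OF tendsto_norm[OF tendsto_diff[OF lim[OF that] tendsto_const]]]])
    qed
    then have "(\<lambda>n. \<Sum>i\<in>nodes. wt i * (norm (nval (x n) i - nval v i))\<^sup>2) \<longlonglongrightarrow> (\<Sum>i\<in>nodes. wt i * (norm (B i - B i))\<^sup>2)"
      by (intro tendsto_sum)
    then have "(\<lambda>n. (hnorm m d (x n - v))\<^sup>2) \<longlonglongrightarrow> 0" by (simp add: hnorm_sq_nodes)
    then have "(\<lambda>n. sqrt ((hnorm m d (x n - v))\<^sup>2)) \<longlonglongrightarrow> sqrt 0" by (rule tendsto_real_sqrt)
    then show ?thesis by (simp add: hnorm_nonneg)
  qed
  have "hnorm m d (v - Phat) \<le> r"
  proof (rule LIMSEQ_le_const)
    show "(\<lambda>n. hnorm m d (x n - v) + r) \<longlonglongrightarrow> r" using tendsto_add[OF lim0 tendsto_const[of r]] by simp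
    have "hnorm m d (v - Phat) \<le> hnorm m d (x n - v) + r" for n
      using hnorm_triangle[of v Phat "x n"] xU[of n] hnorm_commute[of v "x n"] by (simp add: U_def nbhd_def)
    then show "\<exists>N. \<forall>n\<ge>N. hnorm m d (v - Phat) \<le> hnorm m d (x n - v) + r" by blast
  qed
  then have vU: "v \<in> U" using v(1) by (simp add: U_def nbhd_def)
  have "hnorm m d (T v - v) \<le> 0"
  proof (rule LIMSEQ_le_const)
    have "(\<lambda>n. q * hnorm m d (x n - v) + hnorm m d (x (Suc n) - v)) \<longlonglongrightarrow> q * 0 + 0"
      by (intro tendsto_intros lim0 LIMSEQ_Suc)
    then show "(\<lambda>n. q * hnorm m d (x n - v) + hnorm m d (x (Suc n) - v)) \<longlonglongrightarrow> 0" by simp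
    have "hnorm m d (T v - v) \<le> q * hnorm m d (x n - v) + hnorm m d (x (Suc n) - v)" for n
      using hnorm_triangle[of "T v" v "x (Suc n)"] contr[OF vU xU[of n]] hnorm_commute[of v "x n"]
      by (simp add: x_def)
    then show "\<exists>N. \<forall>n\<ge>N. hnorm m d (T v - v) \<le> q * hnorm m d (x n - v) + hnorm m d (x (Suc n) - v)" by blast
  qed
  then have fp: "T v = v"
    using hnorm_eq_0_iff[OF UZ[OF self[OF vU]] v(1)] hnorm_nonneg[of "T v - v"] by simp
  have uniq: "Q = v" if "Q \<in> U" "T Q = Q" for Q
  proof -
    have "hnorm m d (Q - v) \<le> q * hnorm m d (Q - v)" using contr[OF that(1) vU] that(2) fp by simp
    then have "(1 - q) * hnorm m d (Q - v) \<le> 0" by (simp add: algebra_simps)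
    then have "hnorm m d (Q - v) = 0"
      using q hnorm_nonneg[of "Q - v"] by (simp add: mult_le_0_iff)
    then show ?thesis using hnorm_eq_0_iff UZ that(1) v(1) by blast
  qed
  have "(T ^^ n) v = v" for n by (induction n) (simp_all add: fp)
  then have rate: "hnorm m d ((T ^^ n) P0 - v) \<le> q ^ n * hnorm m d (P0 - v)" if "P0 \<in> U" for P0 n
    using geo[OF that vU, of n] by simp
  have "(\<lambda>n. hnorm m d ((T ^^ n) P0 - v)) \<longlonglongrightarrow> 0" if "P0 \<in> U" for P0
  proof (rule tendsto_sandwich[OF _ _ tendsto_const])
    show "(\<lambda>n. q ^ n * hnorm m d (P0 - v)) \<longlonglongrightarrow> 0"
      using tendsto_mult_right[OF LIMSEQ_realpow_zero[OF q], of "hnorm m d (P0 - v)"] by simp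
  qed (intro always_eventually allI hnorm_nonneg rate that)+
  then show ?thesis using vU fp uniq rate by blast
qed

end

section \<open>Energy estimate for the reconstruction\<close>

text \<open>Provides the duality form of the spanning hypothesis that the solvability lemma asks for.\<close>

lemma linear_functional_on_span:
  fixes X :: "real broken set"
  assumes \<psi>: "linear_functional_on X lincomb \<psi>" and B: "finite B" "X = {v. \<exists>c. v = (\<lambda>K x. \<Sum>b\<in>B. c b * b K x)}"
  shows "B \<subseteq> X" and "(\<forall>b\<in>B. \<psi> b = 0) \<Longrightarrow> v \<in> X \<Longrightarrow> \<psi> v = 0"
proof -
  have part: "(\<lambda>K x. \<Sum>b\<in>F. c b * b K x) \<in> X" if "F \<subseteq> B" for F c
  proof -
    have "(\<Sum>b\<in>F. c b * b K x) = (\<Sum>b\<in>B. (if b \<in> F then c b else 0) * b K x)" for K x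
      using that B(1) by (intro sum.mono_neutral_cong_left) auto
    then show ?thesis unfolding B(2) by auto
  qed
  show BX: "B \<subseteq> X"
  proof
    fix b assume b: "b \<in> B"
    have "b = (\<lambda>K x. \<Sum>b\<in>{b}. 1 * b K x)" by simp
    then show "b \<in> X" using part[of "{b}" "\<lambda>_. 1"] b by simp
  qed
  assume zero: "\<forall>b\<in>B. \<psi> b = 0" and v: "v \<in> X"
  obtain c where c: "v = (\<lambda>K x. \<Sum>b\<in>B. c b * b K x)" using v B(2) by auto
  have "\<psi> (\<lambda>K x. \<Sum>b\<in>F. c b * b K x) = 0" if "finite F" "F \<subseteq> B" for F
    using that
  proof (induction F rule: finite_induct)
    case empty
    have "\<psi> (lincomb 0 (\<lambda>K x. 0) 0 (\<lambda>K x. 0)) = 0"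
      using \<psi> part[of "{}" c] by (simp add: linear_functional_on_def)
    then show ?case by (simp add: lincomb_def)
  next
    case (insert b F)
    let ?w = "\<lambda>K x. \<Sum>b\<in>F. c b * b K x"
    have "(\<lambda>K x. \<Sum>b\<in>insert b F. c b * b K x) = lincomb (c b) b 1 ?w"
      using insert.hyps by (simp add: lincomb_def)
    moreover have "\<psi> (lincomb (c b) b 1 ?w) = c b * \<psi> b + 1 * \<psi> ?w"
      using \<psi> part[of F c] insert.prems BX by (simp add: linear_functional_on_def subset_iff)
    ultimately show ?case using insert zero by simp
  qed
  then show "\<psi> v = 0" using c B(1) by simp
qed

context nodal_discretization
begin

lemma hinner_commute: "hinner m d v z = hinner m d z v"
  by (simp add: hinner_nodes inner_commute)

lemma hinner_lincomb: "hinner m d (lincomb r v s w) z = r * hinner m d v z + s * hinner m d w z"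
  by (simp add: hinner_nodes inner_add_left sum_distrib_left sum.distrib algebra_simps)

lemma hinner_self: "hinner m d v v = (hnorm m d v)\<^sup>2"
  by (simp add: hinner_nodes hnorm_sq_nodes power2_norm_eq_inner)

text \<open>The form \<open>aform\<close> is only semidefinite, but the right-hand side sees a test function through its
  discrete Hessian, which vanishes at all nodes on the kernel of the form.\<close>

lemma Rmap_solves:
  assumes rec: "reconstruction_ok m d" and \<sigma>: "0 \<le> \<sigma>"
  shows "\<exists>u\<in>Xspace d. Rmap m \<sigma> d P = Hess d u \<and>
     (\<forall>v\<in>Xspace d. aform m \<sigma> d u v = hinner m d P (Hess d v))"
proof -
  obtain B where B: "finite B" "Xspace d = {v. \<exists>c. v = (\<lambda>K x. \<Sum>b\<in>B. c b * b K x)}"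
    using rec by (auto simp: reconstruction_ok_def fin_dim_space_def)
  have Hlin: "Hess d (lincomb r v s w) = lincomb r (Hess d v) s (Hess d w)"
    if "v \<in> Xspace d" "w \<in> Xspace d" for r v s w
    using rec that by (simp add: reconstruction_ok_def)
  interpret semi_inner_space "Xspace d" lincomb "aform m \<sigma> d"
  proof
    show "lincomb r v s w \<in> Xspace d" if "v \<in> Xspace d" "w \<in> Xspace d" for v w r s
    proof -
      obtain a b where "v = (\<lambda>K x. \<Sum>i\<in>B. a i * i K x)" "w = (\<lambda>K x. \<Sum>i\<in>B. b i * i K x)"
        using \<open>v \<in> Xspace d\<close> \<open>w \<in> Xspace d\<close> unfolding B(2) by blast
      then have "lincomb r v s w = (\<lambda>K x. \<Sum>i\<in>B. (r * a i + s * b i) * i K x)"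
        by (simp add: lincomb_def sum_distrib_left sum.distrib algebra_simps)
      then show ?thesis unfolding B(2) mem_Collect_eq by (rule exI[of _ "\<lambda>i. r * a i + s * b i"])
    qed
    show "Xspace d \<noteq> {}" unfolding B(2) by blast
    show "aform m \<sigma> d v w = aform m \<sigma> d w v" if "v \<in> Xspace d" "w \<in> Xspace d" for v w
      using rec that hinner_commute[of "Hess d v"] by (simp add: aform_def reconstruction_ok_def)
    show "linear_functional_on (Xspace d) lincomb (\<lambda>v. aform m \<sigma> d v w)" if "w \<in> Xspace d" for w
      using rec that unfolding linear_functional_on_def reconstruction_ok_def
      by (simp add: aform_def hinner_lincomb algebra_simps)
    show "0 \<le> aform m \<sigma> d v v" if "v \<in> Xspace d" for v
      using rec that \<sigma> by (simp add: aform_def reconstruction_ok_def hinner_self)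
  qed
  have \<phi>: "linear_functional_on (Xspace d) lincomb (\<lambda>v. hinner m d P (Hess d v))"
    unfolding linear_functional_on_def by (simp add: Hlin hinner_commute[of P] hinner_lincomb)
  have "\<forall>e\<in>Xspace d. aform m \<sigma> d e e = 0 \<longrightarrow> hinner m d P (Hess d e) = 0"
  proof (intro ballI impI)
    fix e assume e: "e \<in> Xspace d" and "aform m \<sigma> d e e = 0"
    moreover have "0 \<le> \<sigma> * Jform d e e" using rec e \<sigma> by (simp add: reconstruction_ok_def)
    ultimately have "(hnorm m d (Hess d e))\<^sup>2 \<le> 0" unfolding aform_def hinner_self by linarith
    then have "wt i * (norm (nval (Hess d e) i))\<^sup>2 \<le> 0" if "i \<in> nodes" for i
      using node_le_hnorm[OF that, of "Hess d e"] by linarith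
    then have "nval (Hess d e) i = 0" if "i \<in> nodes" for i
      using wt_pos[OF that] that by (fastforce simp: mult_le_0_iff)
    then show "hinner m d P (Hess d e) = 0" by (simp add: hinner_nodes)
  qed
  moreover have "B \<subseteq> Xspace d" by (rule linear_functional_on_span(1)[OF \<phi> B])
  moreover have "\<forall>\<psi>. linear_functional_on (Xspace d) lincomb \<psi> \<longrightarrow> (\<forall>w\<in>B. \<psi> w = 0) \<longrightarrow> (\<forall>v\<in>Xspace d. \<psi> v = 0)"
    using linear_functional_on_span(2)[OF _ B] by blast
  ultimately have "\<exists>u\<in>Xspace d. \<forall>v\<in>Xspace d. aform m \<sigma> d u v = hinner m d P (Hess d v)"
    using solvable[OF B(1) _ \<phi>] by blast
  then have "\<exists>u. u \<in> Xspace d \<and> (\<forall>v\<in>Xspace d. aform m \<sigma> d u v = hinner m d P (Hess d v))" by blast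
  from someI_ex[OF this] show ?thesis unfolding Rmap_def by blast
qed

text \<open>The variational equation is linear in the data, so the difference \<open>w\<close> of two reconstructed functions
  can be tested with itself.  The penalty appears with the factor \<open>2\<close> after Young's inequality; it is
  what the reconstruction gains over mere nonexpansiveness.\<close>

lemma Rmap_energy:
  assumes rec: "reconstruction_ok m d" and \<sigma>: "0 \<le> \<sigma>"
  shows "\<exists>w\<in>Xspace d. Rmap m \<sigma> d Q - Rmap m \<sigma> d Q' = Hess d w \<and>
     (hnorm m d (Hess d w))\<^sup>2 + 2 * \<sigma> * Jform d w w \<le> (hnorm m d (Q - Q'))\<^sup>2"
proof -
  obtain u where u: "u \<in> Xspace d" "Rmap m \<sigma> d Q = Hess d u"
      "\<forall>v\<in>Xspace d. aform m \<sigma> d u v = hinner m d Q (Hess d v)"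
    using Rmap_solves[OF assms] by blast
  obtain u' where u': "u' \<in> Xspace d" "Rmap m \<sigma> d Q' = Hess d u'"
      "\<forall>v\<in>Xspace d. aform m \<sigma> d u' v = hinner m d Q' (Hess d v)"
    using Rmap_solves[OF assms] by blast
  define w where "w = lincomb 1 u (-1) u'"
  have diff: "lincomb 1 a (-1) b = a - b" for a b :: "mat2 broken"
    by (simp add: lincomb_def fun_eq_iff)
  have w: "w \<in> Xspace d"
  proof -
    obtain B where B: "Xspace d = {v. \<exists>c. v = (\<lambda>K x. \<Sum>b\<in>B. c b * b K x)}"
      using rec by (auto simp: reconstruction_ok_def fin_dim_space_def)
    obtain a b where "u = (\<lambda>K x. \<Sum>i\<in>B. a i * i K x)" "u' = (\<lambda>K x. \<Sum>i\<in>B. b i * i K x)"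
      using u(1) u'(1) unfolding B by blast
    then have "w = (\<lambda>K x. \<Sum>i\<in>B. (a i - b i) * i K x)"
      by (simp add: w_def lincomb_def sum_subtractf algebra_simps)
    then show ?thesis unfolding B mem_Collect_eq by (rule exI[of _ "\<lambda>i. a i - b i"])
  qed
  have Hw: "Hess d w = Rmap m \<sigma> d Q - Rmap m \<sigma> d Q'"
    using rec u(1,2) u'(1,2) by (simp add: w_def reconstruction_ok_def diff)
  have "aform m \<sigma> d w w = 1 * aform m \<sigma> d u w + (-1) * aform m \<sigma> d u' w"
    using rec u(1) u'(1) w unfolding reconstruction_ok_def
    by (subst (1) w_def) (simp add: aform_def hinner_lincomb algebra_simps)
  also have "\<dots> = hinner m d (Q - Q') (Hess d w)"
    using u(3) u'(3) w hinner_lincomb[of 1 Q "-1" Q' "Hess d w"] by (simp add: diff)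
  finally have "2 * aform m \<sigma> d w w \<le> (hnorm m d (Q - Q'))\<^sup>2 + (hnorm m d (Hess d w))\<^sup>2"
    using hinner_le[of "Q - Q'" "Hess d w"] by simp
  then have "(hnorm m d (Hess d w))\<^sup>2 + 2 * \<sigma> * Jform d w w \<le> (hnorm m d (Q - Q'))\<^sup>2"
    by (simp add: aform_def hinner_self)
  then show ?thesis using w Hw[symmetric] by blast
qed

end

context nodal_discretization
begin

section \<open>Stability of discrete Hessians close to the tangent plane\<close>

lemma sum_nodes: "(\<Sum>i\<in>nodes. F i) = (\<Sum>K\<in>cells d. \<Sum>j<Npoly m. F (K, j))"
  by (simp add: nodes_def sum.cartesian_product)

text \<open>The core of the argument.  Discrete Hessians \<open>G\<close> that are nearly tangent to the constraint surface
  have a norm controlled by the penalty \<open>J\<close>.  The Cordes inequality bounds the squared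
  trace by \<open>1 - \<delta>\<^sup>2\<close> times the squared norm plus the normal component, and inserting this in the hypothesis
  on the traces leaves a positive multiple of the norm on the left.  The Cordes inequality is pointwise
  in $L^2$ while tangency holds only at the nodes; freezing the normal to a constant \<open>B K\<close> on every cell
  bridges the two, and its error is absorbed since \<open>E\<^sub>1 * \<eta>\<^sup>2 \<le> 1 / 2\<close>.  The number \<open>E\<^sub>1\<close> collects the
  constants in front of the normal component, \<open>E\<^sub>2\<close> those in front of the penalty.\<close>

lemma broken_stability:
  assumes G: "G \<in> Zspace m d Sym2" and J: "0 \<le> J"
    and M: "0 < M"
      "\<And>K p. K \<in> cells d \<Longrightarrow> p \<in> polys m UNIV \<Longrightarrow>
        (LINT x|lebesgue_on K. (p x)\<^sup>2) \<le> M * ((diameter K)\<^sup>2 * (\<Sum>j<Npoly m. (p (pts d K j))\<^sup>2))"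
      "\<And>K p. K \<in> cells d \<Longrightarrow> p \<in> polys m UNIV \<Longrightarrow>
        (diameter K)\<^sup>2 * (\<Sum>j<Npoly m. (p (pts d K j))\<^sup>2) \<le> M * (LINT x|lebesgue_on K. (p x)\<^sup>2)"
    and w: "0 < c" "0 < C"
      "\<And>K j. K \<in> cells d \<Longrightarrow> j < Npoly m \<Longrightarrow> c * (diameter K)\<^sup>2 \<le> weight d K j"
      "\<And>K j. K \<in> cells d \<Longrightarrow> j < Npoly m \<Longrightarrow> weight d K j \<le> C * (diameter K)\<^sup>2"
    and cpt: "\<And>K. K \<in> cells d \<Longrightarrow> compact K"
    and c0: "0 < c0" and b: "0 < b"
    and B: "\<And>K. K \<in> cells d \<Longrightarrow> B K \<in> Sym2" "\<And>K. K \<in> cells d \<Longrightarrow> c0 \<le> det (B K)"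
      "\<And>K. K \<in> cells d \<Longrightarrow> norm (B K) \<le> b"
    and N: "\<And>i. i \<in> nodes \<Longrightarrow> norm (N i - B (fst i)) \<le> \<eta>"
    and A2: "broken_L2 d G \<le> broken_L2 d (\<lambda>K x. trace (G K x)) + C\<^sub>J * sqrt J"
    and \<delta>: "\<delta> = 2 * c0 / b\<^sup>2"
    and E\<^sub>1: "E\<^sub>1 = C * M * (1 + \<delta>\<^sup>2) * ((1 + 1 / \<delta>) / c0) * (M / c * 2) / \<delta> ^ 4"
    and E\<^sub>2: "E\<^sub>2 = C * M * (1 + 1 / \<delta>\<^sup>2) * C\<^sub>J\<^sup>2 / \<delta> ^ 4"
    and \<eta>: "E\<^sub>1 * \<eta>\<^sup>2 \<le> 1 / 2"
  shows "(hnorm m d G)\<^sup>2 \<le> 2 * (E\<^sub>1 + E\<^sub>2) * (J + (\<Sum>i\<in>nodes. wt i * (N i \<bullet> nval G i)\<^sup>2))"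
proof -
  let ?I = "\<lambda>K f. LINT x|lebesgue_on K. (f x :: real)"
  have \<delta>0: "0 < \<delta>" using \<delta> c0 b by simp
  have poly: "(\<lambda>x. G K x $ k $ l) \<in> polys m UNIV" if "K \<in> cells d" for K k l
    using G that by (auto simp: Zspace_def intro: polys_component)
  have cont: "continuous_on S (\<lambda>x. G K x $ k $ l)" if "K \<in> cells d" for K k l S
    using polys_continuous[OF poly[OF that]] .
  have int: "integrable (lebesgue_on K) f" if "K \<in> cells d" "continuous_on K f" for K and f :: "plane \<Rightarrow> real"
    using integrable_lebesgue_on_compact cpt that by blast
  note ci = continuous_on_add continuous_on_mult continuous_on_power continuous_on_const cont
  define L where "L = (\<Sum>K\<in>cells d. ?I K (\<lambda>x. (norm (G K x))\<^sup>2))"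
  define T where "T = (\<Sum>K\<in>cells d. ?I K (\<lambda>x. (trace (G K x))\<^sup>2))"
  define S where "S = (\<Sum>K\<in>cells d. ?I K (\<lambda>x. (B K \<bullet> G K x)\<^sup>2))"
  define H where "H = (hnorm m d G)\<^sup>2"
  define R where "R = (\<Sum>i\<in>nodes. wt i * (N i \<bullet> nval G i)\<^sup>2)"
  have L0: "0 \<le> L" and T0: "0 \<le> T"
    unfolding L_def T_def by (intro sum_nonneg Bochner_Integration.integral_nonneg; simp)+
  have R0: "0 \<le> R" unfolding R_def by (intro sum_nonneg mult_nonneg_nonneg) (auto dest: wt_pos)
  \<comment> \<open>Each of the four components is a scalar polynomial, to which the equivalence \<open>M(3)\<close> applies.\<close>
  have H: "H \<le> C * M * L"
  proof -
    have "H = (\<Sum>K\<in>cells d. \<Sum>j<Npoly m. weight d K j * (norm (G K (pts d K j)))\<^sup>2)"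
      unfolding H_def hnorm_sq_nodes sum_nodes by (simp add: wt_def nval_def)
    also have "\<dots> \<le> (\<Sum>K\<in>cells d. C * (M * ?I K (\<lambda>x. (norm (G K x))\<^sup>2)))"
    proof (rule sum_mono)
      fix K assume K: "K \<in> cells d"
      let ?g = "\<lambda>k l x. G K x $ k $ l"
      have "(\<Sum>j<Npoly m. weight d K j * (norm (G K (pts d K j)))\<^sup>2)
          \<le> (\<Sum>j<Npoly m. (C * (diameter K)\<^sup>2) * (norm (G K (pts d K j)))\<^sup>2)"
        using w(4)[OF K] by (intro sum_mono mult_right_mono) auto
      also have "\<dots> = C * ((diameter K)\<^sup>2 * (\<Sum>j<Npoly m. (?g 1 1 (pts d K j))\<^sup>2)
          + (diameter K)\<^sup>2 * (\<Sum>j<Npoly m. (?g 1 2 (pts d K j))\<^sup>2)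
          + (diameter K)\<^sup>2 * (\<Sum>j<Npoly m. (?g 2 1 (pts d K j))\<^sup>2)
          + (diameter K)\<^sup>2 * (\<Sum>j<Npoly m. (?g 2 2 (pts d K j))\<^sup>2))"
        by (simp add: norm_mat2 sum_distrib_left sum.distrib algebra_simps)
      also have "\<dots> \<le> C * (M * ?I K (\<lambda>x. (?g 1 1 x)\<^sup>2) + M * ?I K (\<lambda>x. (?g 1 2 x)\<^sup>2)
          + M * ?I K (\<lambda>x. (?g 2 1 x)\<^sup>2) + M * ?I K (\<lambda>x. (?g 2 2 x)\<^sup>2))"
        using w(2) by (intro mult_left_mono add_mono M(3) K poly) simp_all
      also have "\<dots> = C * (M * ?I K (\<lambda>x. (norm (G K x))\<^sup>2))"
      proof -
        have i: "integrable (lebesgue_on K) (\<lambda>x. (?g k l x)\<^sup>2)" for k l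
          by (intro int K ci)
        show ?thesis unfolding norm_mat2 by (simp add: i algebra_simps)
      qed
      finally show "(\<Sum>j<Npoly m. weight d K j * (norm (G K (pts d K j)))\<^sup>2)
          \<le> C * (M * ?I K (\<lambda>x. (norm (G K x))\<^sup>2))" .
    qed
    also have "\<dots> = C * M * L" by (simp add: L_def sum_distrib_left mult.assoc)
    finally show ?thesis .
  qed
  have T: "T \<le> (1 - \<delta>\<^sup>2) * L + (1 + 1 / \<delta>) / c0 * S"
    unfolding T_def L_def S_def sum_distrib_left sum.distrib[symmetric]
  proof (rule sum_mono)
    fix K assume K: "K \<in> cells d"
    have i1: "integrable (lebesgue_on K) (\<lambda>x. (norm (G K x))\<^sup>2)"
      unfolding norm_mat2 by (intro int K ci)
    have i2: "integrable (lebesgue_on K) (\<lambda>x. (B K \<bullet> G K x)\<^sup>2)"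
      unfolding inner_mat2 by (intro int K ci)
    have i3: "integrable (lebesgue_on K) (\<lambda>x. (trace (G K x))\<^sup>2)"
      unfolding trace_mat2 by (intro int K ci)
    have "?I K (\<lambda>x. (trace (G K x))\<^sup>2) \<le> ?I K (\<lambda>x. (1 - \<delta>\<^sup>2) * (norm (G K x))\<^sup>2
        + (1 + 1 / \<delta>) / c0 * (B K \<bullet> G K x)\<^sup>2)"
      using cordes[OF c0 B(2)[OF K] B(3)[OF K] \<delta> B(1)[OF K]]
      by (intro integral_mono i3 Bochner_Integration.integrable_add integrable_mult_right i1 i2) auto
    also have "\<dots> = (1 - \<delta>\<^sup>2) * ?I K (\<lambda>x. (norm (G K x))\<^sup>2) + (1 + 1 / \<delta>) / c0 * ?I K (\<lambda>x. (B K \<bullet> G K x)\<^sup>2)"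
      using i1 i2 by simp
    finally show "?I K (\<lambda>x. (trace (G K x))\<^sup>2) \<le> \<dots>" .
  qed
  \<comment> \<open>With \<open>B K\<close> constant on the cell, \<open>B K \<bullet> G K x\<close> is again a polynomial and is controlled by its
    nodal values, where \<open>B K\<close> may be exchanged for \<open>N i\<close> at the price of the oscillation \<open>\<eta>\<close>.\<close>
  have S: "S \<le> M / c * 2 * (R + \<eta>\<^sup>2 * H)"
  proof -
    have "S \<le> (\<Sum>K\<in>cells d. \<Sum>j<Npoly m. M / c * (weight d K j * (B K \<bullet> G K (pts d K j))\<^sup>2))"
      unfolding S_def
    proof (rule sum_mono)
      fix K assume K: "K \<in> cells d"
      have p: "(\<lambda>x. B K \<bullet> G K x) \<in> polys m UNIV"
        unfolding inner_mat2 by (intro polys_add polys_cmult poly[OF K])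
      have "?I K (\<lambda>x. (B K \<bullet> G K x)\<^sup>2) \<le> M * ((diameter K)\<^sup>2 * (\<Sum>j<Npoly m. (B K \<bullet> G K (pts d K j))\<^sup>2))"
        by (rule M(2)[OF K p])
      also have "\<dots> = (\<Sum>j<Npoly m. M / c * ((c * (diameter K)\<^sup>2) * (B K \<bullet> G K (pts d K j))\<^sup>2))"
        using w(1) by (simp add: sum_distrib_left)
      also have "\<dots> \<le> (\<Sum>j<Npoly m. M / c * (weight d K j * (B K \<bullet> G K (pts d K j))\<^sup>2))"
        using w(1,3) K M(1) by (intro sum_mono mult_left_mono mult_right_mono) auto
      finally show "?I K (\<lambda>x. (B K \<bullet> G K x)\<^sup>2) \<le> \<dots>" .
    qed
    also have "\<dots> = M / c * (\<Sum>i\<in>nodes. wt i * (B (fst i) \<bullet> nval G i)\<^sup>2)"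
      by (simp add: sum_nodes wt_def nval_def sum_distrib_left)
    also have "\<dots> \<le> M / c * (\<Sum>i\<in>nodes. 2 * (wt i * (N i \<bullet> nval G i)\<^sup>2 + \<eta>\<^sup>2 * (wt i * (norm (nval G i))\<^sup>2)))"
    proof (intro mult_left_mono sum_mono)
      fix i assume i: "i \<in> nodes"
      let ?n = "N i \<bullet> nval G i" and ?e = "(B (fst i) - N i) \<bullet> nval G i"
      have "B (fst i) \<bullet> nval G i = ?n + ?e" by (simp add: inner_diff_left)
      then have "(B (fst i) \<bullet> nval G i)\<^sup>2 = (?n + ?e)\<^sup>2" by (rule arg_cong)
      also have "\<dots> \<le> 2 * (?n\<^sup>2 + ?e\<^sup>2)"
        using sum_squares_bound[of ?n ?e] by (simp add: power2_sum)
      also have "\<dots> \<le> 2 * (?n\<^sup>2 + \<eta>\<^sup>2 * (norm (nval G i))\<^sup>2)"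
      proof -
        have "\<bar>?e\<bar> \<le> norm (B (fst i) - N i) * norm (nval G i)" by (rule Cauchy_Schwarz_ineq2)
        also have "\<dots> \<le> \<eta> * norm (nval G i)"
          using N[OF i] by (intro mult_right_mono) (auto simp: norm_minus_commute)
        finally have "\<bar>?e\<bar>\<^sup>2 \<le> (\<eta> * norm (nval G i))\<^sup>2" by (intro power_mono) auto
        then show ?thesis by (simp add: power_mult_distrib)
      qed
      finally have "(B (fst i) \<bullet> nval G i)\<^sup>2 \<le> 2 * (?n\<^sup>2 + \<eta>\<^sup>2 * (norm (nval G i))\<^sup>2)" .
      then have "wt i * (B (fst i) \<bullet> nval G i)\<^sup>2 \<le> wt i * (2 * (?n\<^sup>2 + \<eta>\<^sup>2 * (norm (nval G i))\<^sup>2))"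
        using wt_pos[OF i] by (intro mult_left_mono) auto
      then show "wt i * (B (fst i) \<bullet> nval G i)\<^sup>2 \<le> 2 * (wt i * ?n\<^sup>2 + \<eta>\<^sup>2 * (wt i * (norm (nval G i))\<^sup>2))"
        by (simp add: algebra_simps)
    qed (use M(1) w(1) in auto)
    also have "\<dots> = M / c * 2 * (R + \<eta>\<^sup>2 * H)"
      by (simp add: R_def H_def hnorm_sq_nodes sum_distrib_left sum.distrib algebra_simps)
    finally show ?thesis .
  qed
  have "sqrt L \<le> sqrt T + C\<^sub>J * sqrt J"
    using A2 by (simp add: broken_L2_def L_def T_def)
  then have "(sqrt L)\<^sup>2 \<le> (sqrt T + C\<^sub>J * sqrt J)\<^sup>2" using L0 by (intro power_mono) auto
  also have "\<dots> \<le> (1 + \<delta>\<^sup>2) * (sqrt T)\<^sup>2 + (1 + 1 / \<delta>\<^sup>2) * (C\<^sub>J * sqrt J)\<^sup>2"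
  proof -
    have "(1 + \<delta>\<^sup>2) * p\<^sup>2 + (1 + 1 / \<delta>\<^sup>2) * r\<^sup>2 - (p + r)\<^sup>2 = (\<delta> * p - r / \<delta>)\<^sup>2" for p r :: real
      using \<delta>0 by (simp add: field_simps power2_eq_square)
    then show ?thesis by (metis diff_ge_0_iff_ge zero_le_power2)
  qed
  finally have "L \<le> (1 + \<delta>\<^sup>2) * T + (1 + 1 / \<delta>\<^sup>2) * (C\<^sub>J\<^sup>2 * J)"
    using L0 T0 J by (simp add: power_mult_distrib)
  also have "(1 + \<delta>\<^sup>2) * T \<le> (1 + \<delta>\<^sup>2) * ((1 - \<delta>\<^sup>2) * L + (1 + 1 / \<delta>) / c0 * (M / c * 2 * (R + \<eta>\<^sup>2 * H)))"
  proof (intro mult_left_mono order.trans[OF T] add_left_mono S)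
    show "0 \<le> (1 + 1 / \<delta>) / c0" using \<delta>0 c0 by simp
  qed simp
  finally have "\<delta> ^ 4 * L \<le> (1 + \<delta>\<^sup>2) * ((1 + 1 / \<delta>) / c0 * (M / c * 2 * (R + \<eta>\<^sup>2 * H)))
      + (1 + 1 / \<delta>\<^sup>2) * (C\<^sub>J\<^sup>2 * J)"
    by (simp add: algebra_simps power2_eq_square power4_eq_xxxx)
  then have L: "L \<le> ((1 + \<delta>\<^sup>2) * ((1 + 1 / \<delta>) / c0 * (M / c * 2 * (R + \<eta>\<^sup>2 * H)))
      + (1 + 1 / \<delta>\<^sup>2) * (C\<^sub>J\<^sup>2 * J)) / \<delta> ^ 4"
    using \<delta>0 by (simp add: pos_le_divide_eq mult.commute)
  have "H \<le> C * M * (((1 + \<delta>\<^sup>2) * ((1 + 1 / \<delta>) / c0 * (M / c * 2 * (R + \<eta>\<^sup>2 * H)))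
      + (1 + 1 / \<delta>\<^sup>2) * (C\<^sub>J\<^sup>2 * J)) / \<delta> ^ 4)"
    using order.trans[OF H mult_left_mono[OF L]] w(2) M(1) by simp
  also have "\<dots> = E\<^sub>1 * (R + \<eta>\<^sup>2 * H) + E\<^sub>2 * J"
  proof -
    have "k * ((a1 * (a2 * (a3 * z)) + a4 * (a5 * J)) / e) = k * a1 * a2 * a3 / e * z + k * a4 * a5 / e * J"
      for k a1 a2 a3 a4 a5 e z :: real
      by (simp add: add_divide_distrib distrib_left mult.assoc)
    then show ?thesis unfolding E\<^sub>1 E\<^sub>2 by blast
  qed
  finally have "H \<le> E\<^sub>1 * R + (E\<^sub>1 * \<eta>\<^sup>2) * H + E\<^sub>2 * J" by (simp add: algebra_simps)
  moreover have "(E\<^sub>1 * \<eta>\<^sup>2) * H \<le> 1 / 2 * H" using \<eta> by (intro mult_right_mono) (auto simp: H_def)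
  ultimately have "H \<le> 2 * (E\<^sub>1 * R + E\<^sub>2 * J)" by simp
  also have "\<dots> \<le> 2 * (E\<^sub>1 + E\<^sub>2) * (J + R)"
  proof -
    have "0 \<le> E\<^sub>1" "0 \<le> E\<^sub>2" unfolding E\<^sub>1 E\<^sub>2 using \<delta>0 w(1,2) M(1) c0 by simp_all
    then have "0 \<le> E\<^sub>1 * J" "0 \<le> E\<^sub>2 * R" using J R0 by simp_all
    then show ?thesis by (simp add: algebra_simps)
  qed
  finally show ?thesis by (simp add: H_def R_def)
qed

end

section \<open>Contraction by reconstruction and projection\<close>

text \<open>Here \<open>SW\<close>, \<open>Y\<close>, \<open>E\<close>, \<open>X\<close> and \<open>NW\<close> stand for the squared norms of the reconstructed difference $W$, of the
  projected difference $D$, of the original difference, of $W - D$ and of the normal component of $W$.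
  Monotonicity and the energy identity say that \<open>2 * \<sigma> * J + X\<close> is lost between \<open>E\<close> and
  \<open>(1 - 2 * \<beta>) * Y\<close>, and stability says that this loss is at least a fixed fraction of \<open>SW\<close>, thus of \<open>Y\<close>.
  The constant \<open>K\<^sub>1\<close> dominates \<open>K\<^sub>0\<close> times the coefficients of the three parts of the loss.
  The value of \<open>\<beta>\<close> keeps the curvature errors below half of that fraction.\<close>

lemma contraction_arithmetic:
  fixes b K\<^sub>0 K\<^sub>1 \<sigma> \<beta> :: real
  assumes "0 < \<sigma>" "0 < K\<^sub>0" and K1: "K\<^sub>1 = 1 + K\<^sub>0 * (1 / (2 * \<sigma>) + 2 * b\<^sup>2 + 2)" and \<beta>: "\<beta> = 1 / (8 * K\<^sub>1)"
    and SW: "SW \<le> K\<^sub>0 * (J + NW)" and NW: "NW \<le> 2 * b\<^sup>2 * X + 2 * \<beta>\<^sup>2 * Y"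
    and X: "X \<le> SW - (1 - 2 * \<beta>) * Y" and E: "SW + 2 * \<sigma> * J \<le> E"
    and nn: "0 \<le> X" "0 \<le> Y" "0 \<le> J"
  shows "(1 + 1 / (4 * K\<^sub>1)) * Y \<le> E"
proof -
  have "K\<^sub>1 = 1 + K\<^sub>0 / (2 * \<sigma>) + 2 * b\<^sup>2 * K\<^sub>0 + 2 * K\<^sub>0" unfolding K1 by (simp add: algebra_simps)
  moreover have "0 \<le> K\<^sub>0 / (2 * \<sigma>)" "0 \<le> 2 * b\<^sup>2 * K\<^sub>0" using assms(1,2) by simp_all
  ultimately have K: "1 \<le> K\<^sub>1" "K\<^sub>0 / (2 * \<sigma>) \<le> K\<^sub>1" "2 * b\<^sup>2 * K\<^sub>0 \<le> K\<^sub>1" "2 * K\<^sub>0 \<le> K\<^sub>1"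
    using assms(2) by linarith+
  have K\<sigma>: "K\<^sub>0 \<le> K\<^sub>1 * (2 * \<sigma>)" using K(2) assms(1) by (simp add: field_simps)
  have b: "K\<^sub>1 * \<beta> = 1 / 8" "\<beta> \<le> 1 / 8" using K(1) by (simp_all add: \<beta> field_simps)
  have "SW \<le> K\<^sub>0 * (J + (2 * b\<^sup>2 * X + 2 * \<beta>\<^sup>2 * Y))"
    using SW mult_left_mono[of "J + NW" "J + (2 * b\<^sup>2 * X + 2 * \<beta>\<^sup>2 * Y)" K\<^sub>0] NW assms(2) by linarith
  also have "\<dots> = K\<^sub>0 * J + (2 * b\<^sup>2 * K\<^sub>0) * X + (2 * K\<^sub>0) * (\<beta>\<^sup>2 * Y)" by (simp add: algebra_simps)
  also have "\<dots> \<le> (K\<^sub>1 * (2 * \<sigma>)) * J + K\<^sub>1 * X + K\<^sub>1 * (\<beta>\<^sup>2 * Y)"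
    using K\<sigma> K nn by (intro add_mono mult_right_mono) auto
  also have "\<dots> = K\<^sub>1 * (2 * \<sigma> * J + X + \<beta>\<^sup>2 * Y)" by (simp add: algebra_simps)
  also have "\<dots> \<le> K\<^sub>1 * (E - (1 - 2 * \<beta>) * Y + \<beta>\<^sup>2 * Y)"
    using X E K(1) by (intro mult_left_mono) auto
  also have "\<dots> = K\<^sub>1 * E - K\<^sub>1 * Y + (K\<^sub>1 * \<beta>) * (2 + \<beta>) * Y" by (simp add: algebra_simps power2_eq_square)
  finally have "(1 - 2 * \<beta>) * Y \<le> K\<^sub>1 * E - K\<^sub>1 * Y + 1 / 8 * (2 + \<beta>) * Y"
    unfolding b(1) using X nn(1) by linarith
  then have "(K\<^sub>1 + (3 / 4 - 17 / 8 * \<beta>)) * Y \<le> K\<^sub>1 * E"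
    by (simp add: algebra_simps add_divide_distrib)
  moreover have "(K\<^sub>1 + 1 / 4) * Y \<le> (K\<^sub>1 + (3 / 4 - 17 / 8 * \<beta>)) * Y"
    using b(2) nn(2) by (intro mult_right_mono) auto
  ultimately have "(K\<^sub>1 + 1 / 4) * Y \<le> K\<^sub>1 * E" by linarith
  moreover have "(K\<^sub>1 + 1 / 4) * Y = K\<^sub>1 * ((1 + 1 / (4 * K\<^sub>1)) * Y)" using K(1) by (simp add: field_simps)
  ultimately show ?thesis using K(1) by simp
qed

context nodal_discretization
begin

lemma nearest_unique:
  assumes A: "\<And>i. i \<in> nodes \<Longrightarrow> A i \<in> det_surface (f (pts d (fst i) (snd i)))"
    and \<beta>: "0 < \<beta>" "\<beta> < 1"
    and \<epsilon>: "\<And>i. i \<in> nodes \<Longrightarrow> \<epsilon> \<le> \<beta> * sqrt (f (pts d (fst i) (snd i)))" "2 * \<epsilon> \<le> \<beta>"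
    and X: "\<And>i. i \<in> nodes \<Longrightarrow> nval X i \<in> Sym2" "\<And>i. i \<in> nodes \<Longrightarrow> norm (nval X i - A i) \<le> \<epsilon>"
  shows "is_singleton (nearest m d (Bset m d f) X)"
proof -
  have f: "0 < f (pts d (fst i) (snd i))" if "i \<in> nodes" for i
    using det_surface_pos(5)[OF A[OF that]] .
  obtain P where P: "P \<in> nearest m d (Bset m d f) X"
    using nearest_exists[of f X] f by blast
  have "P' = P" if P': "P' \<in> nearest m d (Bset m d f) X" for P'
  proof (rule Zspace_ext)
    show "P' \<in> Zspace m d Sym2" "P \<in> Zspace m d Sym2"
      using P P' by (auto simp: nearest_def Bset_def)
    fix i assume i: "i \<in> nodes"
    have "(1 - \<beta>) * (norm (nval P' i - nval P i))\<^sup>2 \<le> (nval X i - nval X i) \<bullet> (nval P' i - nval P i)"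
      by (rule closest_local(1)[OF \<beta>(1) A[OF i] nearest_nodewise[OF f P' i] nearest_nodewise[OF f P i]
            X(1)[OF i] X(1)[OF i] X(2)[OF i] X(2)[OF i] \<epsilon>(1)[OF i] \<epsilon>(2)])
    then have "(1 - \<beta>) * (norm (nval P' i - nval P i))\<^sup>2 \<le> 0" by simp
    then show "nval P' i = nval P i" using \<beta>(2) by (simp add: mult_le_0_iff)
  qed
  then have "nearest m d (Bset m d f) X = {P}" using P by blast
  then show ?thesis by (simp add: is_singleton_def)
qed

text \<open>One step of the method contracts distances: the reconstruction loses the penalty term, the
  projection loses the distance of the reconstructed difference to the tangent plane, and by stability both
  losses cannot be small at once.\<close>

lemma projected_step:
  assumes rec: "reconstruction_ok m d" and \<sigma>: "0 < \<sigma>" and K0: "0 < K\<^sub>0"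
    and stab: "\<And>w. w \<in> Xspace d \<Longrightarrow> (hnorm m d (Hess d w))\<^sup>2
        \<le> K\<^sub>0 * (Jform d w w + (\<Sum>i\<in>nodes. wt i * (cof (A i) \<bullet> nval (Hess d w) i)\<^sup>2))"
    and A: "\<And>i. i \<in> nodes \<Longrightarrow> A i \<in> det_surface (f (pts d (fst i) (snd i)))"
    and b: "\<And>i. i \<in> nodes \<Longrightarrow> norm (A i) \<le> b"
    and K1: "K\<^sub>1 = 1 + K\<^sub>0 * (1 / (2 * \<sigma>) + 2 * b\<^sup>2 + 2)" and \<beta>: "\<beta> = 1 / (8 * K\<^sub>1)"
    and \<epsilon>: "\<And>i. i \<in> nodes \<Longrightarrow> \<epsilon> \<le> \<beta> * sqrt (f (pts d (fst i) (snd i)))" "2 * \<epsilon> \<le> \<beta>"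
    and near: "\<And>i. i \<in> nodes \<Longrightarrow> norm (nval (Rmap m \<sigma> d Q) i - A i) \<le> \<epsilon>"
      "\<And>i. i \<in> nodes \<Longrightarrow> norm (nval (Rmap m \<sigma> d Q') i - A i) \<le> \<epsilon>"
    and P: "P \<in> nearest m d (Bset m d f) (Rmap m \<sigma> d Q)"
      "P' \<in> nearest m d (Bset m d f) (Rmap m \<sigma> d Q')"
  shows "(1 + 1 / (4 * K\<^sub>1)) * (hnorm m d (P - P'))\<^sup>2 \<le> (hnorm m d (Q - Q'))\<^sup>2"
proof -
  have f: "0 < f (pts d (fst i) (snd i))" if "i \<in> nodes" for i
    using det_surface_pos(5)[OF A[OF that]] .
  obtain w where w: "w \<in> Xspace d" "Rmap m \<sigma> d Q - Rmap m \<sigma> d Q' = Hess d w"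
      "(hnorm m d (Hess d w))\<^sup>2 + 2 * \<sigma> * Jform d w w \<le> (hnorm m d (Q - Q'))\<^sup>2"
    using Rmap_energy[OF rec less_imp_le[OF \<sigma>], of Q Q'] by blast
  have sym: "nval (Rmap m \<sigma> d R) i \<in> Sym2" if "i \<in> nodes" for R i
  proof -
    obtain u where "u \<in> Xspace d" "Rmap m \<sigma> d R = Hess d u"
      using Rmap_solves[OF rec less_imp_le[OF \<sigma>], of R] by blast
    then have "Rmap m \<sigma> d R \<in> Zspace m d Sym2" using rec by (simp add: reconstruction_ok_def)
    then show ?thesis using that by (rule nval_Sym2)
  qed
  have K1pos: "0 < K\<^sub>1" unfolding K1 using \<sigma> K0 by (intro add_pos_nonneg mult_nonneg_nonneg add_nonneg_nonneg) auto
  then have \<beta>0: "0 < \<beta>" by (simp add: \<beta>)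
  let ?W = "\<lambda>i. nval (Hess d w) i" and ?D = "\<lambda>i. nval P i - nval P' i"
  have W: "?W i = nval (Rmap m \<sigma> d Q) i - nval (Rmap m \<sigma> d Q') i" for i
    by (simp add: w(2)[symmetric])
  have mono: "(1 - \<beta>) * (norm (?D i))\<^sup>2 \<le> ?W i \<bullet> ?D i"
    and tang: "\<bar>cof (A i) \<bullet> ?D i\<bar> \<le> \<beta> * norm (?D i)" if i: "i \<in> nodes" for i
    unfolding W
    using closest_local[OF \<beta>0 A[OF i] nearest_nodewise[OF f P(1) i] nearest_nodewise[OF f P(2) i]
        sym[OF i] sym[OF i] near(1)[OF i] near(2)[OF i] \<epsilon>(1)[OF i] \<epsilon>(2)] by auto
  define X where "X = (\<Sum>i\<in>nodes. wt i * (norm (?W i - ?D i))\<^sup>2)"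
  have Y: "(hnorm m d (P - P'))\<^sup>2 = (\<Sum>i\<in>nodes. wt i * (norm (?D i))\<^sup>2)"
    by (simp add: hnorm_sq_nodes)
  have 1: "X \<le> (hnorm m d (Hess d w))\<^sup>2 - (1 - 2 * \<beta>) * (hnorm m d (P - P'))\<^sup>2"
    unfolding X_def Y
    unfolding hnorm_sq_nodes sum_distrib_left sum_subtractf[symmetric]
  proof (rule sum_mono)
    fix i assume i: "i \<in> nodes"
    have "(norm (?W i - ?D i))\<^sup>2 = (norm (?W i))\<^sup>2 - 2 * (?W i \<bullet> ?D i) + (norm (?D i))\<^sup>2"
      by (simp only: power2_norm_eq_inner) (simp add: inner_diff_left inner_diff_right inner_commute algebra_simps)
    also have "\<dots> \<le> (norm (?W i))\<^sup>2 - (1 - 2 * \<beta>) * (norm (?D i))\<^sup>2"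
      using mono[OF i] by (simp add: algebra_simps)
    finally have "wt i * (norm (?W i - ?D i))\<^sup>2 \<le> wt i * ((norm (?W i))\<^sup>2 - (1 - 2 * \<beta>) * (norm (?D i))\<^sup>2)"
      using wt_pos[OF i] by (intro mult_left_mono) auto
    then show "wt i * (norm (?W i - ?D i))\<^sup>2 \<le> wt i * (norm (?W i))\<^sup>2 - (1 - 2 * \<beta>) * (wt i * (norm (?D i))\<^sup>2)"
      by (simp add: algebra_simps)
  qed
  have 2: "(\<Sum>i\<in>nodes. wt i * (cof (A i) \<bullet> ?W i)\<^sup>2) \<le> 2 * b\<^sup>2 * X + 2 * \<beta>\<^sup>2 * (hnorm m d (P - P'))\<^sup>2"
    unfolding X_def Y sum_distrib_left sum.distrib[symmetric]
  proof (rule sum_mono)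
    fix i assume i: "i \<in> nodes"
    let ?p = "cof (A i) \<bullet> (?W i - ?D i)" and ?r = "cof (A i) \<bullet> ?D i"
    have "cof (A i) \<bullet> ?W i = ?p + ?r" by (simp add: inner_diff_right)
    then have "(cof (A i) \<bullet> ?W i)\<^sup>2 = (?p + ?r)\<^sup>2" by (rule arg_cong)
    also have "\<dots> \<le> 2 * ?p\<^sup>2 + 2 * ?r\<^sup>2"
      using sum_squares_bound[of ?p ?r] by (simp add: power2_sum)
    also have "\<dots> \<le> 2 * (b\<^sup>2 * (norm (?W i - ?D i))\<^sup>2) + 2 * (\<beta>\<^sup>2 * (norm (?D i))\<^sup>2)"
    proof -
      have "\<bar>?p\<bar> \<le> b * norm (?W i - ?D i)"
        using Cauchy_Schwarz_ineq2[of "cof (A i)" "?W i - ?D i"]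
          mult_right_mono[OF b[OF i] norm_ge_zero, of "?W i - ?D i"] by (simp add: norm_cof)
      then have "\<bar>?p\<bar>\<^sup>2 \<le> (b * norm (?W i - ?D i))\<^sup>2" by (intro power_mono) auto
      moreover have "\<bar>?r\<bar>\<^sup>2 \<le> (\<beta> * norm (?D i))\<^sup>2" by (intro power_mono tang i) auto
      ultimately show ?thesis by (simp add: power_mult_distrib)
    qed
    finally have "wt i * (cof (A i) \<bullet> ?W i)\<^sup>2
        \<le> wt i * (2 * (b\<^sup>2 * (norm (?W i - ?D i))\<^sup>2) + 2 * (\<beta>\<^sup>2 * (norm (?D i))\<^sup>2))"
      using wt_pos[OF i] by (intro mult_left_mono) auto
    then show "wt i * (cof (A i) \<bullet> ?W i)\<^sup>2
        \<le> 2 * b\<^sup>2 * (wt i * (norm (?W i - ?D i))\<^sup>2) + 2 * \<beta>\<^sup>2 * (wt i * (norm (?D i))\<^sup>2)"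
      by (simp add: algebra_simps)
  qed
  have X0: "0 \<le> X" unfolding X_def by (intro sum_nonneg mult_nonneg_nonneg) (auto dest: wt_pos)
  have J0: "0 \<le> Jform d w w" using rec w(1) by (simp add: reconstruction_ok_def)
  show ?thesis
    by (rule contraction_arithmetic[OF \<sigma> K0 K1 \<beta> stab[OF w(1)] 2 1 w(3) X0 _ J0]) simp
qed

text \<open>The nodal values of \<open>B\<close> lie on the surfaces and are their own closest points, so the
  monotonicity of the projection compares the projection of \<open>X\<close> with \<open>B\<close> itself.\<close>

lemma projection_near_base:
  assumes A: "\<And>i. i \<in> nodes \<Longrightarrow> nval B i \<in> det_surface (f (pts d (fst i) (snd i)))"
    and \<beta>: "0 < \<beta>" "\<beta> \<le> 1 / 8"
    and \<epsilon>: "\<And>i. i \<in> nodes \<Longrightarrow> \<epsilon> \<le> \<beta> * sqrt (f (pts d (fst i) (snd i)))" "2 * \<epsilon> \<le> \<beta>" "0 \<le> \<epsilon>"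
    and X: "\<And>i. i \<in> nodes \<Longrightarrow> nval X i \<in> Sym2" "\<And>i. i \<in> nodes \<Longrightarrow> norm (nval X i - nval B i) \<le> \<epsilon>"
    and P: "P \<in> nearest m d (Bset m d f) X"
  shows "hnorm m d (P - B) \<le> 2 * hnorm m d (X - B)"
proof -
  have f: "0 < f (pts d (fst i) (snd i))" if "i \<in> nodes" for i
    using det_surface_pos(5)[OF A[OF that]] .
  have "(hnorm m d (P - B))\<^sup>2 \<le> 4 * (hnorm m d (X - B))\<^sup>2"
    unfolding hnorm_sq_nodes sum_distrib_left
  proof (rule sum_mono)
    fix i assume i: "i \<in> nodes"
    let ?D = "nval P i - nval B i" and ?W = "nval X i - nval B i"
    have self: "closest (det_surface (f (pts d (fst i) (snd i)))) (nval B i) (nval B i)"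
      using A[OF i] by (simp add: closest_def)
    have symB: "nval B i \<in> Sym2" using A[OF i] by (simp add: det_surface_def SPD2_def)
    have "norm (nval B i - nval B i) \<le> \<epsilon>" using \<epsilon>(3) by simp
    from closest_local(1)[OF \<beta>(1) A[OF i] nearest_nodewise[OF f P i] self X(1)[OF i] symB X(2)[OF i] this
        \<epsilon>(1)[OF i] \<epsilon>(2)]
    have "(1 - \<beta>) * (norm ?D)\<^sup>2 \<le> ?W \<bullet> ?D" .
    also have "\<dots> \<le> norm ?W * norm ?D" by (rule norm_cauchy_schwarz)
    finally have *: "(1 - \<beta>) * (norm ?D)\<^sup>2 \<le> norm ?W * norm ?D" .
    have "norm ?D \<le> 2 * norm ?W"
    proof (cases "norm ?D = 0")
      case True
      then show ?thesis using norm_ge_zero[of ?W] by linarith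
    next
      case False
      then have "0 < norm ?D" by simp
      then have "(1 - \<beta>) * norm ?D \<le> norm ?W" using * by (simp add: power2_eq_square)
      moreover have "1 / 2 * norm ?D \<le> (1 - \<beta>) * norm ?D" using \<beta> by (intro mult_right_mono) auto
      ultimately show ?thesis by linarith
    qed
    then have "(norm ?D)\<^sup>2 \<le> (2 * norm ?W)\<^sup>2" by (intro power_mono) auto
    then have "wt i * (norm ?D)\<^sup>2 \<le> wt i * (2 * norm ?W)\<^sup>2"
      using wt_pos[OF i] by (intro mult_left_mono) auto
    then show "wt i * (norm (nval (P - B) i))\<^sup>2 \<le> 4 * (wt i * (norm (nval (X - B) i))\<^sup>2)"
      by (simp add: power_mult_distrib)
  qed
  also have "\<dots> = (2 * hnorm m d (X - B))\<^sup>2" by (simp add: power_mult_distrib)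
  finally show ?thesis by (rule power2_le_imp_le) (simp add: hnorm_nonneg)
qed

end

section \<open>Uniformity over the family of meshes\<close>

text \<open>The pointwise properties hold in the open domain and pass to its closure, where the boundary nodes
  lie, by continuity.\<close>

lemma exact_solution_bounds:
  assumes dom: "convex_polygonal_domain \<Omega>" and ex: "exact_solution \<Omega> m f g u D2u"
  shows "compact (closure \<Omega>)"
    and "\<exists>c\<^sub>0>0. \<exists>b>0. \<forall>x\<in>closure \<Omega>. D2u x \<in> det_surface (f x) \<and> c\<^sub>0 \<le> f x \<and> norm (D2u x) \<le> b"
proof -
  show cpt: "compact (closure \<Omega>)"
    using dom polytope_imp_compact unfolding convex_polygonal_domain_def by blast
  have cont: "continuous_on (closure \<Omega>) D2u" and contf: "continuous_on (closure \<Omega>) f"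
    and sym: "\<And>x. x \<in> closure \<Omega> \<Longrightarrow> D2u x \<in> Sym2"
    and det: "\<And>x. x \<in> \<Omega> \<Longrightarrow> det (D2u x) = f x"
    using ex by (auto simp: exact_solution_def)
  obtain c\<^sub>0 where c0: "0 < c\<^sub>0" "\<And>x. x \<in> closure \<Omega> \<Longrightarrow> c\<^sub>0 \<le> f x"
    using ex by (auto simp: exact_solution_def)
  have "\<exists>\<nu>1 \<nu>2. \<nu>1 \<ge> \<nu>2 \<and> \<nu>2 > 0 \<and>
        (\<forall>x\<in>\<Omega>. \<forall>\<xi>. \<nu>2 * (norm \<xi>)\<^sup>2 \<le> \<xi> \<bullet> (D2u x *v \<xi>) \<and>
                      \<xi> \<bullet> (D2u x *v \<xi>) \<le> \<nu>1 * (norm \<xi>)\<^sup>2)"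
    using ex unfolding exact_solution_def by (elim conjE)
  then obtain \<nu>1 \<nu> where n: "0 < \<nu>"
      "\<forall>x\<in>\<Omega>. \<forall>\<xi>. \<nu> * (norm \<xi>)\<^sup>2 \<le> \<xi> \<bullet> (D2u x *v \<xi>) \<and> \<xi> \<bullet> (D2u x *v \<xi>) \<le> \<nu>1 * (norm \<xi>)\<^sup>2"
    by (elim exE conjE) (rule that)
  have \<nu>: "\<nu> * (norm \<xi>)\<^sup>2 \<le> \<xi> \<bullet> (D2u x *v \<xi>)" if "x \<in> \<Omega>" for x \<xi>
    using bspec[OF n(2) that] by blast
  have comp: "continuous_on (closure \<Omega>) (\<lambda>x. D2u x $ k $ l)" for k l
    by (intro continuous_intros cont)
  have form: "\<xi> \<bullet> (A *v \<xi>) = \<xi>$1 * (A$1$1 * \<xi>$1 + A$1$2 * \<xi>$2) + \<xi>$2 * (A$2$1 * \<xi>$1 + A$2$2 * \<xi>$2)"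
    for A :: mat2 and \<xi> :: plane
    by (simp add: inner_vec_def sum_2 matrix_vector_mult_def)
  have quad: "\<nu> * (norm \<xi>)\<^sup>2 \<le> \<xi> \<bullet> (D2u x *v \<xi>)" if "x \<in> closure \<Omega>" for x \<xi>
  proof -
    have "- (\<xi> \<bullet> (D2u x *v \<xi>)) \<le> - (\<nu> * (norm \<xi>)\<^sup>2)"
    proof (rule continuous_le_on_closure[OF _ that])
      show "continuous_on (closure \<Omega>) (\<lambda>x. - (\<xi> \<bullet> (D2u x *v \<xi>)))"
        unfolding form by (intro continuous_on_minus continuous_on_add continuous_on_mult continuous_on_const comp)
      show "- (\<xi> \<bullet> (D2u x *v \<xi>)) \<le> - (\<nu> * (norm \<xi>)\<^sup>2)" if "x \<in> \<Omega>" for x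
        using \<nu>[OF that] by simp
    qed
    then show ?thesis by simp
  qed
  have det0: "det (D2u x) - f x = 0" if "x \<in> closure \<Omega>" for x
  proof (rule continuous_constant_on_closure[OF _ _ that])
    show "continuous_on (closure \<Omega>) (\<lambda>x. det (D2u x) - f x)"
      unfolding det_2 by (intro continuous_on_diff continuous_on_mult comp contf)
    show "det (D2u x) - f x = 0" if "x \<in> \<Omega>" for x using det[OF that] by simp
  qed
  have det_surface: "D2u x \<in> det_surface (f x)" if "x \<in> closure \<Omega>" for x
  proof -
    have "0 < \<xi> \<bullet> (D2u x *v \<xi>)" if "\<xi> \<noteq> 0" for \<xi>
    proof -
      have "0 < \<nu> * (norm \<xi>)\<^sup>2" using n(1) that by simp
      then show ?thesis using quad[OF \<open>x \<in> closure \<Omega>\<close>, of \<xi>] by linarith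
    qed
    then show ?thesis using sym[OF that] det0[OF that] by (simp add: det_surface_def SPD2_def)
  qed
  have "bounded (D2u ` closure \<Omega>)" by (intro compact_imp_bounded compact_continuous_image cont cpt)
  then obtain b where b: "0 < b" "\<forall>y\<in>D2u ` closure \<Omega>. norm y \<le> b"
    unfolding bounded_pos by blast
  have "\<forall>x\<in>closure \<Omega>. D2u x \<in> det_surface (f x) \<and> c\<^sub>0 \<le> f x \<and> norm (D2u x) \<le> b"
    using c0(2) det_surface b(2) by simp
  then show "\<exists>c\<^sub>0>0. \<exists>b>0. \<forall>x\<in>closure \<Omega>. D2u x \<in> det_surface (f x) \<and> c\<^sub>0 \<le> f x \<and> norm (D2u x) \<le> b"
    by (intro exI[of _ c\<^sub>0] exI[of _ b] conjI c0(1) b(1))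
qed

lemma cell_facts:
  assumes mesh: "mesh_of \<Omega> (cells d)" and K: "K \<in> cells d"
  shows "compact K" "0 < diameter K" "diameter K \<le> meshsize d" "K \<subseteq> closure \<Omega>"
proof -
  have simp: "2 simplex K" and fin: "finite (cells d)" and un: "\<Union>(cells d) = closure \<Omega>"
    using mesh K by (auto simp: mesh_of_def triangulation_def)
  show cpt: "compact K" using simp by (rule compact_simplex)
  have "aff_dim K = 2" using aff_dim_simplex[OF simp] by simp
  then have ne: "K \<noteq> {}" and nsing: "K \<noteq> {a}" for a by force+
  obtain x where x: "x \<in> K" using ne by blast
  obtain y where y: "y \<in> K" "x \<noteq> y" using nsing[of x] x by blast
  have "dist x y \<le> diameter K"
    using diameter_bounded_bound[OF compact_imp_bounded[OF cpt] x y(1)] .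
  then show "0 < diameter K" using y(2) zero_less_dist_iff[of x y] by linarith
  show "diameter K \<le> meshsize d" unfolding meshsize_def using fin K by (intro Max_ge) auto
  show "K \<subseteq> closure \<Omega>" using un K by auto
qed

lemma Npoly_pos: "0 < Npoly m"
  by (simp add: Npoly_def zero_less_binomial)

lemma mesh_nodal_discretization:
  assumes mesh: "mesh_of \<Omega> (cells d)" and uni: "unisolvent m xhat" and aff: "affine_nodes m xhat d"
    and \<gamma>: "0 < \<gamma>" "\<And>K. K \<in> cells d \<Longrightarrow> \<exists>x. cball x (\<gamma> * diameter K) \<subseteq> K"
    and w: "\<And>K j. K \<in> cells d \<Longrightarrow> j < Npoly m \<Longrightarrow> 0 < weight d K j"
  shows "nodal_discretization m d"
proof
  show "finite (cells d)" using mesh by (simp add: mesh_of_def triangulation_def)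
  fix K and b :: "nat \<Rightarrow> real" assume K: "K \<in> cells d"
  obtain A :: mat2 and a where A: "(\<lambda>x. A *v x + a) ` ref_triangle = K" "\<forall>j<Npoly m. pts d K j = A *v xhat j + a"
    using aff K by (auto simp: affine_nodes_def)
  obtain x where "cball x (\<gamma> * diameter K) \<subseteq> K" using \<gamma>(2)[OF K] by blast
  then have "det A \<noteq> 0"
    using affine_cell_det_nonzero[of x "\<gamma> * diameter K" A a ref_triangle] A(1) \<gamma>(1) cell_facts(2)[OF mesh K]
    by simp
  from nodal_unisolvence_affine[OF uni this, of a b]
  show "\<exists>!p. p \<in> polys m UNIV \<and> (\<forall>j<Npoly m. p (pts d K j) = b j)"
    using A(2) by simp
qed (rule w)

lemma pts_in_cell:
  assumes "unisolvent m xhat" "affine_nodes m xhat d" "K \<in> cells d" "j < Npoly m"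
  shows "pts d K j \<in> K"
  using assms by (fastforce simp: affine_nodes_def unisolvent_def)

lemma inverse_sqrt_less_1:
  assumes "1 < (x::real)"
  shows "0 < 1 / sqrt x" "1 / sqrt x < 1"
proof -
  have "0 < 1 / r \<and> 1 / r < 1" if "1 < r" for r :: real using that by simp
  from this[of "sqrt x"] show "0 < 1 / sqrt x" "1 / sqrt x < 1" using assms by simp_all
qed

lemma small_powr:
  fixes \<alpha> \<tau> :: real
  assumes "0 < \<alpha>" "0 < \<tau>"
  shows "\<exists>h\<^sub>0>0. \<forall>h. 0 \<le> h \<longrightarrow> h \<le> h\<^sub>0 \<longrightarrow> h powr \<alpha> \<le> \<tau>"
proof (intro exI[of _ "\<tau> powr (1 / \<alpha>)"] conjI allI impI)
  fix h :: real assume "0 \<le> h" "h \<le> \<tau> powr (1 / \<alpha>)"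
  then have "h powr \<alpha> \<le> (\<tau> powr (1 / \<alpha>)) powr \<alpha>" using assms by (intro powr_mono2) auto
  then show "h powr \<alpha> \<le> \<tau>" using assms by (simp add: powr_powr)
qed (use assms in simp)

text \<open>The number \<open>s\<close> relates the weights to the mesh size: \<open>s * h\<close> times a nodal value is bounded by the discrete norm.
  This is why a neighbourhood of radius proportional to \<open>h\<close> is the right one: its elements, and
  their reconstructions, differ from the interpolated Hessian by at most \<open>\<epsilon>\<close> at every node, which is
  the range in which the projection is single-valued and monotone up to \<open>\<beta>\<close>.\<close>

lemma (in nodal_discretization) local_convergence:
  fixes \<sigma> \<kappa>\<^sub>0 h \<alpha> :: real and W :: "plane \<Rightarrow> mat2" and f :: "plane \<Rightarrow> real"
  defines "Phat \<equiv> interp_mat m d W"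
  defines "U \<equiv> nbhd m d Phat (\<kappa>\<^sub>0 * h)"
  defines "T \<equiv> Tmap m \<sigma> d f"
  assumes rec: "reconstruction_ok m d" and \<sigma>: "0 < \<sigma>" and K0: "0 < K\<^sub>0"
    and stab: "\<And>w. w \<in> Xspace d \<Longrightarrow> (hnorm m d (Hess d w))\<^sup>2
        \<le> K\<^sub>0 * (Jform d w w + (\<Sum>i\<in>nodes. wt i * (cof (W (pts d (fst i) (snd i))) \<bullet> nval (Hess d w) i)\<^sup>2))"
    and W: "\<And>i. i \<in> nodes \<Longrightarrow> W (pts d (fst i) (snd i)) \<in> det_surface (f (pts d (fst i) (snd i)))"
      "\<And>i. i \<in> nodes \<Longrightarrow> norm (W (pts d (fst i) (snd i))) \<le> b"
    and K1: "K\<^sub>1 = 1 + K\<^sub>0 * (1 / (2 * \<sigma>) + 2 * b\<^sup>2 + 2)" and \<beta>: "\<beta> = 1 / (8 * K\<^sub>1)"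
    and \<epsilon>: "0 < \<epsilon>" "\<And>i. i \<in> nodes \<Longrightarrow> \<epsilon> \<le> \<beta> * sqrt (f (pts d (fst i) (snd i)))" "2 * \<epsilon> \<le> \<beta>"
    and q: "q = 1 / sqrt (1 + 1 / (4 * K\<^sub>1))"
    and s: "0 < s" "\<And>i. i \<in> nodes \<Longrightarrow> (s * h)\<^sup>2 \<le> wt i" and h: "0 < h"
    and res: "hnorm m d (Rmap m \<sigma> d Phat - Phat) \<le> C\<^sub>R * h powr (1 + \<alpha>)"
    and \<kappa>: "0 < \<kappa>\<^sub>0" "\<kappa>\<^sub>0 \<le> s * \<epsilon> / 2"
    and small: "C\<^sub>R * h powr \<alpha> \<le> s * \<epsilon> / 2" "2 * (C\<^sub>R * h powr \<alpha>) \<le> (1 - q) * \<kappa>\<^sub>0"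
  shows "\<forall>Q\<in>U. is_singleton (nearest m d (Bset m d f) (Rmap m \<sigma> d Q))"
    and "\<forall>Q\<in>U. T Q \<in> U"
    and "\<forall>Q\<in>U. \<forall>Q'\<in>U. hnorm m d (T Q - T Q') \<le> q * hnorm m d (Q - Q')"
    and "\<exists>Pstar\<in>U. T Pstar = Pstar \<and> (\<forall>Q\<in>U. T Q = Q \<longrightarrow> Q = Pstar) \<and>
            (\<forall>P0\<in>U.
               (\<forall>n. hnorm m d ((T ^^ n) P0 - Pstar) \<le> q ^ n * hnorm m d (P0 - Pstar)) \<and>
               (\<lambda>n. hnorm m d ((T ^^ n) P0 - Pstar)) \<longlonglongrightarrow> 0) \<and>
            hnorm m d (Pstar - Phat) \<le> 2 * C\<^sub>R / (1 - q) * h powr (1 + \<alpha>)"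
proof -
  have K1pos: "1 \<le> K\<^sub>1" unfolding K1 using \<sigma> K0 by simp
  then have \<beta>0: "0 < \<beta>" "\<beta> \<le> 1 / 8" by (simp_all add: \<beta> field_simps)
  have q01: "0 < q" "q < 1"
    unfolding q using K1pos by (intro inverse_sqrt_less_1; simp)+
  have WS: "W (pts d K j) \<in> Sym2" if "K \<in> cells d" "j < Npoly m" for K j
    using W(1)[of "(K, j)"] that by (simp add: nodes_def det_surface_def SPD2_def)
  have PhatZ: "Phat \<in> Zspace m d Sym2" unfolding Phat_def by (rule interp_mat_nodal(1)) (rule WS)
  have Phat_i: "nval Phat i = W (pts d (fst i) (snd i))" if "i \<in> nodes" for i
    unfolding Phat_def using that by (intro interp_mat_nodal(2)[where W = W] WS)
  let ?R = "Rmap m \<sigma> d" and ?B = "Bset m d f"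
  have RZ: "?R Q \<in> Zspace m d Sym2" for Q
    using Rmap_solves[OF rec less_imp_le[OF \<sigma>], of Q] rec by (auto simp: reconstruction_ok_def)
  have Rsym: "nval (?R Q) i \<in> Sym2" if "i \<in> nodes" for Q i using nval_Sym2[OF RZ that] .
  have nonexp: "hnorm m d (?R Q - ?R Q') \<le> hnorm m d (Q - Q')" for Q Q'
  proof -
    obtain w where "w \<in> Xspace d" "?R Q - ?R Q' = Hess d w"
        "(hnorm m d (Hess d w))\<^sup>2 + 2 * \<sigma> * Jform d w w \<le> (hnorm m d (Q - Q'))\<^sup>2"
      using Rmap_energy[OF rec less_imp_le[OF \<sigma>], of Q Q'] by blast
    moreover from this(1) have "0 \<le> 2 * \<sigma> * Jform d w w" using rec \<sigma> by (simp add: reconstruction_ok_def)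
    ultimately have "(hnorm m d (?R Q - ?R Q'))\<^sup>2 \<le> (hnorm m d (Q - Q'))\<^sup>2" by simp
    then show ?thesis using hnorm_nonneg by (rule power2_le_imp_le)
  qed
  have hp: "h powr (1 + \<alpha>) = h * h powr \<alpha>" using h by (simp add: powr_add)
  have node_bound: "norm (nval v i) \<le> t" if "i \<in> nodes" "hnorm m d v \<le> s * h * t" for v :: "mat2 broken" and i t
  proof -
    have sh: "0 < s * h" using s h by simp
    have "(s * h)\<^sup>2 * (norm (nval v i))\<^sup>2 \<le> wt i * (norm (nval v i))\<^sup>2"
      using s(2)[OF that(1)] by (intro mult_right_mono) auto
    also have "\<dots> \<le> (hnorm m d v)\<^sup>2" by (rule node_le_hnorm[OF that(1)])
    finally have "(s * h * norm (nval v i))\<^sup>2 \<le> (hnorm m d v)\<^sup>2" by (simp add: power_mult_distrib)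
    then have "s * h * norm (nval v i) \<le> hnorm m d v" using hnorm_nonneg by (rule power2_le_imp_le)
    then have "s * h * norm (nval v i) \<le> s * h * t" using that(2) by linarith
    then show ?thesis using sh by (simp only: mult_le_cancel_left_pos)
  qed
  have PhatU: "Phat \<in> U" unfolding U_def nbhd_def using PhatZ \<kappa>(1) h by (simp add: hnorm_L2_set L2_set_def)
  have near: "norm (nval (?R Q) i - W (pts d (fst i) (snd i))) \<le> \<epsilon>" if Q: "Q \<in> U" and i: "i \<in> nodes" for Q i
  proof -
    have "hnorm m d (?R Q - Phat) \<le> hnorm m d (?R Q - ?R Phat) + hnorm m d (?R Phat - Phat)"
      by (rule hnorm_triangle)
    also have "\<dots> \<le> \<kappa>\<^sub>0 * h + C\<^sub>R * (h * h powr \<alpha>)"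
      using nonexp[of Q Phat] Q res unfolding U_def nbhd_def hp by simp
    also have "\<dots> = h * (\<kappa>\<^sub>0 + C\<^sub>R * h powr \<alpha>)" by (simp add: algebra_simps)
    also have "\<dots> \<le> h * (s * \<epsilon> / 2 + s * \<epsilon> / 2)" using \<kappa> small h by (intro mult_left_mono add_mono) auto
    also have "\<dots> = s * h * \<epsilon>" by simp
    finally have "norm (nval (?R Q - Phat) i) \<le> \<epsilon>" by (rule node_bound[OF i])
    then show ?thesis by (simp add: Phat_i[OF i])
  qed
  have sing: "is_singleton (nearest m d ?B (?R Q))" if Q: "Q \<in> U" for Q
    using \<beta>0 by (intro nearest_unique[where A = "\<lambda>i. W (pts d (fst i) (snd i))" and \<beta> = \<beta> and \<epsilon> = \<epsilon>]
        W \<epsilon> Rsym near Q) auto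
  have Tn: "T Q \<in> nearest m d ?B (?R Q)" if Q: "Q \<in> U" for Q
  proof -
    obtain P where "nearest m d ?B (?R Q) = {P}" using sing[OF Q] by (auto simp: is_singleton_def)
    then show ?thesis by (simp add: T_def Tmap_def)
  qed
  have contr: "hnorm m d (T Q - T Q') \<le> q * hnorm m d (Q - Q')" if Q: "Q \<in> U" "Q' \<in> U" for Q Q'
  proof -
    let ?k = "1 + 1 / (4 * K\<^sub>1)"
    have k: "0 < ?k" using K1pos by (intro add_pos_pos) auto
    have "?k * (hnorm m d (T Q - T Q'))\<^sup>2 \<le> (hnorm m d (Q - Q'))\<^sup>2"
      by (rule projected_step[OF rec \<sigma> K0 stab W K1 \<beta> \<epsilon>(2,3) near[OF Q(1)] near[OF Q(2)] Tn[OF Q(1)] Tn[OF Q(2)]])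
    then have "(hnorm m d (T Q - T Q'))\<^sup>2 \<le> (hnorm m d (Q - Q'))\<^sup>2 / ?k" using k by (simp only: pos_le_divide_eq mult.commute)
    also have "\<dots> = (q * hnorm m d (Q - Q'))\<^sup>2"
      unfolding q using k by (simp add: power_mult_distrib power_divide)
    finally show ?thesis
      by (rule power2_le_imp_le) (intro mult_nonneg_nonneg less_imp_le[OF q01(1)] hnorm_nonneg)
  qed
  have base: "hnorm m d (T Phat - Phat) \<le> 2 * (C\<^sub>R * h powr (1 + \<alpha>))"
  proof -
    have "hnorm m d (T Phat - Phat) \<le> 2 * hnorm m d (?R Phat - Phat)"
      by (rule projection_near_base[where \<beta> = \<beta> and \<epsilon> = \<epsilon>, OF _ \<beta>0 \<epsilon>(2,3) less_imp_le[OF \<epsilon>(1)] Rsym _ Tn[OF PhatU]])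
         (simp_all add: Phat_i W near[OF PhatU])
    then show ?thesis using res by linarith
  qed
  have TZ: "T Q \<in> Zspace m d Sym2" if "Q \<in> U" for Q
    using Tn[OF that] by (simp add: nearest_def Bset_def)
  have self: "T Q \<in> U" if Q: "Q \<in> U" for Q
  proof -
    have "hnorm m d (T Q - Phat) \<le> hnorm m d (T Q - T Phat) + hnorm m d (T Phat - Phat)"
      by (rule hnorm_triangle)
    also have "\<dots> \<le> q * (\<kappa>\<^sub>0 * h) + 2 * (C\<^sub>R * h powr (1 + \<alpha>))"
    proof (intro add_mono base)
      have "hnorm m d (T Q - T Phat) \<le> q * hnorm m d (Q - Phat)" by (rule contr[OF Q PhatU])
      also have "\<dots> \<le> q * (\<kappa>\<^sub>0 * h)" using Q q01 by (intro mult_left_mono) (auto simp: U_def nbhd_def)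
      finally show "hnorm m d (T Q - T Phat) \<le> q * (\<kappa>\<^sub>0 * h)" .
    qed
    also have "\<dots> = h * (q * \<kappa>\<^sub>0 + 2 * (C\<^sub>R * h powr \<alpha>))" unfolding hp by (simp add: algebra_simps)
    also have "\<dots> \<le> h * (q * \<kappa>\<^sub>0 + (1 - q) * \<kappa>\<^sub>0)" using small(2) h by (intro mult_left_mono add_left_mono) auto
    also have "\<dots> = \<kappa>\<^sub>0 * h" by (simp add: algebra_simps)
    finally show ?thesis using TZ[OF Q] by (simp add: U_def nbhd_def)
  qed
  show "\<forall>Q\<in>U. is_singleton (nearest m d ?B (?R Q))" "\<forall>Q\<in>U. T Q \<in> U"
    "\<forall>Q\<in>U. \<forall>Q'\<in>U. hnorm m d (T Q - T Q') \<le> q * hnorm m d (Q - Q')"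
    using sing self contr by blast+
  have "0 \<le> \<kappa>\<^sub>0 * h" using \<kappa>(1) h by simp
  from contraction_fixed_point[OF PhatZ this, of T q, folded U_def, OF self less_imp_le[OF q01(1)] q01(2) contr]
  obtain Pstar where star: "Pstar \<in> U" "T Pstar = Pstar" "\<forall>Q\<in>U. T Q = Q \<longrightarrow> Q = Pstar"
      "\<forall>P0\<in>U. (\<forall>n. hnorm m d ((T ^^ n) P0 - Pstar) \<le> q ^ n * hnorm m d (P0 - Pstar)) \<and>
         (\<lambda>n. hnorm m d ((T ^^ n) P0 - Pstar)) \<longlonglongrightarrow> 0"
    by blast
  have "hnorm m d (Pstar - Phat) \<le> 2 * C\<^sub>R / (1 - q) * h powr (1 + \<alpha>)"
  proof -
    have "hnorm m d (Pstar - Phat) \<le> hnorm m d (T Pstar - T Phat) + hnorm m d (T Phat - Phat)"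
      using hnorm_triangle[of Pstar Phat "T Phat"] star(2) by simp
    also have "\<dots> \<le> q * hnorm m d (Pstar - Phat) + 2 * (C\<^sub>R * h powr (1 + \<alpha>))"
      by (intro add_mono base contr star(1) PhatU)
    finally have "(1 - q) * hnorm m d (Pstar - Phat) \<le> 2 * C\<^sub>R * h powr (1 + \<alpha>)" by (simp add: algebra_simps)
    then show ?thesis using q01 by (simp add: field_simps)
  qed
  then show "\<exists>Pstar\<in>U. T Pstar = Pstar \<and> (\<forall>Q\<in>U. T Q = Q \<longrightarrow> Q = Pstar) \<and>
            (\<forall>P0\<in>U.
               (\<forall>n. hnorm m d ((T ^^ n) P0 - Pstar) \<le> q ^ n * hnorm m d (P0 - Pstar)) \<and>
               (\<lambda>n. hnorm m d ((T ^^ n) P0 - Pstar)) \<longlonglongrightarrow> 0) \<and>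
            hnorm m d (Pstar - Phat) \<le> 2 * C\<^sub>R / (1 - q) * h powr (1 + \<alpha>)"
    using star by blast
qed

lemma det_cof: "det (cof A) = det A"
  by (simp add: det_2 cof_component)

lemma cof_Sym2: "A \<in> Sym2 \<Longrightarrow> cof A \<in> Sym2"
  by (simp add: Sym2_iff cof_component)

text \<open>Collects the mesh-independent constants.  The oscillation \<open>\<eta>\<close> demanded by the stability estimate is
  reached for small mesh sizes because the exact Hessian is uniformly continuous on the compact closure of
  the domain.\<close>

lemma uniform_stability:
  fixes D :: "'i \<Rightarrow> discretization" and W :: "plane \<Rightarrow> mat2"
  assumes meshes: "\<And>i. mesh_of \<Omega> (cells (D i))" and cpt: "compact (closure \<Omega>)"
    and uni: "unisolvent m xhat" and aff: "\<And>i. affine_nodes m xhat (D i)"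
    and shape: "shape_regular D" and weights: "weights_ok m D"
    and rec: "\<And>i. reconstruction_ok m (D i)"
    and W: "continuous_on (closure \<Omega>) W"
      "\<forall>x\<in>closure \<Omega>. W x \<in> Sym2 \<and> c\<^sub>0 \<le> det (W x) \<and> norm (W x) \<le> b"
    and c0: "0 < c\<^sub>0" and b: "0 < b"
    and A2: "\<exists>C>0. \<forall>i. \<forall>v\<in>Xspace (D i).
          broken_L2 (D i) (Hess (D i) v)
            \<le> broken_L2 (D i) (\<lambda>K x. trace (Hess (D i) v K x)) + C * sqrt (Jform (D i) v v)"
  shows "\<exists>K\<^sub>0>0. \<exists>h\<^sub>1>0. \<forall>i. meshsize (D i) \<le> h\<^sub>1 \<longrightarrow> (\<forall>w\<in>Xspace (D i).
      (hnorm m (D i) (Hess (D i) w))\<^sup>2 \<le> K\<^sub>0 * (Jform (D i) w w +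
        (\<Sum>n\<in>nodal_discretization.nodes m (D i). nodal_discretization.wt (D i) n *
          (cof (W (pts (D i) (fst n) (snd n))) \<bullet> nodal_discretization.nval (D i) (Hess (D i) w) n)\<^sup>2)))"
proof -
  obtain \<gamma> where \<gamma>: "0 < \<gamma>" "\<forall>i. \<forall>K\<in>cells (D i). \<exists>x. cball x (\<gamma> * diameter K) \<subseteq> K"
    using shape unfolding shape_regular_def by blast
  obtain c C where c: "0 < c" "0 < C" and w: "\<forall>i. \<forall>K\<in>cells (D i). \<forall>j<Npoly m.
        0 < weight (D i) K j \<and>
        c * (diameter K)\<^sup>2 \<le> weight (D i) K j \<and> weight (D i) K j \<le> C * (diameter K)\<^sup>2"
    using weights unfolding weights_ok_def by (elim exE conjE) (rule that)
  obtain C\<^sub>J where CJ: "0 < C\<^sub>J" "\<forall>i. \<forall>v\<in>Xspace (D i).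
          broken_L2 (D i) (Hess (D i) v)
            \<le> broken_L2 (D i) (\<lambda>K x. trace (Hess (D i) v K x)) + C\<^sub>J * sqrt (Jform (D i) v v)"
    using A2 by (elim exE conjE) (rule that)
  obtain M where M: "0 < M" "\<forall>(A::mat2) b x. let F = (\<lambda>x. A *v x + b); K = F ` ref_triangle in
     0 < diameter K \<longrightarrow> cball x (\<gamma> * diameter K) \<subseteq> K \<longrightarrow>
     (\<forall>p\<in>polys m (UNIV :: real set).
        (LINT x|lebesgue_on K. (p x)\<^sup>2) \<le> M * ((diameter K)\<^sup>2 * (\<Sum>j<Npoly m. (p (F (xhat j)))\<^sup>2)) \<and>
        (diameter K)\<^sup>2 * (\<Sum>j<Npoly m. (p (F (xhat j)))\<^sup>2) \<le> M * (LINT x|lebesgue_on K. (p x)\<^sup>2))"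
    using cell_norm_equivalence[OF uni \<gamma>(1)] by (elim exE conjE) (rule that)
  have norms: "(LINT x|lebesgue_on K. (p x)\<^sup>2) \<le> M * ((diameter K)\<^sup>2 * (\<Sum>j<Npoly m. (p (pts (D i) K j))\<^sup>2)) \<and>
        (diameter K)\<^sup>2 * (\<Sum>j<Npoly m. (p (pts (D i) K j))\<^sup>2) \<le> M * (LINT x|lebesgue_on K. (p x)\<^sup>2)"
    if K: "K \<in> cells (D i)" and p: "p \<in> polys m UNIV" for i K and p :: "plane \<Rightarrow> real"
  proof -
    obtain A :: mat2 and a where A: "(\<lambda>x. A *v x + a) ` ref_triangle = K" "\<forall>j<Npoly m. pts (D i) K j = A *v xhat j + a"
      using aff[of i] K by (auto simp: affine_nodes_def)
    obtain x where x: "cball x (\<gamma> * diameter K) \<subseteq> K" using \<gamma>(2) K by blast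
    have "(\<Sum>j<Npoly m. (p (pts (D i) K j))\<^sup>2) = (\<Sum>j<Npoly m. (p (A *v xhat j + a))\<^sup>2)"
      using A(2) by simp
    then show ?thesis
      using M(2)[rule_format, of A a x] cell_facts(2)[OF meshes K] x p unfolding Let_def A(1) by simp
  qed
  define \<delta> where "\<delta> = 2 * c\<^sub>0 / b\<^sup>2"
  define E\<^sub>1 where "E\<^sub>1 = C * M * (1 + \<delta>\<^sup>2) * ((1 + 1 / \<delta>) / c\<^sub>0) * (M / c * 2) / \<delta> ^ 4"
  define E\<^sub>2 where "E\<^sub>2 = C * M * (1 + 1 / \<delta>\<^sup>2) * C\<^sub>J\<^sup>2 / \<delta> ^ 4"
  have \<delta>0: "0 < \<delta>" using c0 b by (simp add: \<delta>_def)
  have E: "0 \<le> E\<^sub>1" "0 \<le> E\<^sub>2"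
    unfolding E\<^sub>1_def E\<^sub>2_def using \<delta>0 c M(1) c0 by simp_all
  define \<eta> where "\<eta> = sqrt (1 / (2 * (E\<^sub>1 + 1)))"
  have \<eta>: "0 < \<eta>" "E\<^sub>1 * \<eta>\<^sup>2 \<le> 1 / 2" using E by (simp_all add: \<eta>_def field_simps)
  obtain \<tau> where \<tau>: "0 < \<tau>"
    "\<And>x x'. x \<in> closure \<Omega> \<Longrightarrow> x' \<in> closure \<Omega> \<Longrightarrow> dist x' x < \<tau> \<Longrightarrow> dist (W x') (W x) < \<eta>"
    using compact_uniformly_continuous[OF W(1) cpt] \<eta>(1) unfolding uniformly_continuous_on_def by metis
  show ?thesis
  proof (rule exI[of _ "2 * (E\<^sub>1 + E\<^sub>2) + 1"], intro conjI exI[of _ "\<tau> / 2"] allI impI ballI)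
    fix i v assume h: "meshsize (D i) \<le> \<tau> / 2" and v: "v \<in> Xspace (D i)"
    interpret nodal_discretization m "D i"
    proof (rule mesh_nodal_discretization[OF meshes uni aff \<gamma>(1)])
      show "\<exists>x. cball x (\<gamma> * diameter K) \<subseteq> K" if "K \<in> cells (D i)" for K using \<gamma>(2) that by blast
      show "0 < weight (D i) K j" if "K \<in> cells (D i)" "j < Npoly m" for K j using w that by blast
    qed
    have inK: "pts (D i) K j \<in> K" "pts (D i) K j \<in> closure \<Omega>" if "K \<in> cells (D i)" "j < Npoly m" for K j
      using pts_in_cell[OF uni aff that] cell_facts(4)[OF meshes that(1)] by auto
    let ?N = "\<lambda>n. cof (W (pts (D i) (fst n) (snd n)))"
    define R where "R = (\<Sum>n\<in>nodes. wt n * (?N n \<bullet> nval (Hess (D i) v) n)\<^sup>2)"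
    have J: "0 \<le> Jform (D i) v v" using rec[of i] v by (simp add: reconstruction_ok_def)
    have "(hnorm m (D i) (Hess (D i) v))\<^sup>2 \<le> 2 * (E\<^sub>1 + E\<^sub>2) * (Jform (D i) v v + R)"
      unfolding R_def
    proof (rule broken_stability[where B = "\<lambda>K. cof (W (pts (D i) K 0))" and \<eta> = \<eta> and b = b, OF _ J M(1) _ _ c _ _ _ c0 b])
      show "Hess (D i) v \<in> Zspace m (D i) Sym2" using rec[of i] v by (simp add: reconstruction_ok_def)
      show "norm (?N n - cof (W (pts (D i) (fst n) 0))) \<le> \<eta>" if n: "n \<in> nodes" for n
      proof -
        have K: "fst n \<in> cells (D i)" and j: "snd n < Npoly m" using n by (auto simp: nodes_def)
        have "dist (pts (D i) (fst n) (snd n)) (pts (D i) (fst n) 0) \<le> diameter (fst n)"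
          by (intro diameter_bounded_bound compact_imp_bounded cell_facts(1)[OF meshes K] inK K j Npoly_pos)
        also have "\<dots> < \<tau>" using cell_facts(3)[OF meshes K] h \<tau>(1) by linarith
        finally have "dist (W (pts (D i) (fst n) (snd n))) (W (pts (D i) (fst n) 0)) < \<eta>"
          by (intro \<tau>(2) inK K j Npoly_pos)
        then show ?thesis by (simp add: cof_diff[symmetric] norm_cof dist_norm)
      qed
      show "broken_L2 (D i) (Hess (D i) v)
            \<le> broken_L2 (D i) (\<lambda>K x. trace (Hess (D i) v K x)) + C\<^sub>J * sqrt (Jform (D i) v v)"
        using CJ(2) v by blast
    qed (use norms w CJ(1) \<eta>(2) bspec[OF W(2) inK(2)[OF _ Npoly_pos]] cell_facts(1)[OF meshes]
        in \<open>simp_all add: det_cof cof_Sym2 norm_cof \<delta>_def[symmetric] E\<^sub>1_def E\<^sub>2_def\<close>)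
    also have "\<dots> \<le> (2 * (E\<^sub>1 + E\<^sub>2) + 1) * (Jform (D i) v v + R)"
    proof (intro mult_right_mono add_nonneg_nonneg J)
      show "0 \<le> R" unfolding R_def by (intro sum_nonneg mult_nonneg_nonneg) (auto dest: wt_pos)
    qed simp
    finally show "(hnorm m (D i) (Hess (D i) v))\<^sup>2 \<le> (2 * (E\<^sub>1 + E\<^sub>2) + 1) *
        (Jform (D i) v v + (\<Sum>n\<in>nodes. wt n * (?N n \<bullet> nval (Hess (D i) v) n)\<^sup>2))"
      unfolding R_def .
  qed (use E \<tau>(1) in auto)
qed

theorem theorem4p1:
  fixes \<Omega> :: "plane set" and m :: nat and xhat :: "nat \<Rightarrow> plane"
    and D :: "'i \<Rightarrow> discretization" and \<sigma> \<alpha> :: real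
    and f g u :: "plane \<Rightarrow> real" and D2u :: "plane \<Rightarrow> mat2"
  assumes domain: "convex_polygonal_domain \<Omega>"
    and meshes: "\<And>i. mesh_of \<Omega> (cells (D i))"
    and "shape_regular D" and "quasi_uniform D"
    and nodes: "unisolvent m xhat" "\<And>i. affine_nodes m xhat (D i)"
    and weights: "weights_ok m D"
    and reconstruction: "\<And>i. reconstruction_ok m (D i)" "\<sigma> > 0"
    and A1: "exact_solution \<Omega> m f g u D2u"
    and A2: "\<exists>C>0. \<forall>i. \<forall>v\<in>Xspace (D i).
          broken_L2 (D i) (Hess (D i) v)
            \<le> broken_L2 (D i) (\<lambda>K x. trace (Hess (D i) v K x)) + C * sqrt (Jform (D i) v v)"
    and A3: "\<alpha> > 0"
      "\<exists>C\<^sub>R>0. \<forall>i.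
          hnorm m (D i) (Rmap m \<sigma> (D i) (interp_mat m (D i) D2u) - interp_mat m (D i) D2u)
            \<le> C\<^sub>R * meshsize (D i) powr (1 + \<alpha>)"
  shows "\<exists>\<kappa>\<^sub>0>0. \<exists>h\<^sub>0>0. \<exists>q>0. q < 1 \<and> (\<exists>C>0. \<forall>i. meshsize (D i) \<le> h\<^sub>0 \<longrightarrow>
     (let d = D i; h = meshsize d; Phat = interp_mat m d D2u;
          U = nbhd m d Phat (\<kappa>\<^sub>0 * h); T = Tmap m \<sigma> d f
      in (\<forall>Q\<in>U. is_singleton (nearest m d (Bset m d f) (Rmap m \<sigma> d Q))) \<and>
         (\<forall>Q\<in>U. T Q \<in> U) \<and>
         (\<forall>Q\<in>U. \<forall>Q'\<in>U. hnorm m d (T Q - T Q') \<le> q * hnorm m d (Q - Q')) \<and>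
         (\<exists>Pstar\<in>U. T Pstar = Pstar \<and> (\<forall>Q\<in>U. T Q = Q \<longrightarrow> Q = Pstar) \<and>
            (\<forall>P0\<in>U.
               (\<forall>n. hnorm m d ((T ^^ n) P0 - Pstar) \<le> q ^ n * hnorm m d (P0 - Pstar)) \<and>
               (\<lambda>n. hnorm m d ((T ^^ n) P0 - Pstar)) \<longlonglongrightarrow> 0) \<and>
            hnorm m d (Pstar - Phat) \<le> C * h powr (1 + \<alpha>))))"
proof -
  have cpt: "compact (closure \<Omega>)" by (rule exact_solution_bounds(1)[OF domain A1])
  obtain c\<^sub>0 b where c0: "0 < c\<^sub>0" and b: "0 < b"
    and sol: "\<forall>x\<in>closure \<Omega>. D2u x \<in> det_surface (f x) \<and> c\<^sub>0 \<le> f x \<and> norm (D2u x) \<le> b"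
    using exact_solution_bounds(2)[OF domain A1] by (elim exE conjE) (rule that)
  have cont: "continuous_on (closure \<Omega>) D2u" using A1 unfolding exact_solution_def by (elim conjE)
  have W: "\<forall>x\<in>closure \<Omega>. D2u x \<in> Sym2 \<and> c\<^sub>0 \<le> det (D2u x) \<and> norm (D2u x) \<le> b"
    using sol by (simp add: det_surface_def SPD2_def)
  obtain K\<^sub>0 h\<^sub>1 where K0: "0 < K\<^sub>0" and h1: "0 < h\<^sub>1"
    and stab: "\<forall>i. meshsize (D i) \<le> h\<^sub>1 \<longrightarrow> (\<forall>w\<in>Xspace (D i).
      (hnorm m (D i) (Hess (D i) w))\<^sup>2 \<le> K\<^sub>0 * (Jform (D i) w w +
        (\<Sum>n\<in>nodal_discretization.nodes m (D i). nodal_discretization.wt (D i) n *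
          (cof (D2u (pts (D i) (fst n) (snd n))) \<bullet> nodal_discretization.nval (D i) (Hess (D i) w) n)\<^sup>2)))"
    using uniform_stability[OF meshes cpt nodes assms(3) weights reconstruction(1) cont W c0 b A2]
    by (elim exE conjE) (rule that)
  obtain \<gamma> where \<gamma>: "0 < \<gamma>" "\<forall>i. \<forall>K\<in>cells (D i). \<exists>x. cball x (\<gamma> * diameter K) \<subseteq> K"
    using assms(3) unfolding shape_regular_def by blast
  obtain \<gamma>' where \<gamma>': "0 < \<gamma>'" "\<forall>i. \<forall>K\<in>cells (D i). \<gamma>' * meshsize (D i) \<le> diameter K"
    using assms(4) unfolding quasi_uniform_def by blast
  obtain c C where c: "0 < c" and w: "\<forall>i. \<forall>K\<in>cells (D i). \<forall>j<Npoly m.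
        0 < weight (D i) K j \<and>
        c * (diameter K)\<^sup>2 \<le> weight (D i) K j \<and> weight (D i) K j \<le> C * (diameter K)\<^sup>2"
    using weights unfolding weights_ok_def by (elim exE conjE) (rule that)
  obtain C\<^sub>R where CR: "0 < C\<^sub>R" "\<forall>i.
          hnorm m (D i) (Rmap m \<sigma> (D i) (interp_mat m (D i) D2u) - interp_mat m (D i) D2u)
            \<le> C\<^sub>R * meshsize (D i) powr (1 + \<alpha>)"
    using A3(2) by (elim exE conjE) (rule that)
  define K\<^sub>1 where "K\<^sub>1 = 1 + K\<^sub>0 * (1 / (2 * \<sigma>) + 2 * b\<^sup>2 + 2)"
  define \<beta> where "\<beta> = 1 / (8 * K\<^sub>1)"
  define q where "q = 1 / sqrt (1 + 1 / (4 * K\<^sub>1))"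
  \<comment> \<open>\<open>\<epsilon>\<close> is the nodal distance to the surface in which projections are controlled; half of it is
    spent on the neighbourhood, the other half on the consistency error.\<close>
  define \<epsilon> where "\<epsilon> = min (\<beta> * sqrt c\<^sub>0) (\<beta> / 2)"
  define s where "s = sqrt c * \<gamma>'"
  define \<kappa>\<^sub>0 where "\<kappa>\<^sub>0 = s * \<epsilon> / 2"
  have "0 \<le> K\<^sub>0 * (1 / (2 * \<sigma>) + 2 * b\<^sup>2 + 2)" using K0 reconstruction(2) by simp
  then have K1: "0 < K\<^sub>1" unfolding K\<^sub>1_def by linarith
  have \<beta>: "0 < \<beta>" using K1 by (simp add: \<beta>_def)
  have q: "0 < q" "q < 1"
    unfolding q_def using K1 by (intro inverse_sqrt_less_1; simp)+
  have \<epsilon>: "0 < \<epsilon>" "\<epsilon> \<le> \<beta> * sqrt c\<^sub>0" "2 * \<epsilon> \<le> \<beta>" using \<beta> c0 by (auto simp: \<epsilon>_def)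
  have s: "0 < s" using c \<gamma>'(1) by (simp add: s_def)
  have \<kappa>: "0 < \<kappa>\<^sub>0" using s \<epsilon> by (simp add: \<kappa>\<^sub>0_def)
  \<comment> \<open>On the scale of the mesh size the consistency error must be below both the admissible nodal
    distance and the room that the contraction leaves inside the neighbourhood.\<close>
  define \<tau> where "\<tau> = min (s * \<epsilon> / 2) ((1 - q) * \<kappa>\<^sub>0 / 2) / C\<^sub>R"
  have "0 < \<tau>" using s \<epsilon> q \<kappa> CR(1) by (simp add: \<tau>_def)
  then obtain h\<^sub>2 where h2: "0 < h\<^sub>2" "\<forall>h. 0 \<le> h \<longrightarrow> h \<le> h\<^sub>2 \<longrightarrow> h powr \<alpha> \<le> \<tau>"
    using small_powr[OF A3(1)] by blast
  have goal: "let d = D i; h = meshsize d; Phat = interp_mat m d D2u;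
          U = nbhd m d Phat (\<kappa>\<^sub>0 * h); T = Tmap m \<sigma> d f
      in (\<forall>Q\<in>U. is_singleton (nearest m d (Bset m d f) (Rmap m \<sigma> d Q))) \<and>
         (\<forall>Q\<in>U. T Q \<in> U) \<and>
         (\<forall>Q\<in>U. \<forall>Q'\<in>U. hnorm m d (T Q - T Q') \<le> q * hnorm m d (Q - Q')) \<and>
         (\<exists>Pstar\<in>U. T Pstar = Pstar \<and> (\<forall>Q\<in>U. T Q = Q \<longrightarrow> Q = Pstar) \<and>
            (\<forall>P0\<in>U.
               (\<forall>n. hnorm m d ((T ^^ n) P0 - Pstar) \<le> q ^ n * hnorm m d (P0 - Pstar)) \<and>
               (\<lambda>n. hnorm m d ((T ^^ n) P0 - Pstar)) \<longlonglongrightarrow> 0) \<and>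
            hnorm m d (Pstar - Phat) \<le> 2 * C\<^sub>R / (1 - q) * h powr (1 + \<alpha>))"
    if h: "meshsize (D i) \<le> min h\<^sub>1 h\<^sub>2" for i
  proof -
    interpret nodal_discretization m "D i"
    proof (rule mesh_nodal_discretization[OF meshes nodes \<gamma>(1)])
      show "\<exists>x. cball x (\<gamma> * diameter K) \<subseteq> K" if "K \<in> cells (D i)" for K using \<gamma>(2) that by blast
      show "0 < weight (D i) K j" if "K \<in> cells (D i)" "j < Npoly m" for K j using w that by blast
    qed
    have un: "\<Union>(cells (D i)) = closure \<Omega>" using meshes[of i] by (simp add: mesh_of_def)
    have "\<Omega> \<noteq> {}" using domain by (simp add: convex_polygonal_domain_def)
    then have "closure \<Omega> \<noteq> {}" by simp
    then have "cells (D i) \<noteq> {}" unfolding un[symmetric] by auto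
    then obtain K where K: "K \<in> cells (D i)" by blast
    have h0: "0 < meshsize (D i)" using cell_facts(2,3)[OF meshes K] by linarith
    have nd: "fst n \<in> cells (D i)" "snd n < Npoly m" "pts (D i) (fst n) (snd n) \<in> closure \<Omega>" if "n \<in> local.nodes" for n
    proof -
      show K: "fst n \<in> cells (D i)" and j: "snd n < Npoly m" using that by (auto simp: nodes_def)
      show "pts (D i) (fst n) (snd n) \<in> closure \<Omega>"
        using pts_in_cell[OF nodes K j] cell_facts(4)[OF meshes K] by blast
    qed
    have st: "(hnorm m (D i) (Hess (D i) w))\<^sup>2 \<le> K\<^sub>0 * (Jform (D i) w w +
        (\<Sum>n\<in>local.nodes. wt n * (cof (D2u (pts (D i) (fst n) (snd n))) \<bullet> nval (Hess (D i) w) n)\<^sup>2))"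
      if "w \<in> Xspace (D i)" for w
      using stab h that by simp
    have \<epsilon>n: "\<epsilon> \<le> \<beta> * sqrt (f (pts (D i) (fst n) (snd n)))" if "n \<in> local.nodes" for n
    proof -
      have "sqrt c\<^sub>0 \<le> sqrt (f (pts (D i) (fst n) (snd n)))" using bspec[OF sol nd(3)[OF that]] by simp
      then have "\<beta> * sqrt c\<^sub>0 \<le> \<beta> * sqrt (f (pts (D i) (fst n) (snd n)))" using \<beta> by (intro mult_left_mono) auto
      then show ?thesis using \<epsilon>(2) by linarith
    qed
    have sw: "(s * meshsize (D i))\<^sup>2 \<le> wt n" if "n \<in> local.nodes" for n
    proof -
      have "(s * meshsize (D i))\<^sup>2 = c * (\<gamma>' * meshsize (D i))\<^sup>2"
        using c by (simp add: s_def power_mult_distrib)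
      also have "\<dots> \<le> c * (diameter (fst n))\<^sup>2"
        using \<gamma>' nd(1)[OF that] c h0 by (intro mult_left_mono power_mono) auto
      also have "\<dots> \<le> wt n" unfolding wt_def using w nd(1,2)[OF that] by blast
      finally show ?thesis .
    qed
    have pw: "meshsize (D i) powr \<alpha> \<le> \<tau>" using h2(2) h h0 by simp
    have "C\<^sub>R * meshsize (D i) powr \<alpha> \<le> C\<^sub>R * \<tau>" using CR(1) pw by (intro mult_left_mono) auto
    also have "\<dots> = min (s * \<epsilon> / 2) ((1 - q) * \<kappa>\<^sub>0 / 2)" using CR(1) by (simp add: \<tau>_def)
    finally have small: "C\<^sub>R * meshsize (D i) powr \<alpha> \<le> s * \<epsilon> / 2"
        "2 * (C\<^sub>R * meshsize (D i) powr \<alpha>) \<le> (1 - q) * \<kappa>\<^sub>0" by auto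
    have surface_nodes: "D2u (pts (D i) (fst n) (snd n)) \<in> det_surface (f (pts (D i) (fst n) (snd n)))"
        "norm (D2u (pts (D i) (fst n) (snd n))) \<le> b" if "n \<in> local.nodes" for n
      using bspec[OF sol nd(3)[OF that]] by auto
    have \<kappa>le: "\<kappa>\<^sub>0 \<le> s * \<epsilon> / 2" by (simp add: \<kappa>\<^sub>0_def)
    note loc = local_convergence[where W = D2u and f = f and \<kappa>\<^sub>0 = \<kappa>\<^sub>0 and h = "meshsize (D i)" and \<alpha> = \<alpha>,
        OF reconstruction K0 st surface_nodes K\<^sub>1_def \<beta>_def \<epsilon>(1) \<epsilon>n \<epsilon>(3) q_def s sw h0 CR(2)[rule_format] \<kappa> \<kappa>le small]
    show ?thesis unfolding Let_def by (intro conjI loc)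
  qed
  have "0 < 2 * C\<^sub>R / (1 - q)" "0 < min h\<^sub>1 h\<^sub>2" using CR(1) q h1 h2(1) by simp_all
  then show ?thesis using \<kappa> q goal
    by (intro exI[of _ \<kappa>\<^sub>0] exI[of _ "min h\<^sub>1 h\<^sub>2"] exI[of _ q] exI[of _ "2 * C\<^sub>R / (1 - q)"] conjI allI impI)
qed

end
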